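(* Let $\mathbf{k}$ be an algebraically closed field of characteristic $0$ and let $p$ be a prime number. Let $(V,c)$ be a finite-dimensional braided pair of finite group type with Nichols rank $p^3$, i.e. $\dim\mathfrak{B}(V)=p^3$. Then $(V,c)$ is of diagonal group type, and for a suitable basis $\{x_1,\dots,x_n\}$ of $V$ with $c(x_i\otimes x_j)=q_{ij}x_j\otimes x_i$ it fits in one of the following possibilities: \begin{itemize} \item $\dim V=3$, $\mathfrak{B}(V)$ is a Quantum Linear Space, and $N(q_{11})=N(q_{22})=N(q_{33})=p$; \item $\dim V=2$, $\mathfrak{B}(V)$ is a Quantum Linear Space, and $N(q_{11})=p$, $N(q_{22})=p^2$; \item $\dim V=2$, $\mathfrak{B}(V)$ is of type $A_2$, and $q_{11}=q_{22}=(q_{12}q_{21})^{-1}$, $N(q_{11})=p$; \item $\dim V=1$, $\mathfrak{B}(V)$ is a Quantum Linear Space, and $N(q_{11})=p^3$. \end{itemize}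
   Context: A braided pair (BP) is a pair $(V,c)$ with $V$ a vector space and $c:V\otimes V\to V\otimes V$ a bijective solution of the braid equation. $(V,c)$ is of group type if $V$ has a basis $\{x_1,\dots,x_n\}$ and there are $g_i\in\mathrm{GL}(V)$ with $c(x_i\otimes x_j)=g_i(x_j)\otimes x_i$ for all $i,j$; it is of finite group type if moreover the group generated by $g_1,\dots,g_n$ is finite. It is of diagonal group type if there are a basis $\{x_i\}$ and a matrix $(q_{ij})$ with entries in $\mathbf{k}^\times$ with $c(x_i\otimes x_j)=q_{ij}x_j\otimes x_i$. For $q\in\mathbf{k}^\times$, $N(q)$ is the order of $q$ if $q\ne1$ is a root of unity, and $N(q)=\infty$ if $q=1$ or $q$ is not a root of unity. Nichols algebra. The braid group $\mathbb{B}_n$ (generators $\sigma_1,\dots,\sigma_{n-1}$) acts on $V^{\otimes n}$, $\sigma_i$ acting by $c$ in positions $i,i+1$. Let $s:\mathbb{S}_n\to\mathbb{B}_n$ be the set-theoretic section sending a reduced expression $\tau_{i_1}\cdots\tau_{i_l}$ ($\tau_i=(i\ i{+}1)$) to $\sigma_{i_1}\cdots\sigma_{i_l}$, and $\mathbf{S}^n=\sum_{x\in\mathbb{S}_n}s(x)$. The Nichols algebra $\mathfrak{B}(V)$ is the image of the graded map $\bigoplus_n\mathbf{S}^n$ from the tensor algebra of $V$ to the tensor coalgebra of $V$ (a map of braided Hopf algebras); as an algebra it is the quotient of the tensor algebra by $\bigoplus_n\ker\mathbf{S}^n$. The Nichols rank of $V$ is $\dim\mathfrak{B}(V)$. For $(V,c)$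 of diagonal group type, $\mathfrak{B}(V)$ is a Quantum Linear Space if $q_{ij}q_{ji}=1$ for all $i\neq j$. For a primitive element $x$, $\mathrm{Ad}_x(y)=xy-m(c(x\otimes y))$, with $m$ and $c$ the multiplication and braiding of $\mathfrak{B}(V)$. The nilpotency order of an endomorphism $T$ in $y\neq0$ is the number $r+1$ with $T^r(y)\ne0$, $T^{r+1}(y)=0$. For $\dim V=2$, $\mathfrak{B}(V)$ is of type $A_2$ if the matrix with $a_{ii}=2$, $a_{ij}=1-d_{ij}$ ($i\ne j$), where $d_{ij}$ is the nilpotency order of $\mathrm{Ad}_{x_i}$ on $x_j$ in $\mathfrak{B}(V)$, is the Cartan matrix of type $A_2$ (that is, $d_{12}=d_{21}=2$). *)

theory Defs
  imports
    "HOL-Computational_Algebra.Computational_Algebra"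
    "HOL-Algebra.Generated_Groups"
    "HOL-Combinatorics.Permutations"
    "HOL-Library.Function_Algebras"
    "HOL-Library.Extended_Nat"
begin

section \<open>Tensor powers\<close>

text \<open>
  Throughout, \<open>V\<close> is the type \<open>'v\<close> with scalar multiplication \<open>scale\<close>.  The tensor
  \<open>v\<^sub>1 \<otimes> \<dots> \<otimes> v\<^sub>n\<close> is realised as the multilinear form \<open>(f\<^sub>1, \<dots>, f\<^sub>n) \<mapsto> \<Prod>\<^sub>i f\<^sub>i(v\<^sub>i)\<close> on the dual
  space, and the \<open>n\<close>-th tensor power as the span of these forms.  Over a field
  this is a faithful model: it is multilinear, and tensors of linearly independent vectors
  are linearly independent (\<open>pure_linear_entry\<close> and \<open>independent_pure\<close> below).  The list
  argument makes all degrees live in one type, which then also contains the tensor algebra.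
\<close>

type_synonym ('k, 'v) tensor = "('v \<Rightarrow> 'k) list \<Rightarrow> 'k"

definition tscale :: "'k::field \<Rightarrow> ('k, 'v) tensor \<Rightarrow> ('k, 'v) tensor" where
  "tscale a t = (\<lambda>fs. a * t fs)"

definition pure :: "('k::field \<Rightarrow> 'v::ab_group_add \<Rightarrow> 'v) \<Rightarrow> 'v list \<Rightarrow> ('k, 'v) tensor" where
  "pure scale vs = (\<lambda>fs.
     if length fs = length vs \<and> (\<forall>f\<in>set fs. Vector_Spaces.linear scale (*) f)
     then \<Prod>i<length vs. (fs ! i) (vs ! i) else 0)"

definition tensor_power ::
  "('k::field \<Rightarrow> 'v::ab_group_add \<Rightarrow> 'v) \<Rightarrow> nat \<Rightarrow> ('k, 'v) tensor set" where
  "tensor_power scale n = module.span tscale (pure scale ` {vs. length vs = n})"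

definition tensor_algebra ::
  "('k::field \<Rightarrow> 'v::ab_group_add \<Rightarrow> 'v) \<Rightarrow> ('k, 'v) tensor set" where
  "tensor_algebra scale = module.span tscale (range (pure scale))"

definition tensor_mult ::
  "('k::field, 'v) tensor \<Rightarrow> ('k, 'v) tensor \<Rightarrow> ('k, 'v) tensor" where
  "tensor_mult s t = (\<lambda>fs. \<Sum>k\<le>length fs. s (take k fs) * t (drop k fs))"

definition degree_part :: "nat \<Rightarrow> ('k::field, 'v) tensor \<Rightarrow> ('k, 'v) tensor" where
  "degree_part n t = (\<lambda>fs. if length fs = n then t fs else 0)"

text \<open>
  \<open>braid_at c i\<close> is \<open>id\<^bsup>\<otimes>i\<^esup> \<otimes> c \<otimes> id\<close>, the action of \<open>c\<close> on the tensor factors \<open>i\<close> and \<open>i + 1\<close>,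
  factors being numbered from \<open>0\<close>: contracting the other factors against the given functionals
  leaves an element of \<open>V \<otimes> V\<close>, to which \<open>c\<close> is applied (see \<open>braid_at_pure\<close>).
\<close>

definition braid_at ::
  "(('k::field, 'v) tensor \<Rightarrow> ('k, 'v) tensor) \<Rightarrow> nat \<Rightarrow> ('k, 'v) tensor \<Rightarrow> ('k, 'v) tensor" where
  "braid_at c i t = (\<lambda>fs.
     if Suc i < length fs
     then c (\<lambda>gs. if length gs = 2 then t (take i fs @ gs @ drop (i + 2) fs) else 0)
            [fs ! i, fs ! Suc i]
     else t fs)"


section \<open>Braided pairs\<close>

definition braided_pair ::
  "('k::field \<Rightarrow> 'v::ab_group_add \<Rightarrow> 'v) \<Rightarrow> (('k, 'v) tensor \<Rightarrow> ('k, 'v) tensor) \<Rightarrow> bool" where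
  "braided_pair scale c \<longleftrightarrow>
     (\<forall>s\<in>tensor_power scale 2. \<forall>t\<in>tensor_power scale 2. c (s + t) = c s + c t) \<and>
     (\<forall>a. \<forall>t\<in>tensor_power scale 2. c (tscale a t) = tscale a (c t)) \<and>
     bij_betw c (tensor_power scale 2) (tensor_power scale 2) \<and>
     (\<forall>t\<in>tensor_power scale 3.
        braid_at c 0 (braid_at c 1 (braid_at c 0 t)) =
        braid_at c 1 (braid_at c 0 (braid_at c 1 t)))"

definition basis_family ::
  "('k::field \<Rightarrow> 'v::ab_group_add \<Rightarrow> 'v) \<Rightarrow> nat \<Rightarrow> (nat \<Rightarrow> 'v) \<Rightarrow> bool" where
  "basis_family scale n x \<longleftrightarrow>
     inj_on x {1..n} \<and> \<not> module.dependent scale (x ` {1..n}) \<and>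
     module.span scale (x ` {1..n}) = UNIV"

definition GL :: "('k::field \<Rightarrow> 'v::ab_group_add \<Rightarrow> 'v) \<Rightarrow> ('v \<Rightarrow> 'v) monoid" where
  "GL scale = \<lparr>carrier = {g. Vector_Spaces.linear scale scale g \<and> bij g},
               monoid.mult = (\<circ>), one = id\<rparr>"

definition group_braiding ::
  "('k::field \<Rightarrow> 'v::ab_group_add \<Rightarrow> 'v) \<Rightarrow> (('k, 'v) tensor \<Rightarrow> ('k, 'v) tensor) \<Rightarrow>
   nat \<Rightarrow> (nat \<Rightarrow> 'v) \<Rightarrow> (nat \<Rightarrow> 'v \<Rightarrow> 'v) \<Rightarrow> bool" where
  "group_braiding scale c n x g \<longleftrightarrow>
     basis_family scale n x \<and>
     (\<forall>i\<in>{1..n}. g i \<in> carrier (GL scale)) \<and>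
     (\<forall>i\<in>{1..n}. \<forall>j\<in>{1..n}. c (pure scale [x i, x j]) = pure scale [g i (x j), x i])"

definition finite_group_type ::
  "('k::field \<Rightarrow> 'v::ab_group_add \<Rightarrow> 'v) \<Rightarrow> (('k, 'v) tensor \<Rightarrow> ('k, 'v) tensor) \<Rightarrow> bool" where
  "finite_group_type scale c \<longleftrightarrow>
     (\<exists>n x g. group_braiding scale c n x g \<and> finite (generate (GL scale) (g ` {1..n})))"

definition diagonal_braiding ::
  "('k::field \<Rightarrow> 'v::ab_group_add \<Rightarrow> 'v) \<Rightarrow> (('k, 'v) tensor \<Rightarrow> ('k, 'v) tensor) \<Rightarrow>
   nat \<Rightarrow> (nat \<Rightarrow> 'v) \<Rightarrow> (nat \<Rightarrow> nat \<Rightarrow> 'k) \<Rightarrow> bool" where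
  "diagonal_braiding scale c n x q \<longleftrightarrow>
     basis_family scale n x \<and>
     (\<forall>i\<in>{1..n}. \<forall>j\<in>{1..n}. q i j \<noteq> 0) \<and>
     (\<forall>i\<in>{1..n}. \<forall>j\<in>{1..n}. c (pure scale [x i, x j]) = tscale (q i j) (pure scale [x j, x i]))"

definition diagonal_group_type ::
  "('k::field \<Rightarrow> 'v::ab_group_add \<Rightarrow> 'v) \<Rightarrow> (('k, 'v) tensor \<Rightarrow> ('k, 'v) tensor) \<Rightarrow> bool" where
  "diagonal_group_type scale c \<longleftrightarrow> (\<exists>n x q. diagonal_braiding scale c n x q)"

definition root_order :: "'k::field \<Rightarrow> enat" where
  "root_order q = (if q \<noteq> 1 \<and> (\<exists>n>0. q ^ n = 1) then enat (LEAST n. 0 < n \<and> q ^ n = 1) else \<infinity>)"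


section \<open>Nichols algebras\<close>

text \<open>
  Words \<open>[i\<^sub>1, \<dots>, i\<^sub>l]\<close> in the generators; \<open>\<S>\<^sub>n\<close> is the group of permutations of \<open>{..<n}\<close> and the
  letter \<open>i\<close> stands for the transposition of \<open>i\<close> and \<open>i + 1\<close>, or for the braid generator acting
  on the factors \<open>i\<close> and \<open>i + 1\<close>.
\<close>

definition word_perm :: "nat list \<Rightarrow> nat \<Rightarrow> nat" where
  "word_perm ws = foldr (\<lambda>i \<pi>. transpose i (Suc i) \<circ> \<pi>) ws id"

definition reduced_word :: "nat \<Rightarrow> (nat \<Rightarrow> nat) \<Rightarrow> nat list \<Rightarrow> bool" where
  "reduced_word n \<pi> ws \<longleftrightarrow>
     set ws \<subseteq> {i. Suc i < n} \<and> word_perm ws = \<pi> \<and>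
     (\<forall>us. set us \<subseteq> {i. Suc i < n} \<and> word_perm us = \<pi> \<longrightarrow> length ws \<le> length us)"

definition braid_word ::
  "(('k::field, 'v) tensor \<Rightarrow> ('k, 'v) tensor) \<Rightarrow> nat list \<Rightarrow> ('k, 'v) tensor \<Rightarrow> ('k, 'v) tensor" where
  "braid_word c ws t = foldr (braid_at c) ws t"

text \<open>The action of \<open>s(\<pi>)\<close>; by Matsumoto's theorem the choice of reduced word is immaterial.\<close>

definition matsumoto_lift ::
  "(('k::field, 'v) tensor \<Rightarrow> ('k, 'v) tensor) \<Rightarrow> nat \<Rightarrow> (nat \<Rightarrow> nat) \<Rightarrow>
   ('k, 'v) tensor \<Rightarrow> ('k, 'v) tensor" where
  "matsumoto_lift c n \<pi> = braid_word c (SOME ws. reduced_word n \<pi> ws)"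

definition quantum_symmetrizer ::
  "(('k::field, 'v) tensor \<Rightarrow> ('k, 'v) tensor) \<Rightarrow> nat \<Rightarrow> ('k, 'v) tensor \<Rightarrow> ('k, 'v) tensor" where
  "quantum_symmetrizer c n t = (\<Sum>\<pi> | \<pi> permutes {..<n}. matsumoto_lift c n \<pi> t)"

text \<open>The graded map \<open>\<Oplus>\<^sub>n S\<^sup>n\<close>; its \<open>n\<close>-th component is evaluated on lists of length \<open>n\<close>.\<close>

definition nichols_map ::
  "(('k::field, 'v) tensor \<Rightarrow> ('k, 'v) tensor) \<Rightarrow> ('k, 'v) tensor \<Rightarrow> ('k, 'v) tensor" where
  "nichols_map c t = (\<lambda>fs. quantum_symmetrizer c (length fs) (degree_part (length fs) t) fs)"

definition nichols_algebra ::
  "('k::field \<Rightarrow> 'v::ab_group_add \<Rightarrow> 'v) \<Rightarrow> (('k, 'v) tensor \<Rightarrow> ('k, 'v) tensor) \<Rightarrow>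
   ('k, 'v) tensor set" where
  "nichols_algebra scale c = nichols_map c ` tensor_algebra scale"

text \<open>
  The library dimension of an infinite-dimensional space is \<open>0\<close>; a positive value of the rank
  thus entails that the Nichols algebra is finite-dimensional.
\<close>

definition nichols_rank ::
  "('k::field \<Rightarrow> 'v::ab_group_add \<Rightarrow> 'v) \<Rightarrow> (('k, 'v) tensor \<Rightarrow> ('k, 'v) tensor) \<Rightarrow> nat" where
  "nichols_rank scale c = vector_space.dim tscale (nichols_algebra scale c)"

text \<open>
  On \<open>V \<otimes> V\<^bsup>\<otimes>n\<^esup>\<close> the braiding of the tensor algebra is the composite of \<open>c\<close> in the positions
  \<open>0, 1, \<dots>, n - 1\<close>, position \<open>0\<close> acting first.
\<close>

definition braid_past ::
  "(('k::field, 'v) tensor \<Rightarrow> ('k, 'v) tensor) \<Rightarrow> ('k, 'v) tensor \<Rightarrow> ('k, 'v) tensor" where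
  "braid_past c t =
     (\<lambda>fs. fold (braid_at c) [0..<length fs - 1] (degree_part (length fs) t) fs)"

definition tensor_Ad ::
  "('k::field \<Rightarrow> 'v::ab_group_add \<Rightarrow> 'v) \<Rightarrow> (('k, 'v) tensor \<Rightarrow> ('k, 'v) tensor) \<Rightarrow>
   'v \<Rightarrow> ('k, 'v) tensor \<Rightarrow> ('k, 'v) tensor" where
  "tensor_Ad scale c x t =
     tensor_mult (pure scale [x]) t - braid_past c (tensor_mult (pure scale [x]) t)"

text \<open>
  Multiplication and braiding of the Nichols algebra are induced from the tensor algebra along
  \<open>nichols_map\<close>, which is the quotient map onto the Nichols algebra.  Accordingly \<open>Ad\<^sub>x\<close>, for \<open>x \<in> V\<close>,
  is computed on a representative; the result does not depend on it, since the kernel is an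
  ideal compatible with the braiding.
\<close>

definition nichols_Ad ::
  "('k::field \<Rightarrow> 'v::ab_group_add \<Rightarrow> 'v) \<Rightarrow> (('k, 'v) tensor \<Rightarrow> ('k, 'v) tensor) \<Rightarrow>
   'v \<Rightarrow> ('k, 'v) tensor \<Rightarrow> ('k, 'v) tensor" where
  "nichols_Ad scale c x b =
     nichols_map c (tensor_Ad scale c x (SOME t. t \<in> tensor_algebra scale \<and> nichols_map c t = b))"

definition has_nilpotency_order :: "('a::zero \<Rightarrow> 'a) \<Rightarrow> 'a \<Rightarrow> nat \<Rightarrow> bool" where
  "has_nilpotency_order T y d \<longleftrightarrow>
     (\<exists>r. d = r + 1 \<and> (T ^^ r) y \<noteq> 0 \<and> (T ^^ (r + 1)) y = 0)"

definition quantum_linear_space :: "nat \<Rightarrow> (nat \<Rightarrow> nat \<Rightarrow> 'k::field) \<Rightarrow> bool" where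
  "quantum_linear_space n q \<longleftrightarrow> (\<forall>i\<in>{1..n}. \<forall>j\<in>{1..n}. i \<noteq> j \<longrightarrow> q i j * q j i = 1)"

text \<open>
  For two-dimensional \<open>V\<close> with basis \<open>x 1\<close>, \<open>x 2\<close>: the off-diagonal entries \<open>1 - d\<^sub>i\<^sub>j\<close> of the
  Cartan matrix are both \<open>-1\<close>.  In degree one the quotient map is the identity.
\<close>

definition type_A2 ::
  "('k::field \<Rightarrow> 'v::ab_group_add \<Rightarrow> 'v) \<Rightarrow> (('k, 'v) tensor \<Rightarrow> ('k, 'v) tensor) \<Rightarrow>
   (nat \<Rightarrow> 'v) \<Rightarrow> bool" where
  "type_A2 scale c x \<longleftrightarrow>
     has_nilpotency_order (nichols_Ad scale c (x 1)) (pure scale [x 2]) 2 \<and>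
     has_nilpotency_order (nichols_Ad scale c (x 2)) (pure scale [x 1]) 2"


section \<open>Adequacy of the model\<close>

lemma vector_space_tscale: "vector_space (tscale :: 'k::field \<Rightarrow> ('k, 'v) tensor \<Rightarrow> _)"
  by unfold_locales (auto simp: tscale_def fun_eq_iff algebra_simps)

interpretation tensor: vector_space "tscale :: 'k::field \<Rightarrow> ('k, 'v) tensor \<Rightarrow> ('k, 'v) tensor"
  by (rule vector_space_tscale)

lemma group_GL:
  assumes "vector_space scale"
  shows "group (GL scale)"
proof -
  interpret vector_space scale by fact
  interpret vector_space_pair scale scale ..
  show ?thesis
  proof (rule groupI)
    fix g assume g: "g \<in> carrier (GL scale)"
    then obtain h where h: "Vector_Spaces.linear scale scale h" "h \<circ> g = id"
      using linear_injective_left_inverse[of g] by (auto simp: GL_def bij_def)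
    then have "bij h"
      using g by (metis (no_types, lifting) GL_def bij_comp bij_id bij_imp_bij_inv comp_assoc
        comp_id mem_Collect_eq partial_object.select_convs(1) inv_o_cancel bij_is_surj surj_iff id_comp)
    then show "\<exists>h\<in>carrier (GL scale). h \<otimes>\<^bsub>GL scale\<^esub> g = \<one>\<^bsub>GL scale\<^esub>"
      using h by (intro bexI[of _ h]) (auto simp: GL_def)
  qed (auto simp: GL_def linear_id bij_comp o_assoc intro: Vector_Spaces.linear_compose)
qed

lemma pure_Nil: "pure scale [] fs = (if fs = [] then 1 else 0)"
  by (simp add: pure_def)

lemma pure_Cons_Nil: "pure scale (v # vs) [] = 0"
  by (simp add: pure_def)

lemma pure_Cons_Cons:
  "pure scale (v # vs) (f # fs) =
     (if Vector_Spaces.linear scale (*) f then f v else 0) * pure scale vs fs"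
  by (simp add: pure_def prod.lessThan_Suc_shift del: prod.lessThan_Suc)

lemmas pure_simps = pure_Nil pure_Cons_Nil pure_Cons_Cons

lemma pure_eq_0: "length fs \<noteq> length vs \<Longrightarrow> pure scale vs fs = 0"
  by (auto simp: pure_def)

lemma pure_append:
  "length fs = length us \<Longrightarrow> pure scale (us @ vs) (fs @ gs) = pure scale us fs * pure scale vs gs"
  by (induction fs us rule: list_induct2) (auto simp: pure_simps)

lemma pure_linear_entry:
  assumes "vector_space scale"
  shows "pure scale (us @ (scale a x + y) # ws) =
    tscale a (pure scale (us @ x # ws)) + pure scale (us @ y # ws)"
proof
  fix fs
  show "pure scale (us @ (scale a x + y) # ws) fs =
    (tscale a (pure scale (us @ x # ws)) + pure scale (us @ y # ws)) fs"
  proof (induction us arbitrary: fs)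
    case Nil
    show ?case
    proof (cases fs)
      case (Cons f gs)
      have "f (scale a x + y) = a * f x + f y" if "Vector_Spaces.linear scale (*) f"
        using that by (simp add: Vector_Spaces.linear.axioms module_hom.add module_hom.scale
            linear_iff_module_hom)
      then show ?thesis
        by (simp add: Cons pure_simps tscale_def algebra_simps)
    qed (simp add: pure_simps tscale_def)
  next
    case (Cons u us)
    then show ?case
      by (cases fs) (simp_all add: pure_simps tscale_def algebra_simps)
  qed
qed

lemma pure_dual:
  assumes "\<forall>b\<in>B. Vector_Spaces.linear scale (*) (d b) \<and> (\<forall>b'\<in>B. d b b' = (if b' = b then 1 else 0))"
    and "vs \<in> lists B" "ws \<in> lists B"
  shows "pure scale ws (map d vs) = (if ws = vs then 1 else 0)"
  using assms(2,3)
proof (induction vs arbitrary: ws)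
  case Nil
  then show ?case by (cases ws) (auto simp: pure_simps)
next
  case (Cons v vs)
  then show ?case using assms(1) by (cases ws) (auto simp: pure_simps)
qed

lemma independent_pure:
  assumes "vector_space scale" and "\<not> module.dependent scale B"
  shows "inj_on (pure scale) (lists B)" and "tensor.independent (pure scale ` lists B)"
proof -
  interpret V: vector_space scale by fact
  interpret P: vector_space_pair scale "(*) :: 'a \<Rightarrow> 'a \<Rightarrow> 'a"
    by unfold_locales (auto simp: algebra_simps)
  define d where "d b = P.construct B (\<lambda>b'. if b' = b then 1 else 0)" for b
  have d: "\<forall>b\<in>B. Vector_Spaces.linear scale (*) (d b) \<and>
      (\<forall>b'\<in>B. d b b' = (if b' = b then 1 else 0))"
    using assms(2) by (auto simp: d_def P.linear_construct P.construct_basis)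
  note dual = pure_dual[OF d]
  show inj: "inj_on (pure scale) (lists B)"
    by (rule inj_onI) (metis dual zero_neq_one)
  show "tensor.independent (pure scale ` lists B)"
  proof
    assume "tensor.dependent (pure scale ` lists B)"
    then obtain T u v where T: "finite T" "T \<subseteq> pure scale ` lists B"
      "(\<Sum>t\<in>T. tscale (u t) t) = 0" "v \<in> T" "u v \<noteq> 0"
      unfolding tensor.dependent_explicit by blast
    then obtain vs where vs: "vs \<in> lists B" "v = pure scale vs" by blast
    have "(\<Sum>t\<in>T. tscale (u t) t) fs = (\<Sum>t\<in>T. u t * t fs)" for fs
      using T(1) by (induction T rule: finite_induct) (auto simp: tscale_def)
    then have "0 = (\<Sum>t\<in>T. u t * t (map d vs))"
      using T(3) by (metis zero_fun_apply)
    also have "\<dots> = (\<Sum>t\<in>T. if t = v then u v else 0)"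
    proof (rule sum.cong)
      fix t assume "t \<in> T"
      then obtain ws where "ws \<in> lists B" "t = pure scale ws" using T(2) by blast
      then show "u t * t (map d vs) = (if t = v then u v else 0)"
        using dual[OF vs(1), of ws] inj_onD[OF inj _ _ vs(1), of ws] vs(2) by auto
    qed simp
    also have "\<dots> = u v"
      using T(1,4) by simp
    finally show False using T(5) by simp
  qed
qed

lemma tensor_mult_eval:
  assumes "\<And>gs. length gs \<noteq> m \<Longrightarrow> s gs = 0"
  shows "tensor_mult s t fs = (if m \<le> length fs then s (take m fs) * t (drop m fs) else 0)"
proof -
  have "tensor_mult s t fs =
    (\<Sum>k\<le>length fs. if k = m then s (take m fs) * t (drop m fs) else 0)"
    unfolding tensor_mult_def by (rule sum.cong) (auto simp: assms)
  then show ?thesis by simp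
qed

lemma tensor_mult_pure: "tensor_mult (pure scale us) (pure scale vs) = pure scale (us @ vs)"
proof
  fix fs
  show "tensor_mult (pure scale us) (pure scale vs) fs = pure scale (us @ vs) fs"
  proof (cases "length us \<le> length fs")
    case True
    then show ?thesis
      using pure_append[of "take (length us) fs" us scale vs "drop (length us) fs"]
      by (simp add: tensor_mult_eval[OF pure_eq_0])
  qed (auto simp: tensor_mult_eval[OF pure_eq_0] pure_eq_0)
qed

lemma tensor_power_eval:
  assumes "t \<in> tensor_power scale n" and "length fs \<noteq> n"
  shows "t fs = 0"
  using assms(1) unfolding tensor_power_def
proof (induction rule: tensor.span_induct_alt)
  case (step a x y)
  then show ?case using assms(2) by (auto simp: tscale_def pure_eq_0)
qed simp

lemma braid_at_pure:
  assumes "braided_pair scale c"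
  shows "braid_at c (length us) (pure scale (us @ [x, y] @ ws)) =
    tensor_mult (pure scale us) (tensor_mult (c (pure scale [x, y])) (pure scale ws))"
proof
  fix fs
  let ?u = "length us" and ?p = "pure scale [x, y]"
  have p: "?p \<in> tensor_power scale 2"
    unfolding tensor_power_def by (intro tensor.span_base imageI) simp
  have c_scale: "c (tscale a ?p) = tscale a (c ?p)" for a
    using assms p by (auto simp: braided_pair_def)
  have "c ?p \<in> tensor_power scale 2"
    using assms p by (auto simp: braided_pair_def bij_betw_def)
  note c_eval = tensor_power_eval[OF this]
  show "braid_at c ?u (pure scale (us @ [x, y] @ ws)) fs =
    tensor_mult (pure scale us) (tensor_mult (c ?p) (pure scale ws)) fs"
  proof (cases "Suc ?u < length fs")
    case True
    define a where "a = pure scale us (take ?u fs) * pure scale ws (drop (?u + 2) fs)"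
    have "pure scale (us @ [x, y] @ ws) (take ?u fs @ gs @ drop (?u + 2) fs) = a * ?p gs"
      if "length gs = 2" for gs
      using that True by (subst pure_append, simp, subst pure_append) (auto simp: a_def)
    then have slice: "(\<lambda>gs. if length gs = 2
        then pure scale (us @ [x, y] @ ws) (take ?u fs @ gs @ drop (?u + 2) fs) else 0) =
      tscale a ?p"
      by (auto simp: tscale_def fun_eq_iff pure_eq_0)
    have "take 2 (drop ?u fs) = [fs ! ?u, fs ! Suc ?u]"
      using True by (simp add: numeral_2_eq_2 take_Suc_conv_app_nth)
    then have "tensor_mult (pure scale us) (tensor_mult (c ?p) (pure scale ws)) fs =
        a * c ?p [fs ! ?u, fs ! Suc ?u]"
      using True by (simp add: tensor_mult_eval[OF pure_eq_0] tensor_mult_eval[OF c_eval]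
          a_def add.commute)
    moreover have "braid_at c ?u (pure scale (us @ [x, y] @ ws)) fs =
        tscale a (c ?p) [fs ! ?u, fs ! Suc ?u]"
      unfolding braid_at_def if_P[OF True] slice c_scale ..
    ultimately show ?thesis by (simp add: tscale_def)
  next
    case False
    then show ?thesis
      by (auto simp: braid_at_def pure_eq_0 tensor_mult_eval[OF pure_eq_0]
          tensor_mult_eval[OF c_eval])
  qed
qed

end

theory Submission
  imports Defs
begin

text \<open>
  Let \<open>x\<^sub>1, \<dots>, x\<^sub>n\<close> be a basis of \<open>V\<close> with \<open>c(x\<^sub>i \<otimes> v) = g\<^sub>i v \<otimes> x\<^sub>i\<close> and let \<open>\<xi>\<^sub>1, \<dots>, \<xi>\<^sub>n\<close> be the dual basis.
  Sorting the permutations by the factor that they move to the last place factorises the quantum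
  symmetriser of degree \<open>m + 1\<close> through the one of degree \<open>m\<close> (\<open>contract_quantum_symmetrizer\<close>).  Therefore
  contraction of the last tensor factor with \<open>\<xi>\<^sub>i\<close> is a skew derivation \<open>\<delta>\<^sub>i\<close> of the Nichols algebra \<open>B\<close>:
  \<open>\<delta>\<^sub>i (b x\<^sub>j) = \<delta>\<^sub>i\<^sub>j b + \<delta>\<^sub>i(b) g\<^sub>i(x\<^sub>j)\<close>, and an element without constant term that is killed by all \<open>\<delta>\<^sub>i\<close> is zero.
  This structure on \<open>B\<close> yields all bounds on \<open>dim B\<close> (locale \<open>nichols_calculus\<close>).

  As \<open>g\<^sub>i\<close> has finite order and preserves the component of \<open>V\<close> of degree \<open>g\<^sub>i\<close>, the basis can be chosen such that
  \<open>g\<^sub>i x\<^sub>i = q\<^sub>i\<^sub>i x\<^sub>i\<close>.  With \<open>Q = q\<^sub>i\<^sub>i\<close>, \<open>D = \<delta>\<^sub>i\<close> and the right multiplication \<open>R\<close> by \<open>x\<^sub>i\<close> satisfy a relation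
  \<open>D R = \<kappa> + Q R D\<close> with \<open>\<kappa> \<noteq> 0\<close>.  Such a pair, with \<open>D\<close> nilpotent, has two consequences.  The lengths of the Jordan
  blocks of \<open>D\<close> are multiples of \<open>N = N(Q)\<close>, so \<open>N\<close> divides \<open>dim B\<close> (\<open>weyl_pair_order_dvd_dim\<close>); and if
  \<open>D\<close> kills a subspace \<open>U\<close>, the sum of the \<open>R\<^sup>a U\<close> with \<open>a < N\<close> has dimension at least \<open>N dim U\<close>
  (\<open>dim_tower_ge\<close>).  Iterating the second one gives \<open>\<Prod>\<^sub>i N(q\<^sub>i\<^sub>i) \<le> dim B\<close>.  With \<open>dim B = p\<^sup>3\<close> it follows that
  all \<open>N(q\<^sub>i\<^sub>i)\<close> are powers of \<open>p\<close> and that \<open>dim V \<le> 3\<close>.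

  The \<open>g\<^sub>i\<close> commute: if \<open>g\<^sub>i\<close> and \<open>g\<^sub>j\<close> do not, then \<open>g\<^sub>i x\<^sub>j\<close> has a component along some \<open>x\<^sub>l\<close> with
  \<open>g\<^sub>l = g\<^sub>i g\<^sub>j g\<^sub>i\<^sup>-\<^sup>1\<close>, so \<open>i\<close>, \<open>j\<close>, \<open>l\<close> are distinct, \<open>dim V = 3\<close>, and the lower bound is attained.  Then the
  ordered monomials span \<open>B\<close>, but there is a linear form that vanishes on all of them and not on \<open>x\<^sub>i x\<^sub>j\<close>
  (\<open>no_three_cycle\<close>).  Commuting operators of finite order are simultaneously diagonalisable, and the braiding is
  diagonal.

  Let \<open>c(x\<^sub>i \<otimes> x\<^sub>j) = q\<^sub>i\<^sub>j x\<^sub>j \<otimes> x\<^sub>i\<close>.  If \<open>q\<^sub>i\<^sub>j q\<^sub>j\<^sub>i \<noteq> 1\<close>, right multiplication by the braided commutator of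
  \<open>x\<^sub>i\<close> and \<open>x\<^sub>j\<close> belongs to a further such pair with parameter \<open>q\<^sub>i\<^sub>i q\<^sub>i\<^sub>j q\<^sub>j\<^sub>i q\<^sub>j\<^sub>j\<close>, whose order is a power of \<open>p\<close> and contributes a further
  factor to the lower bound.  Hence \<open>dim V = 2\<close> and all three orders are \<open>p\<close>; an iterated commutator would
  contribute a factor 2, so both of them vanish, which forces the relations of type \<open>A\<^sub>2\<close>.  If all
  \<open>q\<^sub>i\<^sub>j q\<^sub>j\<^sub>i\<close> are 1 and \<open>dim V \<le> 2\<close>, the ordered monomials span \<open>B\<close>, and the orders multiply to \<open>p\<^sup>3\<close>.
\<close>

section \<open>Linear algebra of the q-Weyl relation\<close>

definition qint :: "nat \<Rightarrow> 'k::field \<Rightarrow> 'k" where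
  "qint m q = (\<Sum>i<m. q ^ i)"

lemma qint_0 [simp]: "qint 0 q = 0"
  by (simp add: qint_def)

lemma qint_Suc: "qint (Suc m) q = 1 + q * qint m q"
  unfolding qint_def sum.lessThan_Suc_shift by (simp add: sum_distrib_left)

lemma qint_eq_0_iff:
  fixes q :: "'k::field_char_0"
  shows "qint m q = 0 \<longleftrightarrow> m = 0 \<or> q \<noteq> 1 \<and> q ^ m = 1"
proof (cases "q = 1")
  case False
  then have "qint m q = (1 - q ^ m) / (1 - q)"
    using geometric_sum[of q m] by (simp add: qint_def divide_simps) (simp add: algebra_simps)
  then show ?thesis using False by auto
qed (simp add: qint_def)

lemma sum_lessThan_add:
  fixes f :: "nat \<Rightarrow> 'a::comm_monoid_add"
  shows "(\<Sum>j<a + b. f j) = (\<Sum>j<a. f j) + (\<Sum>j<b. f (a + j))"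
  by (induction b) (auto simp: add_ac)

text \<open>
  A copy of \<open>vector_space\<close>: definitions in \<open>vector_space\<close> itself are instantiated for real vector spaces
  at once, and their short names then refer to the real instances.
\<close>

locale vector_space_calculus = vector_space scale
  for scale :: "'a::field \<Rightarrow> 'b::ab_group_add \<Rightarrow> 'b"
begin

lemma scale_inverse_scale: "e \<noteq> 0 \<Longrightarrow> scale (inverse e) (scale e v) = v"
  by simp

text \<open>
  Only \<open>S\<close> is finite-dimensional here, not the ambient space: in the application this is the space of all
  tensors.
\<close>

lemma dim_finite_rank_nullity:
  assumes f: "Vector_Spaces.linear scale scale f" and S: "subspace S"
    and A: "finite A" "S \<subseteq> span A"
  shows "dim S = dim (f ` S) + dim {v \<in> S. f v = 0}"
proof -
  interpret vector_space_pair scale scale ..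
  let ?K = "{v \<in> S. f v = 0}"
  have K: "subspace ?K"
    using S f by (auto simp: subspace_def linear_0 linear_add linear_scale)
  obtain BK where BK: "BK \<subseteq> ?K" "independent BK" "?K \<subseteq> span BK"
    using maximal_independent_subset by blast
  obtain BS where BS: "BK \<subseteq> BS" "BS \<subseteq> S" "independent BS" "S \<subseteq> span BS"
    using maximal_independent_subset_extend[of BK S] BK by blast
  have fin: "finite BS"
    using independent_span_bound[OF A(1) BS(3)] BS(2) A(2) by blast
  define C where "C = BS - BK"
  have spanS: "span BS = S" "span BK = ?K"
    using BS BK S K by (auto simp: span_minimal subset_antisym)
  have C: "independent C" "C \<subseteq> S" "BS = C \<union> BK" "C \<inter> BK = {}"
    using BS independent_mono by (auto simp: C_def)
  have inj: "inj_on f (span C)"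
  proof -
    define pr where "pr = construct BS (\<lambda>b. if b \<in> C then b else 0)"
    have pr: "Vector_Spaces.linear scale scale pr"
      and pr_basis: "\<And>b. b \<in> BS \<Longrightarrow> pr b = (if b \<in> C then b else 0)"
      using BS(3) by (auto simp: pr_def linear_construct construct_basis)
    have pr_C: "pr x = x" if "x \<in> span C" for x
      using that C(3) linear_eq_on[OF pr linear_id that] pr_basis by auto
    have "pr b = 0" if "b \<in> BK" for b
      using that pr_basis C(3,4) by auto
    then have pr_K: "pr x = 0" if "x \<in> span BK" for x
      using linear_eq_0_on_span[OF pr _ that] by blast
    have "x = 0" if x: "x \<in> span C" "f x = 0" for x
    proof -
      have "x \<in> S" using x(1) span_minimal[OF C(2) S] by blast
      then have "x \<in> span BK" using x(2) spanS(2) by simp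
      then show "x = 0" using pr_K pr_C[OF x(1)] by simp
    qed
    then show ?thesis
      by (intro inj_onI) (metis f linear_diff eq_iff_diff_eq_0 span_diff)
  qed
  have fC: "independent (f ` C)"
    using linear_independent_injective_image[OF f C(1)] inj by blast
  have "f ` S = span (f ` C)"
  proof -
    have "f ` S = f ` span BS" by (simp add: spanS)
    also have "\<dots> = span (f ` BS)" by (rule linear_span_image[OF f, symmetric])
    also have "\<dots> = span (f ` C)"
    proof (rule subset_antisym)
      show "span (f ` BS) \<subseteq> span (f ` C)"
      proof (rule span_minimal)
        show "f ` BS \<subseteq> span (f ` C)"
          using BK(1) C(3) by (fastforce intro: span_base span_zero)
      qed simp
    qed (use C in \<open>auto intro!: span_mono\<close>)
    finally show ?thesis .
  qed
  then have "dim (f ` S) = card (f ` C)" using fC by (simp add: dim_eq_card_independent)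
  also have "\<dots> = card C"
    using inj_on_subset[OF inj span_superset] by (simp add: card_image)
  finally have "dim (f ` S) = card C" .
  moreover have "dim ?K = card BK" using BK(2) spanS by (metis dim_span_eq_card_independent)
  moreover have "dim S = card BS" using BS(3) spanS by (metis dim_span_eq_card_independent)
  moreover have "card BS = card C + card BK"
    using C fin by (metis card_Un_disjoint finite_Un)
  ultimately show ?thesis by simp
qed

lemma dim_mono_finite:
  assumes "subspace T" "finite A" "T \<subseteq> span A" "S \<subseteq> T"
  shows "dim S \<le> dim T"
proof -
  obtain BT where BT: "BT \<subseteq> T" "independent BT" "T \<subseteq> span BT" "card BT = dim T"
    using basis_exists by blast
  have "finite BT" using independent_span_bound[OF assms(2) BT(2)] BT(1) assms(3) by blast
  then show ?thesis using dim_le_card[of S BT] assms(4) BT by auto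
qed

lemma dim_eq_imp_eq:
  assumes "subspace T" "finite A" "T \<subseteq> span A" "subspace S" "S \<subseteq> T" "dim T \<le> dim S"
  shows "S = T"
proof -
  obtain BS where BS: "BS \<subseteq> S" "independent BS" "S \<subseteq> span BS" "card BS = dim S"
    using basis_exists by blast
  obtain BT where BT: "BS \<subseteq> BT" "BT \<subseteq> T" "independent BT" "T \<subseteq> span BT"
    using maximal_independent_subset_extend[of BS T] BS assms(5) by blast
  have fin: "finite BT" using independent_span_bound[OF assms(2) BT(3)] BT(2) assms(3) by blast
  have "card BT = dim T" using BT by (simp add: basis_card_eq_dim)
  then have "BS = BT" using card_subset_eq[OF fin BT(1)] card_mono[OF fin BT(1)] BS(4) assms(6) by simp
  then have "T \<subseteq> span BS" using BT by simp
  also have "\<dots> \<subseteq> S" using BS(1) assms(4) by (rule span_minimal)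
  finally show ?thesis using assms(5) by simp
qed

text \<open>
  The operators are linear on the whole space and the relation is imposed on \<open>B\<close> only: contractions of
  tensors are defined everywhere, whereas multiplication in the Nichols algebra makes sense on \<open>B\<close>.
\<close>

definition weyl_pair :: "'b set \<Rightarrow> ('b \<Rightarrow> 'b) \<Rightarrow> ('b \<Rightarrow> 'b) \<Rightarrow> 'a \<Rightarrow> 'a \<Rightarrow> bool" where
  "weyl_pair B D R \<kappa> Q \<longleftrightarrow>
     Vector_Spaces.linear scale scale D \<and> Vector_Spaces.linear scale scale R \<and> subspace B \<and>
     D ` B \<subseteq> B \<and> R ` B \<subseteq> B \<and> \<kappa> \<noteq> 0 \<and>
     (\<forall>b\<in>B. D (R b) = scale \<kappa> b + scale Q (R (D b)))"

lemma linear_funpow: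
  "Vector_Spaces.linear scale scale f \<Longrightarrow> Vector_Spaces.linear scale scale (f ^^ m)"
  by (induction m) (auto simp: linear_id Vector_Spaces.linear_compose simp del: funpow.simps(2) simp add: funpow_Suc_right)

lemma funpow_stable: "f ` B \<subseteq> B \<Longrightarrow> b \<in> B \<Longrightarrow> (f ^^ m) b \<in> B"
  by (induction m) auto

lemma weyl_pair_funpow_left:
  fixes \<kappa> Q :: 'a and D R :: "'b \<Rightarrow> 'b"
  assumes "weyl_pair B D R \<kappa> Q" "b \<in> B"
  shows "(D ^^ m) (R b) = scale (Q ^ m) (R ((D ^^ m) b)) + scale (\<kappa> * qint m Q) ((D ^^ (m - 1)) b)"
  using assms(2)
proof (induction m arbitrary: b)
  case (Suc m)
  have lin: "Vector_Spaces.linear scale scale (D ^^ m)"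
    using assms(1) by (auto simp: weyl_pair_def linear_funpow)
  interpret Dm: Vector_Spaces.linear scale scale "D ^^ m" by fact
  have Db: "D b \<in> B" using Suc.prems assms(1) by (auto simp: weyl_pair_def)
  have "(D ^^ Suc m) (R b) = (D ^^ m) (scale \<kappa> b + scale Q (R (D b)))"
    using assms(1) Suc.prems by (auto simp: weyl_pair_def funpow_swap1)
  also have "\<dots> = scale \<kappa> ((D ^^ m) b) + scale Q ((D ^^ m) (R (D b)))"
    by (simp add: Dm.add Dm.scale)
  also have "\<dots> = scale \<kappa> ((D ^^ m) b) + scale Q (scale (Q ^ m) (R ((D ^^ m) (D b))) +
      scale (\<kappa> * qint m Q) ((D ^^ (m - 1)) (D b)))"
    by (simp add: Suc.IH[OF Db])
  also have "\<dots> = scale (Q ^ Suc m) (R ((D ^^ Suc m) b)) +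
      (scale \<kappa> ((D ^^ m) b) + scale (Q * (\<kappa> * qint m Q)) ((D ^^ (m - 1)) (D b)))"
    by (simp add: scale_right_distrib funpow_swap1 algebra_simps)
  also have "scale \<kappa> ((D ^^ m) b) + scale (Q * (\<kappa> * qint m Q)) ((D ^^ (m - 1)) (D b)) =
     scale (\<kappa> * qint (Suc m) Q) ((D ^^ m) b)"
  proof (cases m)
    case (Suc k)
    then show ?thesis by (simp add: qint_Suc funpow_swap1 distrib_left scale_left_distrib mult_ac)
  qed (simp add: qint_Suc)
  finally show ?case by simp
qed auto

lemma weyl_pair_funpow_right:
  fixes \<kappa> Q :: 'a and D S :: "'b \<Rightarrow> 'b"
  assumes "weyl_pair B D S \<kappa> Q" "b \<in> B"
  shows "D ((S ^^ m) b) = scale (Q ^ m) ((S ^^ m) (D b)) + scale (\<kappa> * qint m Q) ((S ^^ (m - 1)) b)"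
proof (induction m)
  case (Suc m)
  interpret S: Vector_Spaces.linear scale scale S using assms(1) by (auto simp: weyl_pair_def)
  have "(S ^^ m) b \<in> B" using assms by (auto simp: weyl_pair_def intro: funpow_stable)
  then have "D ((S ^^ Suc m) b) = scale \<kappa> ((S ^^ m) b) + scale Q (S (D ((S ^^ m) b)))"
    using assms(1) by (auto simp: weyl_pair_def)
  also have "\<dots> = scale \<kappa> ((S ^^ m) b) + (scale (Q ^ Suc m) ((S ^^ Suc m) (D b)) +
      scale (Q * (\<kappa> * qint m Q)) (S ((S ^^ (m - 1)) b)))"
    by (simp add: Suc.IH S.scale S.add scale_right_distrib)
  also have "\<dots> = scale (Q ^ Suc m) ((S ^^ Suc m) (D b)) + scale (\<kappa> * qint (Suc m) Q) ((S ^^ m) b)"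
  proof (cases m)
    case (Suc k)
    then show ?thesis by (simp add: qint_Suc distrib_left scale_left_distrib mult_ac add_ac)
  qed (simp add: qint_Suc)
  finally show ?case by simp
qed simp

text \<open>
  Let \<open>v = D\<^sup>m b\<close> with \<open>D v = 0\<close>.  Then \<open>D\<^sup>m\<^sup>+\<^sup>1 (R b)\<close> is \<open>v\<close> times \<open>\<kappa>\<close> times the q-integer of
  \<open>m + 1\<close>, so \<open>v\<close> lies in the image of \<open>D\<^sup>m\<^sup>+\<^sup>1\<close> unless \<open>N\<close> divides \<open>m + 1\<close>: every Jordan block of \<open>D\<close> has a
  length divisible by \<open>N\<close>.  Here \<open>\<nu> m\<close> is the number of blocks longer than \<open>m\<close>.
\<close>

lemma weyl_pair_order_dvd_dim:
  fixes \<kappa> Q :: 'a and D R :: "'b \<Rightarrow> 'b"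
  assumes W: "weyl_pair B D R \<kappa> Q" and A: "finite A" "B \<subseteq> span A"
    and nil: "\<And>b. b \<in> B \<Longrightarrow> (D ^^ l) b = 0"
    and N: "\<And>m. qint m Q = 0 \<longleftrightarrow> N dvd m" "N > 0"
  shows "N dvd dim B"
proof -
  have D: "Vector_Spaces.linear scale scale D" and B: "subspace B" and DB: "D ` B \<subseteq> B" and RB: "R ` B \<subseteq> B"
    and k: "\<kappa> \<noteq> 0" and R: "Vector_Spaces.linear scale scale R"
    using W by (auto simp: weyl_pair_def)
  interpret D: Vector_Spaces.linear scale scale D by fact
  interpret R: Vector_Spaces.linear scale scale R by fact
  define I where "I m = (D ^^ m) ` B" for m
  have I_sub: "subspace (I m)" "I m \<subseteq> B" for m
    using D.subspace_image B DB funpow_stable[OF DB] linear_funpow[OF D, of m]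
    by (auto simp: I_def intro: module_hom.subspace_image Vector_Spaces.linear.axioms
        simp: linear_iff_module_hom)
  define \<nu> where "\<nu> m = dim {v \<in> I m. D v = 0}" for m
  have rn: "dim (I m) = dim (I (Suc m)) + \<nu> m" for m
    using dim_finite_rank_nullity[OF D I_sub(1)[of m] A(1)] I_sub(2)[of m] A(2)
    by (auto simp: I_def \<nu>_def image_image)
  have step: "\<nu> m = \<nu> (Suc m)" if "\<not> N dvd Suc m" for m
  proof -
    have "{v \<in> I m. D v = 0} = {v \<in> I (Suc m). D v = 0}"
    proof (intro subset_antisym subsetI)
      fix v assume "v \<in> {v \<in> I m. D v = 0}"
      then have v: "v \<in> I m" "D v = 0" by auto
      then obtain b where b: "b \<in> B" "v = (D ^^ m) b" by (auto simp: I_def)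
      have "(D ^^ Suc m) (R b) = scale (Q ^ Suc m) (R (D v)) + scale (\<kappa> * qint (Suc m) Q) v"
        using weyl_pair_funpow_left[OF W b(1), of "Suc m"] b(2) by simp
      then have "(D ^^ Suc m) (R b) = scale (\<kappa> * qint (Suc m) Q) v" using v by simp
      moreover have "\<kappa> * qint (Suc m) Q \<noteq> 0" using that N(1) k by simp
      moreover have "(D ^^ Suc m) (R b) \<in> I (Suc m)" unfolding I_def using b RB by (intro imageI) auto
      moreover have "scale (inverse (\<kappa> * qint (Suc m) Q)) (scale (\<kappa> * qint (Suc m) Q) v) = v"
        using \<open>\<kappa> * qint (Suc m) Q \<noteq> 0\<close> by (rule scale_inverse_scale)
      ultimately have "v \<in> I (Suc m)"
        using I_sub(1) subspace_scale by metis
      then show "v \<in> {v \<in> I (Suc m). D v = 0}" using \<open>\<kappa> * qint (Suc m) Q \<noteq> 0\<close> v(2) by simp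
    next
      fix v assume "v \<in> {v \<in> I (Suc m). D v = 0}"
      then obtain b where "b \<in> B" "v = (D ^^ m) (D b)" "D v = 0" by (auto simp: I_def funpow_swap1)
      then show "v \<in> {v \<in> I m. D v = 0}" using DB by (auto simp: I_def)
    qed
    then show ?thesis by (simp add: \<nu>_def)
  qed
  have block: "\<nu> (N * a + j) = \<nu> (N * a)" if "j < N" for a j
    using that
  proof (induction j)
    case (Suc j)
    have "\<not> N dvd Suc (N * a + j)"
      using Suc.prems by (metis add_Suc_right dvd_add_right_iff dvd_triv_left nat_dvd_not_less zero_less_Suc)
    then show ?case using step Suc by simp
  qed simp
  have tel: "dim (I 0) = dim (I m) + (\<Sum>j<m. \<nu> j)" for m
  proof (induction m)
    case (Suc m)
    then show ?case using rn[of m] by simp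
  qed simp
  have blocks: "N dvd (\<Sum>j<N * a. \<nu> j)" for a
  proof (induction a)
    case (Suc a)
    have "(\<Sum>j<N * Suc a. \<nu> j) = (\<Sum>j<N * a. \<nu> j) + (\<Sum>j<N. \<nu> (N * a + j))"
      unfolding mult_Suc_right add.commute[of N "N * a"] by (rule sum_lessThan_add)
    also have "(\<Sum>j<N. \<nu> (N * a + j)) = (\<Sum>j<N. \<nu> (N * a))"
      by (rule sum.cong) (auto intro: block)
    finally show ?case using Suc by (simp add: dvd_add)
  qed simp
  have "I (N * l) = {0}"
  proof -
    have "(D ^^ (N * l)) b = 0" if "b \<in> B" for b
    proof -
      \<comment> \<open>\<open>D\<^sup>l\<close> vanishes already; the exponent \<open>N l\<close> makes the number of summands a multiple of \<open>N\<close>\<close>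
      have "N * l = (N - 1) * l + l" using N(2) by (cases N) auto
      then show ?thesis using nil[OF that] linear_funpow[OF D]
        by (metis comp_apply funpow_add module_hom.zero linear_iff_module_hom)
    qed
    then show ?thesis using B subspace_0 by (auto simp: I_def image_def)
  qed
  then have "dim (I (N * l)) = 0" using dim_le_card[of "{0}" "{}"] by simp
  then show ?thesis using tel[of "N * l"] blocks[of l] by (simp add: I_def)
qed

text \<open>
  For the right multiplication \<open>R\<close> by an element \<open>y\<close> this is \<open>U + U y + \<dots> + U y\<^sup>M\<^sup>-\<^sup>1\<close>.
\<close>

definition tower :: "('b \<Rightarrow> 'b) \<Rightarrow> nat \<Rightarrow> 'b set \<Rightarrow> 'b set" where
  "tower R M U = span (\<Union>a<M. (R ^^ a) ` U)"

lemma subspace_tower [simp]: "subspace (tower R M U)"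
  by (simp add: tower_def)

lemma tower_subset: "subspace S \<Longrightarrow> R ` S \<subseteq> S \<Longrightarrow> U \<subseteq> S \<Longrightarrow> tower R M U \<subseteq> S"
  unfolding tower_def by (intro span_minimal) (auto dest: funpow_stable)

lemma in_tower: "u \<in> U \<Longrightarrow> a < M \<Longrightarrow> (R ^^ a) u \<in> tower R M U"
  unfolding tower_def by (auto intro!: span_base)

text \<open>
  Induction on \<open>M\<close>: \<open>D\<^sup>M\<close> kills the tower of height \<open>M\<close> and maps \<open>R\<^sup>M U\<close> onto \<open>U\<close>, as \<open>D\<^sup>M R\<^sup>M\<close> is on \<open>U\<close> the
  scalar \<open>\<kappa>\<^sup>M\<close> times a product of nonzero q-integers.
\<close>

lemma dim_tower_ge:
  fixes \<kappa> Q :: 'a and D R :: "'b \<Rightarrow> 'b"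
  assumes W: "weyl_pair B D R \<kappa> Q" and A: "finite A" "B \<subseteq> span A"
    and U: "subspace U" "U \<subseteq> B" "\<And>u. u \<in> U \<Longrightarrow> D u = 0"
    and q: "\<And>m. 0 < m \<Longrightarrow> m < M \<Longrightarrow> qint m Q \<noteq> 0"
  shows "M * dim U \<le> dim (tower R M U)"
  using q
proof (induction M)
  case (Suc M)
  have D: "Vector_Spaces.linear scale scale D" and B: "subspace B" and RB: "R ` B \<subseteq> B"
    and k: "\<kappa> \<noteq> 0"
    using W by (auto simp: weyl_pair_def)
  interpret DM: Vector_Spaces.linear scale scale "D ^^ M" using D by (rule linear_funpow)
  have R0: "(R ^^ l) 0 = 0" for l
  proof -
    interpret Rl: Vector_Spaces.linear scale scale "R ^^ l"
      using W by (intro linear_funpow) (simp add: weyl_pair_def)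
    show ?thesis by (rule Rl.zero)
  qed
  have sub: "tower R m U \<subseteq> B" for m using tower_subset[OF B RB U(2)] .
  have pow: "(D ^^ j) ((R ^^ a) u) = (if j \<le> a then scale (\<kappa> ^ j * (\<Prod>i<j. qint (a - i) Q)) ((R ^^ (a - j)) u) else 0)"
    if u: "u \<in> U" for u j a
  proof (induction j)
    case (Suc j)
    interpret D: Vector_Spaces.linear scale scale D by (rule D)
    show ?case
    proof (cases "j \<le> a")
      case True
      have "D ((R ^^ (a - j)) u) = scale (\<kappa> * qint (a - j) Q) ((R ^^ (a - j - 1)) u)"
        using weyl_pair_funpow_right[OF W, of u "a - j"] U u R0 by auto
      then show ?thesis using True Suc
        by (auto simp: D.scale mult_ac not_less_eq_eq le_antisym)
    qed (use Suc in \<open>auto simp: D.zero\<close>)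
  qed auto
  have "M * dim U \<le> dim (tower R M U)" using Suc by simp
  also have "\<dots> \<le> dim {v \<in> tower R (Suc M) U. (D ^^ M) v = 0}"
  proof (rule dim_mono_finite[OF _ A(1)])
    show "subspace {v \<in> tower R (Suc M) U. (D ^^ M) v = 0}"
      using subspace_tower[of R "Suc M" U] by (auto simp: subspace_def DM.add DM.scale DM.zero)
    show "{v \<in> tower R (Suc M) U. (D ^^ M) v = 0} \<subseteq> span A" using sub A(2) by blast
    have "(D ^^ M) v = 0" if "v \<in> tower R M U" for v
      using that unfolding tower_def
    proof (induction v rule: span_induct_alt)
      case (step c x y)
      then show ?case using pow by (auto simp: DM.add DM.scale)
    qed (rule DM.zero)
    moreover have "tower R M U \<subseteq> tower R (Suc M) U" unfolding tower_def
      by (intro span_mono UN_mono) auto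
    ultimately show "tower R M U \<subseteq> {v \<in> tower R (Suc M) U. (D ^^ M) v = 0}" by blast
  qed
  finally have 1: "M * dim U \<le> dim {v \<in> tower R (Suc M) U. (D ^^ M) v = 0}" .
  have 2: "dim U \<le> dim ((D ^^ M) ` tower R (Suc M) U)"
  proof (rule dim_mono_finite[OF _ A(1)])
    show "subspace ((D ^^ M) ` tower R (Suc M) U)" by (rule DM.subspace_image) simp
    show "(D ^^ M) ` tower R (Suc M) U \<subseteq> span A"
    proof -
      have "D ` B \<subseteq> B" using W by (simp add: weyl_pair_def)
      then have "(D ^^ M) ` tower R (Suc M) U \<subseteq> B" using sub by (blast intro: funpow_stable)
      then show ?thesis using A(2) by (rule subset_trans)
    qed
    show "U \<subseteq> (D ^^ M) ` tower R (Suc M) U"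
    proof
      fix u assume u: "u \<in> U"
      define e where "e = \<kappa> ^ M * (\<Prod>i<M. qint (M - i) Q)"
      have "e \<noteq> 0" using k Suc.prems by (auto simp: e_def)
      then have "u = (D ^^ M) (scale (inverse e) ((R ^^ M) u))"
        using pow[OF u, of M M] scale_inverse_scale[OF \<open>e \<noteq> 0\<close>, of u]
        by (simp add: DM.scale flip: e_def del: scale_scale)
      moreover have "scale (inverse e) ((R ^^ M) u) \<in> tower R (Suc M) U"
        using in_tower[OF u] by (simp add: subspace_scale)
      ultimately show "u \<in> (D ^^ M) ` tower R (Suc M) U" by blast
    qed
  qed
  have "dim (tower R (Suc M) U) = dim ((D ^^ M) ` tower R (Suc M) U) + dim {v \<in> tower R (Suc M) U. (D ^^ M) v = 0}"
    using dim_finite_rank_nullity[OF linear_funpow[OF D] subspace_tower A(1)] sub A(2) by blast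
  then show ?case using 1 2 by simp
qed simp

lemma dim_tower_le:
  assumes R: "Vector_Spaces.linear scale scale R" and A: "finite A" "U \<subseteq> span A"
  shows "dim (tower R M U) \<le> M * dim U"
proof -
  obtain C where C: "C \<subseteq> U" "independent C" "U \<subseteq> span C" "card C = dim U"
    using basis_exists by blast
  have fin: "finite C" using independent_span_bound[OF A(1) C(2)] C(1) A(2) by blast
  have "(R ^^ a) ` U \<subseteq> span ((R ^^ a) ` C)" for a
  proof -
    interpret Ra: Vector_Spaces.linear scale scale "R ^^ a" using R by (rule linear_funpow)
    show ?thesis using C(3) Ra.span_image[of C] by blast
  qed
  then have "(\<Union>a<M. (R ^^ a) ` U) \<subseteq> span (\<Union>a<M. (R ^^ a) ` C)"
    using span_mono[OF UN_upper, of _ "{..<M}" "\<lambda>a. (R ^^ a) ` C"] by blast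
  then have "tower R M U \<subseteq> span (\<Union>a<M. (R ^^ a) ` C)"
    unfolding tower_def by (simp add: span_minimal)
  then have "dim (tower R M U) \<le> card (\<Union>a<M. (R ^^ a) ` C)"
    by (rule dim_le_card) (simp add: fin)
  also have "\<dots> \<le> (\<Sum>a<M. card ((R ^^ a) ` C))" by (rule card_UN_le) simp
  also have "\<dots> \<le> (\<Sum>a<M. card C)" by (intro sum_mono card_image_le fin)
  finally show ?thesis using C(4) by simp
qed

lemma tower_stable:
  assumes S: "Vector_Spaces.linear scale scale S" and N: "\<And>u. u \<in> U \<Longrightarrow> (S ^^ N) u = 0"
  shows "S ` tower S N U \<subseteq> tower S N U"
proof -
  interpret S: Vector_Spaces.linear scale scale S by fact
  have "S x \<in> tower S N U" if "x \<in> tower S N U" for x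
    using that unfolding tower_def
  proof (induction rule: span_induct_alt)
    case base
    then show ?case by (metis S.zero span_zero)
  next
    case (step c x y)
    obtain a u where a: "a < N" "u \<in> U" "x = (S ^^ a) u" using step(1) by blast
    have "S x \<in> span (\<Union>a<N. (S ^^ a) ` U)"
    proof (cases "Suc a < N")
      case True
      then show ?thesis using a by (intro span_base) (auto intro!: bexI[of _ "Suc a"])
    next
      case False
      then have "S x = (S ^^ N) u" using a by (metis Suc_lessI funpow.simps(2) comp_apply)
      then show ?thesis using N a by (simp add: span_zero)
    qed
    then show ?case using step(2) by (simp only: S.add S.scale) (intro span_add span_scale)
  qed
  then show ?thesis by blast
qed

lemma tower_span:
  assumes "Vector_Spaces.linear scale scale S"
  shows "tower S M (span X) = span (\<Union>a<M. (S ^^ a) ` X)"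
proof -
  have im: "(S ^^ a) ` span X = span ((S ^^ a) ` X)" for a
  proof -
    interpret vector_space_pair scale scale ..
    show ?thesis using linear_span_image[OF linear_funpow[OF assms]] by simp
  qed
  have "(\<Union>a<M. span ((S ^^ a) ` X)) \<subseteq> span (\<Union>a<M. (S ^^ a) ` X)"
    using span_mono[OF UN_upper, of _ "{..<M}" "\<lambda>a. (S ^^ a) ` X"] by blast
  moreover have "span (\<Union>a<M. (S ^^ a) ` X) \<subseteq> span (\<Union>a<M. span ((S ^^ a) ` X))"
    by (intro span_mono UN_mono span_superset subset_refl)
  ultimately show ?thesis unfolding tower_def im
    by (meson span_minimal subspace_span subset_antisym)
qed

end

section \<open>Algebras with skew derivations\<close>

text \<open>
  The order that governs the q-Weyl relation.  At \<open>q = 1\<close> the q-integers do not vanish in characteristic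
  0, which is why \<open>root_order 1\<close> is infinite.
\<close>

definition q_order :: "'k::field_char_0 \<Rightarrow> nat \<Rightarrow> bool" where
  "q_order q N \<longleftrightarrow> 2 \<le> N \<and> (\<forall>m. qint m q = 0 \<longleftrightarrow> N dvd m)"

lemma q_order_cases:
  fixes q :: "'k::field_char_0"
  obtains N where "q_order q N" | "\<And>m. 0 < m \<Longrightarrow> qint m q \<noteq> 0"
proof (cases "q \<noteq> 1 \<and> (\<exists>n>0. q ^ n = 1)")
  case True
  define N where "N = (LEAST n. 0 < n \<and> q ^ n = 1)"
  have N: "0 < N" "q ^ N = 1"
    using True LeastI_ex[of "\<lambda>n. 0 < n \<and> q ^ n = 1"] by (auto simp: N_def)
  have least: "N \<le> m" if "0 < m" "q ^ m = 1" for m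
    using that by (auto simp: N_def intro: Least_le)
  have "q ^ m = 1 \<longleftrightarrow> N dvd m" for m
  proof
    assume "q ^ m = 1"
    moreover have "q ^ m = (q ^ N) ^ (m div N) * q ^ (m mod N)"
      by (metis mult_div_mod_eq power_add power_mult)
    ultimately have "q ^ (m mod N) = 1" using N by simp
    then show "N dvd m" using least[of "m mod N"] N(1) by (metis dvd_eq_mod_eq_0 mod_less_divisor neq0_conv not_less)
  qed (use N in \<open>auto simp: power_mult\<close>)
  moreover have "N \<noteq> 1" using N True by auto
  ultimately have "q_order q N"
    using N True by (auto simp: q_order_def qint_eq_0_iff)
  then show thesis by (rule that)
next
  case False
  then have "\<And>m. 0 < m \<Longrightarrow> qint m q \<noteq> 0" by (metis qint_eq_0_iff neq0_conv)
  then show thesis by (rule that(2))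
qed

lemma q_order_imp_root_order:
  assumes "q_order q N"
  shows "root_order q = enat N"
proof -
  have iff: "m = 0 \<or> q \<noteq> 1 \<and> q ^ m = 1 \<longleftrightarrow> N dvd m" for m
    using assms by (auto simp: q_order_def qint_eq_0_iff)
  have N: "2 \<le> N" using assms by (simp add: q_order_def)
  then have q: "q \<noteq> 1" "q ^ N = 1" using iff[of N] by auto
  have "(LEAST n. 0 < n \<and> q ^ n = 1) = N"
  proof (rule Least_equality)
    fix m assume "0 < m \<and> q ^ m = 1"
    then show "N \<le> m" using iff[of m] q dvd_imp_le by blast
  qed (use N q in auto)
  then show ?thesis using q N by (auto simp: root_order_def intro!: exI[of _ N])
qed

lemma q_order_nz: "q_order q N \<Longrightarrow> 0 < m \<Longrightarrow> m < N \<Longrightarrow> qint m q \<noteq> 0"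
  by (auto simp: q_order_def dest: dvd_imp_le)

lemma q_order_power:
  assumes "q_order q N"
  shows "q ^ m = 1 \<longleftrightarrow> N dvd m"
proof -
  have iff: "k = 0 \<or> q \<noteq> 1 \<and> q ^ k = 1 \<longleftrightarrow> N dvd k" for k
    using assms by (simp add: q_order_def qint_eq_0_iff)
  have "q \<noteq> 1" using iff[of N] assms by (auto simp: q_order_def)
  then show ?thesis using iff[of m] by auto
qed

interpretation tensor: vector_space_calculus "tscale :: 'k::field \<Rightarrow> ('k, 'v) tensor \<Rightarrow> ('k, 'v) tensor"
  by (simp add: vector_space_calculus_def vector_space_tscale)

text \<open>
  On the image of the quantum symmetrisers this is a skew derivation (\<open>contract_R_F\<close>); as an operation on
  tensors it is defined, and linear, without any reference to a quotient.
\<close>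

definition contract :: "('v \<Rightarrow> 'k) \<Rightarrow> ('k, 'v) tensor \<Rightarrow> ('k, 'v) tensor" where
  "contract f b = (\<lambda>fs. b (fs @ [f]))"

definition unit_tensor :: "('k::field, 'v) tensor" where
  "unit_tensor = (\<lambda>fs. if fs = [] then 1 else 0)"

abbreviation tlinear :: "(('k::field, 'v) tensor \<Rightarrow> ('k, 'v) tensor) \<Rightarrow> bool" where
  "tlinear \<equiv> Vector_Spaces.linear tscale tscale"

lemma tlinearI:
  "(\<And>s t. f (s + t) = f s + f t) \<Longrightarrow> (\<And>a t. f (tscale a t) = tscale a (f t)) \<Longrightarrow> tlinear f"
  by (auto simp: Vector_Spaces.linear_def module_hom_def module_hom_axioms_def vector_space_tscale
      intro: tensor.module_axioms)

lemma tlinear_rules: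
  assumes "tlinear f"
  shows "f (s + t) = f s + f t" "f (s - t) = f s - f t" "f (tscale a t) = tscale a (f t)" "f 0 = 0"
proof -
  have f: "module_hom tscale tscale f" using assms by (simp add: linear_iff_module_hom)
  show "f (s + t) = f s + f t" using f by (rule module_hom.add)
  show "f (s - t) = f s - f t" using f by (rule module_hom.diff)
  show "f (tscale a t) = tscale a (f t)" using f by (rule module_hom.scale)
  show "f 0 = 0" using f by (rule module_hom.zero)
qed

lemma tlinear_sum:
  assumes "tlinear f"
  shows "f (\<Sum>i\<in>A. h i) = (\<Sum>i\<in>A. f (h i))"
proof -
  have "module_hom tscale tscale f" using assms by (simp add: linear_iff_module_hom)
  then show ?thesis by (rule module_hom.sum)
qed

lemma tlinear_contract: "tlinear (contract f)"
  by (rule tlinearI) (auto simp: contract_def tscale_def)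

lemma contract_unit: "contract f unit_tensor = 0"
  by (auto simp: contract_def unit_tensor_def)

definition vanishes_from :: "nat \<Rightarrow> ('k::field, 'v) tensor \<Rightarrow> bool" where
  "vanishes_from m b \<longleftrightarrow> (\<forall>fs. m \<le> length fs \<longrightarrow> b fs = 0)"

definition lowers_degree :: "(('k::field, 'v) tensor \<Rightarrow> ('k, 'v) tensor) \<Rightarrow> bool" where
  "lowers_degree D \<longleftrightarrow> (\<forall>m b. vanishes_from (Suc m) b \<longrightarrow> vanishes_from m (D b))"

lemma lowers_degree_contract: "lowers_degree (contract f)"
  by (auto simp: lowers_degree_def vanishes_from_def contract_def)

lemma lowers_degree_commutator:
  fixes D E :: "('k::field, 'v) tensor \<Rightarrow> ('k, 'v) tensor"
  assumes "lowers_degree D" "lowers_degree E"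
  shows "lowers_degree (\<lambda>b. D (E b) - tscale a (E (D b)))"
  unfolding lowers_degree_def
proof (intro allI impI)
  fix m and b :: "('k, 'v) tensor" assume "vanishes_from (Suc m) b"
  moreover have "vanishes_from (Suc m) b" if "vanishes_from m b" for m and b :: "('k, 'v) tensor"
    using that by (auto simp: vanishes_from_def)
  ultimately have "vanishes_from m (D (E b))" "vanishes_from m (E (D b))"
    using assms unfolding lowers_degree_def by blast+
  then show "vanishes_from m (D (E b) - tscale a (E (D b)))"
    by (auto simp: vanishes_from_def tscale_def)
qed

text \<open>
  The source of nilpotency: tensors of a finite-dimensional subspace of the tensor algebra vanish in all
  large degrees.
\<close>

lemma lowers_degree_funpow:
  assumes "lowers_degree D" "tlinear D" "vanishes_from m b"
  shows "(D ^^ m) b = 0"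
  using assms(3)
proof (induction m arbitrary: b)
  case (Suc m)
  then show ?case using assms(1) by (simp add: lowers_degree_def funpow_swap1)
qed (auto simp: vanishes_from_def)

text \<open>
  The Nichols algebra \<open>B\<close> as a right module over the tensor algebra: \<open>R j\<close> multiplies by \<open>x\<^sub>j\<close> from the right,
  contraction with \<open>\<xi>\<^sub>i\<close> is the skew derivation \<open>\<delta>\<^sub>i\<close>, and \<open>G i l j\<close> is the coefficient of \<open>x\<^sub>l\<close> in \<open>g\<^sub>i x\<^sub>j\<close>.  By
  \<open>generated\<close>, \<open>B\<close> is a quotient of the tensor algebra; by \<open>separated\<close> it is the smallest one on which
  all \<open>\<delta>\<^sub>i\<close> are defined.
\<close>

locale nichols_calculus =
  fixes B :: "('k::field_char_0, 'v) tensor set"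
    and n :: nat
    and \<xi> :: "nat \<Rightarrow> 'v \<Rightarrow> 'k"
    and R :: "nat \<Rightarrow> ('k, 'v) tensor \<Rightarrow> ('k, 'v) tensor"
    and G :: "nat \<Rightarrow> nat \<Rightarrow> nat \<Rightarrow> 'k"
  assumes subspace_B: "tensor.subspace B"
    and finite_dim_B: "\<exists>A. finite A \<and> B \<subseteq> tensor.span A"
    and unit_B: "unit_tensor \<in> B"
    and linear_R: "j \<in> {1..n} \<Longrightarrow> tlinear (R j)"
    and R_B: "j \<in> {1..n} \<Longrightarrow> b \<in> B \<Longrightarrow> R j b \<in> B"
    and contract_B: "i \<in> {1..n} \<Longrightarrow> b \<in> B \<Longrightarrow> contract (\<xi> i) b \<in> B"
    and contract_R: "i \<in> {1..n} \<Longrightarrow> j \<in> {1..n} \<Longrightarrow> b \<in> B \<Longrightarrow>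
      contract (\<xi> i) (R j b) =
        (if i = j then b else 0) + (\<Sum>l=1..n. tscale (G i l j) (R l (contract (\<xi> i) b)))"
    and R_Nil: "j \<in> {1..n} \<Longrightarrow> b \<in> B \<Longrightarrow> R j b [] = 0"
    and bounded_B: "\<exists>m. \<forall>b\<in>B. vanishes_from m b"
    and separated: "b \<in> B \<Longrightarrow> b [] = 0 \<Longrightarrow> (\<And>i. i \<in> {1..n} \<Longrightarrow> contract (\<xi> i) b = 0) \<Longrightarrow> b = 0"
    and generated: "tensor.subspace S \<Longrightarrow> unit_tensor \<in> S \<Longrightarrow>
      (\<And>j b. j \<in> {1..n} \<Longrightarrow> b \<in> S \<Longrightarrow> b \<in> B \<Longrightarrow> R j b \<in> S) \<Longrightarrow> B \<subseteq> S"
begin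

abbreviation \<delta> :: "nat \<Rightarrow> ('k, 'v) tensor \<Rightarrow> ('k, 'v) tensor" where
  "\<delta> i \<equiv> contract (\<xi> i)"

definition basic_part :: "('k, 'v) tensor set" where
  "basic_part = tensor.span {unit_tensor}"

lemma unit_nonzero: "(unit_tensor :: ('k, 'v) tensor) \<noteq> 0"
proof
  assume "(unit_tensor :: ('k, 'v) tensor) = 0"
  then have "(unit_tensor :: ('k, 'v) tensor) [] = 0" by simp
  then show False by (simp add: unit_tensor_def)
qed

lemma dim_basic_part: "tensor.dim basic_part = 1"
  unfolding basic_part_def by (subst tensor.dim_span_eq_card_independent) (auto simp: unit_nonzero)

lemma basic_part_B: "basic_part \<subseteq> B"
  unfolding basic_part_def by (intro tensor.span_minimal) (auto simp: unit_B subspace_B)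

lemma kernel_basic_part:
  assumes "tlinear D" "D unit_tensor = 0" "u \<in> basic_part"
  shows "D u = 0"
  using assms(3) unfolding basic_part_def
proof (induction rule: tensor.span_induct_alt)
  case base
  then show ?case by (rule tlinear_rules(4)[OF assms(1)])
next
  case (step c x y)
  have "D (tscale c x + y) = tscale c (D x) + D y"
    by (simp only: tlinear_rules[OF assms(1)])
  also have "D x = 0" using step(1) assms(2) by blast
  also have "D y = 0" by (rule step)
  finally show ?case by (simp only: tensor.scale_zero_right add_0)
qed

text \<open>
  Evidence for \<open>dim B \<ge> m\<close> on which a tower can be built.
\<close>

definition part_of_dim :: "nat \<Rightarrow> ('k, 'v) tensor set \<Rightarrow> bool" where
  "part_of_dim m U \<longleftrightarrow> tensor.subspace U \<and> U \<subseteq> B \<and> m \<le> tensor.dim U"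

lemma part_of_dim_basic: "part_of_dim 1 basic_part"
  by (auto simp: part_of_dim_def dim_basic_part basic_part_B[THEN subsetD]) (simp add: basic_part_def)

lemma part_of_dim_le: "part_of_dim m U \<Longrightarrow> m \<le> tensor.dim B"
  using finite_dim_B tensor.dim_mono_finite[OF subspace_B] unfolding part_of_dim_def
  by (meson le_trans)

lemma part_of_dim_tower:
  assumes "part_of_dim m U" "tensor.weyl_pair B D S \<kappa> Q" "\<And>u. u \<in> U \<Longrightarrow> D u = 0"
    and "\<And>j. 0 < j \<Longrightarrow> j < M \<Longrightarrow> qint j Q \<noteq> 0"
  shows "part_of_dim (m * M) (tensor.tower S M U)"
proof -
  have "S ` B \<subseteq> B" using assms(2) by (simp add: tensor.weyl_pair_def)
  then have sub: "tensor.tower S M U \<subseteq> B"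
    using assms(1) by (intro tensor.tower_subset subspace_B) (auto simp: part_of_dim_def)
  obtain A where A: "finite A" "B \<subseteq> tensor.span A" using finite_dim_B by blast
  have "M * tensor.dim U \<le> tensor.dim (tensor.tower S M U)"
    using assms(1,3,4) by (intro tensor.dim_tower_ge[OF assms(2) A]) (auto simp: part_of_dim_def)
  moreover have "m * M \<le> M * tensor.dim U" using assms(1) by (simp add: part_of_dim_def)
  ultimately have "m * M \<le> tensor.dim (tensor.tower S M U)" by linarith
  then show ?thesis using sub by (simp add: part_of_dim_def)
qed

lemma kernel_tower:
  assumes "tlinear D" "tlinear S" "S ` B \<subseteq> B" "U \<subseteq> B" "\<And>u. u \<in> U \<Longrightarrow> D u = 0"
    and "\<And>b. b \<in> B \<Longrightarrow> D b = 0 \<Longrightarrow> D (S b) = 0"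
    and "u \<in> tensor.tower S M U"
  shows "D u = 0"
proof -
  have "tensor.subspace {b \<in> B. D b = 0}"
    using subspace_B by (auto simp: tensor.subspace_def tlinear_rules[OF assms(1)])
  then have "tensor.tower S M U \<subseteq> {b \<in> B. D b = 0}"
    by (rule tensor.tower_subset) (use assms in auto)
  then show ?thesis using assms(7) by blast
qed

text \<open>
  If no q-integer of \<open>Q\<close> vanished, the towers over the unit would have unbounded dimension.
\<close>

lemma weyl_pair_order:
  assumes W: "tensor.weyl_pair B D S \<kappa> Q" and "lowers_degree D" "D unit_tensor = 0"
  obtains N where "q_order Q N" "N dvd tensor.dim B"
proof -
  have D: "tlinear D" using W by (simp add: tensor.weyl_pair_def)
  obtain A where A: "finite A" "B \<subseteq> tensor.span A" using finite_dim_B by blast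
  obtain l where l: "\<And>b. b \<in> B \<Longrightarrow> vanishes_from l b" using bounded_B by blast
  show thesis
  proof (rule q_order_cases[of Q])
    fix N assume N: "q_order Q N"
    have "N dvd tensor.dim B"
      by (rule tensor.weyl_pair_order_dvd_dim[OF W A])
        (use lowers_degree_funpow[OF assms(2) D l] N in \<open>auto simp: q_order_def\<close>)
    then show thesis using that N by blast
  next
    assume "\<And>m. 0 < m \<Longrightarrow> qint m Q \<noteq> 0"
    then have "part_of_dim (1 * Suc (tensor.dim B)) (tensor.tower S (Suc (tensor.dim B)) basic_part)"
      by (intro part_of_dim_tower[OF part_of_dim_basic W] kernel_basic_part[OF D assms(3)]) auto
    then show thesis using part_of_dim_le by fastforce
  qed
qed

text \<open>
  This says \<open>g\<^sub>i x\<^sub>i = Q x\<^sub>i\<close>.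
\<close>

definition self_eigen :: "nat \<Rightarrow> 'k \<Rightarrow> bool" where
  "self_eigen i Q \<longleftrightarrow> (\<forall>l\<in>{1..n}. G i l i = (if l = i then Q else 0))"

lemma weyl_pair_generator:
  assumes "i \<in> {1..n}" "self_eigen i Q"
  shows "tensor.weyl_pair B (\<delta> i) (R i) 1 Q"
proof -
  have "(\<Sum>l=1..n. tscale (G i l i) (R l (\<delta> i b))) = tscale Q (R i (\<delta> i b))" for b
  proof -
    have "(\<Sum>l=1..n. tscale (G i l i) (R l (\<delta> i b))) = (\<Sum>l=1..n. if l = i then tscale Q (R i (\<delta> i b)) else 0)"
      using assms(2) by (intro sum.cong) (auto simp: self_eigen_def)
    then show ?thesis using assms(1) by simp
  qed
  then show ?thesis
    using assms(1) by (auto simp: tensor.weyl_pair_def tlinear_contract linear_R subspace_B R_B contract_B contract_R)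
qed

lemma generator_order:
  assumes "i \<in> {1..n}" "self_eigen i Q"
  obtains N where "q_order Q N" "N dvd tensor.dim B"
  using weyl_pair_order[OF weyl_pair_generator[OF assms] lowers_degree_contract contract_unit] by blast

lemma contract_R_kernel:
  assumes "i \<in> {1..n}" "j \<in> {1..n}" "i \<noteq> j" "b \<in> B" "\<delta> i b = 0"
  shows "\<delta> i (R j b) = 0"
proof -
  have "R l 0 = 0" if "l \<in> {1..n}" for l using tlinear_rules(4)[OF linear_R[OF that]] .
  then show ?thesis using assms by (simp add: contract_R)
qed

text \<open>
  The monomials \<open>x\<^sub>1\<^sup>a \<dots> x\<^sub>n\<^sup>z\<close> with exponents below the \<open>N i\<close> are independent: \<open>\<delta>\<^sub>m\<^sub>+\<^sub>1\<close> kills all products of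
  \<open>x\<^sub>1, \<dots>, x\<^sub>m\<close>, so the powers of \<open>x\<^sub>m\<^sub>+\<^sub>1\<close> form a tower over their span.  The group action may mix the
  generators, since \<open>\<delta>\<^sub>i (b x\<^sub>j)\<close> with \<open>i \<noteq> j\<close> vanishes together with \<open>\<delta>\<^sub>i b\<close> in any case.
\<close>

lemma ordered_products:
  assumes "\<And>i. i \<in> {1..n} \<Longrightarrow> self_eigen i (Q i)" "\<And>i. i \<in> {1..n} \<Longrightarrow> q_order (Q i) (N i)"
  shows "(\<Prod>i=1..n. N i) \<le> tensor.dim B"
proof -
  have "\<exists>U. part_of_dim (\<Prod>i=1..m. N i) U \<and> (\<forall>i\<in>{m<..n}. \<forall>u\<in>U. \<delta> i u = 0)" if "m \<le> n" for m
    using that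
  proof (induction m)
    case 0
    have "part_of_dim (\<Prod>i=1..0. N i) basic_part" using part_of_dim_basic by simp
    then show ?case
      using kernel_basic_part[OF tlinear_contract contract_unit] by blast
  next
    case (Suc m)
    then obtain U where U: "part_of_dim (\<Prod>i=1..m. N i) U" "\<forall>i\<in>{m<..n}. \<forall>u\<in>U. \<delta> i u = 0"
      using Suc_leD by blast
    have m: "Suc m \<in> {1..n}" using Suc.prems by simp
    have "part_of_dim ((\<Prod>i=1..m. N i) * N (Suc m)) (tensor.tower (R (Suc m)) (N (Suc m)) U)"
      by (rule part_of_dim_tower[OF U(1) weyl_pair_generator[OF m assms(1)[OF m]]])
        (use U(2) m q_order_nz[OF assms(2)[OF m]] in auto)
    moreover have "\<delta> i u = 0" if "i \<in> {Suc m<..n}" "u \<in> tensor.tower (R (Suc m)) (N (Suc m)) U" for i u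
      by (rule kernel_tower[OF tlinear_contract linear_R[OF m] _ _ _ _ that(2)])
        (use that(1) m U R_B contract_R_kernel[of i "Suc m"] in \<open>auto simp: part_of_dim_def\<close>)
    ultimately show ?case by (intro exI[of _ "tensor.tower (R (Suc m)) (N (Suc m)) U"]) simp
  qed
  then show ?thesis using part_of_dim_le by blast
qed

lemma prime_power_order:
  assumes p: "prime p" and d: "tensor.dim B = p ^ 3" and N: "q_order Q N" "N dvd tensor.dim B"
  obtains e where "1 \<le> e" "q_order Q (p ^ e)"
proof -
  obtain e where e: "N = p ^ e" using p N(2) d by (auto simp: divides_primepow_nat)
  moreover have "e \<noteq> 0" using N(1) e by (auto simp: q_order_def intro: ccontr)
  ultimately show thesis using that[of e] N(1) by simp
qed

end

section \<open>Braided commutators in rank two\<close>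

lemma sum_fun_apply: "(\<Sum>i\<in>A. f i) x = (\<Sum>i\<in>A. f i x)"
  by (induction A rule: infinite_finite_induct) auto

context nichols_calculus
begin

text \<open>
  Only coordinate functions are admitted as arguments, for these are the ones that \<open>contract_R\<close> covers.
\<close>

definition homogeneous :: "nat \<Rightarrow> ('k, 'v) tensor \<Rightarrow> bool" where
  "homogeneous d b \<longleftrightarrow> (\<forall>fs. set fs \<subseteq> \<xi> ` {1..n} \<longrightarrow> length fs \<noteq> d \<longrightarrow> b fs = 0)"

lemma R_snoc:
  assumes "i \<in> {1..n}" "j \<in> {1..n}" "b \<in> B"
  shows "R j b (fs @ [\<xi> i]) = (if i = j then b fs else 0) + (\<Sum>l=1..n. G i l j * R l (\<delta> i b) fs)"
proof -
  have "R j b (fs @ [\<xi> i]) = \<delta> i (R j b) fs" by (simp add: contract_def)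
  then show ?thesis using assms by (simp add: contract_R sum_fun_apply tscale_def)
qed

lemma homogeneous_R:
  assumes "j \<in> {1..n}" "b \<in> B" "homogeneous d b"
  shows "homogeneous (Suc d) (R j b)"
proof -
  have "R j b fs = 0" if "set fs \<subseteq> \<xi> ` {1..n}" "length fs \<noteq> Suc d" "j \<in> {1..n}" "b \<in> B" "homogeneous d b"
    for fs j b d
    using that
  proof (induction fs arbitrary: j b d rule: rev_induct)
    case Nil
    then show ?case using R_Nil by simp
  next
    case (snoc f gs)
    obtain i where i: "i \<in> {1..n}" "f = \<xi> i" using snoc.prems(1) by auto
    obtain d' where d': "homogeneous d' (\<delta> i b)" "length gs \<noteq> Suc d'"
    proof (cases d)
      case 0
      then have "homogeneous (length gs) (\<delta> i b)"
        using snoc.prems(5) i by (auto simp: homogeneous_def contract_def)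
      then show thesis using that by simp
    next
      case (Suc d')
      then have "homogeneous d' (\<delta> i b)"
        using snoc.prems(5) i by (auto simp: homogeneous_def contract_def)
      then show thesis using that Suc snoc.prems(2) by simp
    qed
    have "R l (\<delta> i b) gs = 0" if "l \<in> {1..n}" for l
      using snoc.IH[OF _ d'(2) that contract_B[OF i(1) snoc.prems(4)] d'(1)] snoc.prems(1) by auto
    moreover have "b gs = 0"
      using snoc.prems(1,2,5) by (auto simp: homogeneous_def)
    ultimately show ?case using R_snoc[OF i(1) snoc.prems(3,4)] by (simp add: i)
  qed
  then show ?thesis using assms by (simp add: homogeneous_def)
qed

lemma R_pow_B: "j \<in> {1..n} \<Longrightarrow> b \<in> B \<Longrightarrow> (R j ^^ a) b \<in> B"
  by (induction a) (auto simp: R_B)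

lemma homogeneous_R_pow:
  "j \<in> {1..n} \<Longrightarrow> b \<in> B \<Longrightarrow> homogeneous d b \<Longrightarrow> homogeneous (a + d) ((R j ^^ a) b)"
  by (induction a) (auto simp: homogeneous_R R_pow_B)

lemma R_unit_coeff:
  assumes "a \<in> {1..n}" "m \<in> {1..n}"
  shows "R a unit_tensor [\<xi> m] = (if m = a then 1 else 0)"
    and "\<delta> m (R a unit_tensor) = (if m = a then unit_tensor else 0)"
proof -
  have "R l 0 = 0" if "l \<in> {1..n}" for l using tlinear_rules(4)[OF linear_R[OF that]] .
  then show *: "\<delta> m (R a unit_tensor) = (if m = a then unit_tensor else 0)"
    using contract_R[OF assms(2,1) unit_B] by (simp add: contract_unit)
  have "R a unit_tensor [\<xi> m] = \<delta> m (R a unit_tensor) []" by (simp add: contract_def)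
  then show "R a unit_tensor [\<xi> m] = (if m = a then 1 else 0)"
    unfolding * by (simp add: unit_tensor_def)
qed

lemma degree_two_coeff:
  assumes "a \<in> {1..n}" "b \<in> {1..n}" "m \<in> {1..n}" "k \<in> {1..n}"
  shows "R b (R a unit_tensor) [\<xi> m, \<xi> k] =
    (if k = b \<and> m = a then 1 else 0) + (if k = a then G k m b else 0)"
proof -
  have "R b (R a unit_tensor) ([\<xi> m] @ [\<xi> k]) = (if k = b then R a unit_tensor [\<xi> m] else 0) +
      (\<Sum>l=1..n. G k l b * R l (\<delta> k (R a unit_tensor)) [\<xi> m])"
    by (rule R_snoc) (use assms in \<open>auto simp: R_B unit_B\<close>)
  also have "(\<Sum>l=1..n. G k l b * R l (\<delta> k (R a unit_tensor)) [\<xi> m]) =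
      (\<Sum>l=1..n. if l = m then (if k = a then G k m b else 0) else 0)"
  proof (rule sum.cong)
    fix l assume l: "l \<in> {1..n}"
    have "R l 0 = 0" using tlinear_rules(4)[OF linear_R[OF l]] .
    then show "G k l b * R l (\<delta> k (R a unit_tensor)) [\<xi> m] =
        (if l = m then (if k = a then G k m b else 0) else 0)"
      using assms l by (auto simp: R_unit_coeff)
  qed simp
  finally show ?thesis using assms by (auto simp: R_unit_coeff)
qed

text \<open>
  If the lower bound is attained by \<open>x\<^sub>j, x\<^sub>i, x\<^sub>l\<close>, the monomials ordered in this way span \<open>B\<close>.  Among those
  of degree two, by the conditions on \<open>G\<close>, the linear form \<open>\<phi>\<close> of the proof could be nonzero only on \<open>x\<^sub>j x\<^sub>l\<close>:
  there its first term is the coefficient of \<open>x\<^sub>i\<close> in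
  \<open>g\<^sub>j x\<^sub>l\<close>, which the second term cancels.  But \<open>\<phi>(x\<^sub>i x\<^sub>j) = 1\<close>.
\<close>

lemma no_three_cycle:
  assumes ix: "i \<in> {1..n}" "j \<in> {1..n}" "l \<in> {1..n}" "distinct [i, j, l]"
    and eig: "\<And>k. k \<in> {i, j, l} \<Longrightarrow> self_eigen k (Q k)" "\<And>k. k \<in> {i, j, l} \<Longrightarrow> q_order (Q k) (N k)"
    and dim: "tensor.dim B \<le> N j * N i * N l"
    and G: "G j i j = 0" "G j i i = 0" "G l j l = 0"
  shows False
proof -
  note lin = linear_R[OF ix(1)] linear_R[OF ix(2)] linear_R[OF ix(3)]
  define U1 where "U1 = tensor.tower (R j) (N j) basic_part"
  define U2 where "U2 = tensor.tower (R i) (N i) U1"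
  define U3 where "U3 = tensor.tower (R l) (N l) U2"
  define X1 where "X1 = (\<Union>a<N j. (R j ^^ a) ` {unit_tensor})"
  define X2 where "X2 = (\<Union>a<N i. (R i ^^ a) ` X1)"
  define X3 where "X3 = (\<Union>a<N l. (R l ^^ a) ` X2)"
  have span: "U3 = tensor.span X3"
    unfolding U1_def U2_def U3_def X1_def X2_def X3_def basic_part_def
    by (simp only: tensor.tower_span lin)
  have RB: "R k ` B \<subseteq> B" if "k \<in> {1..n}" for k using that R_B by blast
  have U1: "part_of_dim (1 * N j) U1"
    unfolding U1_def
    by (rule part_of_dim_tower[OF part_of_dim_basic weyl_pair_generator[OF ix(2) eig(1)]])
      (use kernel_basic_part[OF tlinear_contract contract_unit] q_order_nz[OF eig(2)] in auto)
  have ker1: "\<delta> k u = 0" if "k \<in> {i, l}" "u \<in> U1" for k u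
    using that(2) unfolding U1_def
    by (rule kernel_tower[OF tlinear_contract lin(2) RB[OF ix(2)], rotated -1])
      (use basic_part_B kernel_basic_part[OF tlinear_contract contract_unit] contract_R_kernel ix that(1) in auto)
  have U2: "part_of_dim (1 * N j * N i) U2"
    unfolding U2_def
    by (rule part_of_dim_tower[OF U1 weyl_pair_generator[OF ix(1) eig(1)]])
      (use ker1 q_order_nz[OF eig(2)] in auto)
  have ker2: "\<delta> l u = 0" if "u \<in> U2" for u
    using that unfolding U2_def
    by (rule kernel_tower[OF tlinear_contract lin(1) RB[OF ix(1)], rotated -1])
      (use U1 ker1 contract_R_kernel ix in \<open>auto simp: part_of_dim_def\<close>)
  have U3: "part_of_dim (1 * N j * N i * N l) U3"
    unfolding U3_def
    by (rule part_of_dim_tower[OF U2 weyl_pair_generator[OF ix(3) eig(1)]])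
      (use ker2 q_order_nz[OF eig(2)] in auto)
  obtain A where "finite A" "B \<subseteq> tensor.span A" using finite_dim_B by blast
  then have "U3 = B"
    using U3 dim by (intro tensor.dim_eq_imp_eq[OF subspace_B]) (auto simp: part_of_dim_def)
  define \<phi> where "\<phi> b = b [\<xi> i, \<xi> j] - G j i l * b [\<xi> j, \<xi> l]" for b :: "('k, 'v) tensor"
  have \<phi>_X3: "\<phi> x = 0" if x: "x \<in> X3" for x
  proof -
    obtain c b a where x: "x = (R l ^^ c) ((R i ^^ b) ((R j ^^ a) unit_tensor))"
      using x unfolding X1_def X2_def X3_def by blast
    have "homogeneous 0 unit_tensor" by (auto simp: homogeneous_def unit_tensor_def)
    then have "homogeneous (c + (b + (a + 0))) x"
      unfolding x by (intro homogeneous_R_pow R_pow_B ix unit_B)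
    show ?thesis
    proof (cases "a + b + c = 2")
      case True
      then consider "a = 2" "b = 0" "c = 0" | "a = 0" "b = 2" "c = 0" | "a = 0" "b = 0" "c = 2"
        | "a = 1" "b = 1" "c = 0" | "a = 1" "b = 0" "c = 1" | "a = 0" "b = 1" "c = 1"
        by atomize_elim presburger
      then show ?thesis
        by cases (use ix G in \<open>simp_all add: x \<phi>_def numeral_2_eq_2 degree_two_coeff\<close>)
    next
      case False
      then show ?thesis using \<open>homogeneous _ x\<close> ix by (auto simp: \<phi>_def homogeneous_def)
    qed
  qed
  have "\<phi> x = 0" if "x \<in> tensor.span X3" for x
    using that
  proof (induction rule: tensor.span_induct_alt)
    case (step c x y)
    then show ?case using \<phi>_X3[of x] by (simp add: \<phi>_def tscale_def algebra_simps)
  qed (simp add: \<phi>_def)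
  then have "\<phi> (R j (R i unit_tensor)) = 0"
    using \<open>U3 = B\<close> span ix by (auto simp: R_B unit_B)
  then show False using ix G by (simp add: \<phi>_def degree_two_coeff)
qed

end

locale diagonal_calculus = nichols_calculus B n \<xi> R G
  for B :: "('k::field_char_0, 'v) tensor set" and n \<xi> R G +
  fixes q :: "nat \<Rightarrow> nat \<Rightarrow> 'k"
  assumes G_q: "i \<in> {1..n} \<Longrightarrow> l \<in> {1..n} \<Longrightarrow> j \<in> {1..n} \<Longrightarrow> G i l j = (if l = j then q i j else 0)"
    and q_nz: "i \<in> {1..n} \<Longrightarrow> j \<in> {1..n} \<Longrightarrow> q i j \<noteq> 0"
begin

lemma contract_R_diag:
  assumes "i \<in> {1..n}" "j \<in> {1..n}" "b \<in> B"
  shows "\<delta> i (R j b) = (if i = j then b else 0) + tscale (q i j) (R j (\<delta> i b))"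
proof -
  have "(\<Sum>l=1..n. tscale (G i l j) (R l (\<delta> i b))) =
      (\<Sum>l=1..n. if l = j then tscale (q i j) (R j (\<delta> i b)) else 0)"
    using assms by (intro sum.cong) (auto simp: G_q)
  then show ?thesis using assms by (simp add: contract_R)
qed

lemma self_eigen_q: "i \<in> {1..n} \<Longrightarrow> self_eigen i (q i i)"
  by (auto simp: self_eigen_def G_q)

text \<open>
  Right multiplication by the braided commutator \<open>w = x\<^sub>i x\<^sub>j - q\<^sub>j\<^sub>i\<^sup>-\<^sup>1 x\<^sub>j x\<^sub>i\<close>; as operators act from the
  right, \<open>x\<^sub>i x\<^sub>j\<close> is \<open>R j \<circ> R i\<close>.  The coefficient is the one for which \<open>\<delta>\<^sub>j w = 0\<close>.
\<close>

definition bracket_mult :: "nat \<Rightarrow> nat \<Rightarrow> ('k, 'v) tensor \<Rightarrow> ('k, 'v) tensor" where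
  "bracket_mult i j b = R j (R i b) - tscale (inverse (q j i)) (R i (R j b))"

text \<open>
  The skew derivation dual to \<open>w\<close>.  With this coefficient the terms in \<open>\<delta>\<^sub>j(b) x\<^sub>j\<close> cancel in
  \<open>bracket_deriv_mult\<close>.
\<close>

definition bracket_deriv :: "nat \<Rightarrow> nat \<Rightarrow> ('k, 'v) tensor \<Rightarrow> ('k, 'v) tensor" where
  "bracket_deriv i j b = \<delta> j (\<delta> i b) - tscale (inverse (q j i)) (\<delta> i (\<delta> j b))"

lemma bracket_mult_B: "i \<in> {1..n} \<Longrightarrow> j \<in> {1..n} \<Longrightarrow> b \<in> B \<Longrightarrow> bracket_mult i j b \<in> B"
  unfolding bracket_mult_def by (intro tensor.subspace_diff tensor.subspace_scale subspace_B R_B)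

lemma bracket_deriv_B: "i \<in> {1..n} \<Longrightarrow> j \<in> {1..n} \<Longrightarrow> b \<in> B \<Longrightarrow> bracket_deriv i j b \<in> B"
  unfolding bracket_deriv_def by (intro tensor.subspace_diff tensor.subspace_scale subspace_B contract_B)

lemma linear_bracket_mult:
  assumes "i \<in> {1..n}" "j \<in> {1..n}"
  shows "tlinear (bracket_mult i j)"
  using assms
  by (intro tlinearI)
    (simp_all add: bracket_mult_def tlinear_rules[OF linear_R], auto simp: tscale_def fun_eq_iff algebra_simps)

lemma linear_bracket_deriv: "tlinear (bracket_deriv i j)"
  by (rule tlinearI)
    (simp_all add: bracket_deriv_def tlinear_rules[OF tlinear_contract], auto simp: tscale_def fun_eq_iff algebra_simps)

lemma lowers_degree_bracket_deriv: "lowers_degree (bracket_deriv i j)"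
  using lowers_degree_commutator[OF lowers_degree_contract lowers_degree_contract]
  by (simp add: bracket_deriv_def[abs_def])

lemmas expand = tlinear_rules[OF linear_R] tlinear_rules[OF tlinear_contract] contract_R_diag
  R_B contract_B

lemma contract_bracket_mult_other:
  assumes "i \<in> {1..n}" "j \<in> {1..n}" "k \<in> {1..n}" "k \<noteq> i" "k \<noteq> j" "b \<in> B"
  shows "\<delta> k (bracket_mult i j b) = tscale (q k i * q k j) (bracket_mult i j (\<delta> k b))"
  using assms by (simp add: bracket_mult_def expand) (auto simp: tscale_def fun_eq_iff algebra_simps)

lemma contract_bracket_mult_right:
  assumes "i \<in> {1..n}" "j \<in> {1..n}" "i \<noteq> j" "b \<in> B"
  shows "\<delta> j (bracket_mult i j b) = tscale (q j i * q j j) (bracket_mult i j (\<delta> j b))"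
  using assms q_nz[of j i] by (simp add: bracket_mult_def expand) (auto simp: tscale_def fun_eq_iff field_simps)

lemma contract_bracket_mult_left:
  assumes "i \<in> {1..n}" "j \<in> {1..n}" "i \<noteq> j" "b \<in> B"
  shows "\<delta> i (bracket_mult i j b) = tscale (q i j - inverse (q j i)) (R j b) + tscale (q i i * q i j) (bracket_mult i j (\<delta> i b))"
  using assms q_nz[of j i] by (simp add: bracket_mult_def expand) (auto simp: tscale_def fun_eq_iff field_simps)

lemma bracket_deriv_R:
  assumes "i \<in> {1..n}" "j \<in> {1..n}" "i \<noteq> j" "b \<in> B"
  shows "bracket_deriv i j (R i b) = tscale (q i i * q j i) (R i (bracket_deriv i j b))"
  using assms q_nz[of j i] by (simp add: bracket_deriv_def expand) (auto simp: tscale_def fun_eq_iff field_simps)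

text \<open>
  The commutator is a root vector: its q-Weyl relation has the parameter \<open>q\<^sub>i\<^sub>i q\<^sub>i\<^sub>j q\<^sub>j\<^sub>i q\<^sub>j\<^sub>j\<close>, by which the degree
  of \<open>w\<close> acts on \<open>w\<close>.
\<close>

lemma bracket_deriv_mult:
  assumes "i \<in> {1..n}" "j \<in> {1..n}" "i \<noteq> j" "b \<in> B"
  shows "bracket_deriv i j (bracket_mult i j b) = tscale (q i j - inverse (q j i)) b +
    tscale (q i i * q i j * q j i * q j j) (bracket_mult i j (bracket_deriv i j b))"
  using assms q_nz[of j i]
  by (simp add: bracket_deriv_def contract_bracket_mult_left contract_bracket_mult_right expand tlinear_rules[OF linear_bracket_mult])
    (auto simp: tscale_def fun_eq_iff field_simps)

lemma weyl_pair_bracket: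
  assumes "i \<in> {1..n}" "j \<in> {1..n}" "i \<noteq> j" "q i j * q j i \<noteq> 1"
  shows "tensor.weyl_pair B (bracket_deriv i j) (bracket_mult i j) (q i j - inverse (q j i)) (q i i * q i j * q j i * q j j)"
  unfolding tensor.weyl_pair_def
  using assms q_nz[of j i] by (auto simp: linear_bracket_deriv linear_bracket_mult bracket_deriv_B bracket_mult_B bracket_deriv_mult subspace_B field_simps)

text \<open>
  Right multiplication by \<open>x\<^sub>i w - (q\<^sub>i\<^sub>i q\<^sub>j\<^sub>i)\<^sup>-\<^sup>1 w x\<^sub>i\<close>, which \<open>bracket_deriv\<close> kills.
\<close>

definition double_bracket_mult :: "nat \<Rightarrow> nat \<Rightarrow> ('k, 'v) tensor \<Rightarrow> ('k, 'v) tensor" where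
  "double_bracket_mult i j b = bracket_mult i j (R i b) - tscale (inverse (q i i * q j i)) (R i (bracket_mult i j b))"

definition double_bracket_deriv :: "nat \<Rightarrow> nat \<Rightarrow> ('k, 'v) tensor \<Rightarrow> ('k, 'v) tensor" where
  "double_bracket_deriv i j b = bracket_deriv i j (\<delta> i b) - tscale (inverse (q i i * q j i)) (\<delta> i (bracket_deriv i j b))"

lemma double_bracket_mult_B: "i \<in> {1..n} \<Longrightarrow> j \<in> {1..n} \<Longrightarrow> b \<in> B \<Longrightarrow> double_bracket_mult i j b \<in> B"
  unfolding double_bracket_mult_def by (intro tensor.subspace_diff tensor.subspace_scale subspace_B R_B bracket_mult_B)

lemma double_bracket_deriv_B: "i \<in> {1..n} \<Longrightarrow> j \<in> {1..n} \<Longrightarrow> b \<in> B \<Longrightarrow> double_bracket_deriv i j b \<in> B"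
  unfolding double_bracket_deriv_def by (intro tensor.subspace_diff tensor.subspace_scale subspace_B contract_B bracket_deriv_B)

lemma linear_double_bracket_mult:
  assumes "i \<in> {1..n}" "j \<in> {1..n}"
  shows "tlinear (double_bracket_mult i j)"
  using assms
  by (intro tlinearI)
    (simp_all add: double_bracket_mult_def tlinear_rules[OF linear_R] tlinear_rules[OF linear_bracket_mult], auto simp: tscale_def fun_eq_iff algebra_simps)

lemma linear_double_bracket_deriv: "tlinear (double_bracket_deriv i j)"
  by (rule tlinearI)
    (simp_all add: double_bracket_deriv_def tlinear_rules[OF tlinear_contract] tlinear_rules[OF linear_bracket_deriv], auto simp: tscale_def fun_eq_iff algebra_simps)

lemmas expand_bracket = expand tlinear_rules[OF linear_bracket_mult] tlinear_rules[OF linear_bracket_deriv] bracket_mult_B bracket_deriv_B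

lemma contract_double_bracket_mult_right:
  assumes "i \<in> {1..n}" "j \<in> {1..n}" "i \<noteq> j" "b \<in> B"
  shows "\<delta> j (double_bracket_mult i j b) = tscale ((q j i)\<^sup>2 * q j j) (double_bracket_mult i j (\<delta> j b))"
  using assms
  by (simp add: double_bracket_mult_def contract_bracket_mult_right expand_bracket)
    (auto simp: tscale_def fun_eq_iff algebra_simps power2_eq_square)

text \<open>
  The first coefficient decides whether the iterated commutator vanishes: it is zero exactly if
  \<open>q\<^sub>i\<^sub>i = -1\<close> or \<open>q\<^sub>i\<^sub>i q\<^sub>i\<^sub>j q\<^sub>j\<^sub>i = 1\<close>.
\<close>

lemma contract_double_bracket_mult_left:
  assumes "i \<in> {1..n}" "j \<in> {1..n}" "i \<noteq> j" "b \<in> B"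
  shows "\<delta> i (double_bracket_mult i j b) = tscale ((1 + q i i) * (q i j - inverse (q i i * q j i))) (bracket_mult i j b) +
    tscale ((q i i)\<^sup>2 * q i j) (double_bracket_mult i j (\<delta> i b))"
proof -
  have swap: "R j (R i b) = bracket_mult i j b + tscale (inverse (q j i)) (R i (R j b))" by (simp add: bracket_mult_def)
  show ?thesis
    using assms q_nz[of j i] q_nz[of i i]
    by (simp add: double_bracket_mult_def contract_bracket_mult_left expand_bracket swap)
      (auto simp: tscale_def fun_eq_iff field_simps power2_eq_square)
qed

lemma bracket_deriv_double_mult:
  assumes "i \<in> {1..n}" "j \<in> {1..n}" "i \<noteq> j" "b \<in> B"
  shows "bracket_deriv i j (double_bracket_mult i j b) = tscale (q i i * q i j * q j i * q j j * q i i * q j i) (double_bracket_mult i j (bracket_deriv i j b))"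
  using assms q_nz[of j i] q_nz[of i i]
  by (simp add: double_bracket_mult_def bracket_deriv_mult bracket_deriv_R expand_bracket)
    (auto simp: tscale_def fun_eq_iff field_simps power2_eq_square)

lemma double_bracket_deriv_mult:
  assumes "i \<in> {1..n}" "j \<in> {1..n}" "i \<noteq> j" "b \<in> B"
  shows "double_bracket_deriv i j (double_bracket_mult i j b) =
    tscale ((1 + q i i) * (q i j - inverse (q i i * q j i)) * (q i j - inverse (q j i))) b +
    tscale ((q i i)\<^sup>2 * q i j * (q i i * q i j * q j i * q j j * q i i * q j i)) (double_bracket_mult i j (double_bracket_deriv i j b))"
  using assms q_nz[of j i] q_nz[of i i]
  by (simp add: double_bracket_deriv_def contract_double_bracket_mult_left bracket_deriv_double_mult bracket_deriv_mult expand_bracket tlinear_rules[OF linear_double_bracket_mult])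
    (auto simp: tscale_def fun_eq_iff field_simps power2_eq_square)

lemma weyl_pair_double_bracket:
  assumes "i \<in> {1..n}" "j \<in> {1..n}" "i \<noteq> j" "q i j * q j i \<noteq> 1"
    and "q i i \<noteq> -1" "q i i * q i j * q j i \<noteq> 1"
  shows "tensor.weyl_pair B (double_bracket_deriv i j) (double_bracket_mult i j)
    ((1 + q i i) * (q i j - inverse (q i i * q j i)) * (q i j - inverse (q j i)))
    ((q i i)\<^sup>2 * q i j * (q i i * q i j * q j i * q j j * q i i * q j i))"
proof -
  have "1 + q i i \<noteq> 0" using assms(5) by (metis add.commute add.inverse_unique)
  moreover have "q i j - inverse (q i i * q j i) \<noteq> 0" "q i j - inverse (q j i) \<noteq> 0"
    using assms q_nz[of j i] q_nz[of i i] by (auto simp: field_simps)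
  ultimately show ?thesis
    unfolding tensor.weyl_pair_def
    using assms(1,2,3) by (auto simp: linear_double_bracket_deriv linear_double_bracket_mult double_bracket_deriv_B double_bracket_mult_B double_bracket_deriv_mult subspace_B)
qed

end

section \<open>Braided algebras of dimension the cube of a prime\<close>

context nichols_calculus
begin

text \<open>
  An induction on the degree: if \<open>T\<close> kills all elements of smaller degree, then all \<open>\<delta>\<^sub>i\<close> kill \<open>T b\<close>.
\<close>

lemma annihilator:
  assumes T: "tlinear T" "T ` B \<subseteq> B" "\<And>b. b \<in> B \<Longrightarrow> T b [] = 0"
    and comm: "\<And>i. i \<in> {1..n} \<Longrightarrow> \<exists>c. \<forall>b\<in>B. \<delta> i (T b) = tscale c (T (\<delta> i b))"
    and b: "b \<in> B"
  shows "T b = 0"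
proof -
  obtain m where "vanishes_from m b" using bounded_B b by blast
  then show ?thesis using b
  proof (induction m arbitrary: b)
    case 0
    then have "b = 0" by (auto simp: vanishes_from_def)
    then show ?case by (simp only: tlinear_rules(4)[OF T(1)])
  next
    case (Suc m)
    show ?case
    proof (rule separated)
      fix i assume i: "i \<in> {1..n}"
      have "vanishes_from m (\<delta> i b)"
        using lowers_degree_contract Suc.prems(1) unfolding lowers_degree_def by blast
      then have "T (\<delta> i b) = 0" using Suc.IH contract_B i Suc.prems(2) by blast
      moreover obtain c where "\<forall>b\<in>B. \<delta> i (T b) = tscale c (T (\<delta> i b))" using comm[OF i] by blast
      ultimately show "\<delta> i (T b) = 0" using Suc.prems(2) by simp
    qed (use T Suc.prems in auto)
  qed
qed

lemma R_pow_linear: "i \<in> {1..n} \<Longrightarrow> tlinear (R i ^^ m)"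
  by (rule tensor.linear_funpow[OF linear_R])

end

context diagonal_calculus
begin

text \<open>
  By \<open>annihilator\<close>: since the q-integer of \<open>N\<close> vanishes, \<open>R\<^sup>N\<close> commutes with every \<open>\<delta>\<^sub>j\<close> up to a scalar.
\<close>

lemma R_pow_order:
  assumes i: "i \<in> {1..n}" and N: "q_order (q i i) N" and b: "b \<in> B"
  shows "(R i ^^ N) b = 0"
proof (rule annihilator[OF R_pow_linear[OF i] _ _ _ b])
  obtain M where M: "N = Suc M" using N by (cases N) (auto simp: q_order_def)
  show "(R i ^^ N) b [] = 0" if "b \<in> B" for b using that i by (auto simp: M R_Nil R_pow_B)
  show "\<exists>c. \<forall>b\<in>B. \<delta> j ((R i ^^ N) b) = tscale c ((R i ^^ N) (\<delta> j b))" if j: "j \<in> {1..n}" for j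
  proof (cases "j = i")
    case True
    have "qint N (q i i) = 0" using N by (simp add: q_order_def)
    then have "\<forall>b\<in>B. \<delta> i ((R i ^^ N) b) = tscale (q i i ^ N) ((R i ^^ N) (\<delta> i b))"
      using tensor.weyl_pair_funpow_right[OF weyl_pair_generator[OF i self_eigen_q[OF i]], of _ N] by simp
    then show ?thesis unfolding True by blast
  next
    case False
    have "\<delta> j ((R i ^^ m) b) = tscale (q j i ^ m) ((R i ^^ m) (\<delta> j b))" if "b \<in> B" for m b
      using that
    proof (induction m)
      case (Suc m)
      then show ?case using i j False
        by (simp add: contract_R_diag R_pow_B tlinear_rules[OF linear_R])
    qed simp
    then show ?thesis by blast
  qed
qed (use i R_pow_B in blast)

lemma bracket_mult_eq_0:
  assumes "i \<in> {1..n}" "j \<in> {1..n}" "i \<noteq> j" "q i j * q j i = 1" "b \<in> B"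
  shows "bracket_mult i j b = 0"
proof (rule annihilator[OF linear_bracket_mult _ _ _ \<open>b \<in> B\<close>])
  show "bracket_mult i j b [] = 0" if "b \<in> B" for b
    using that assms by (simp add: bracket_mult_def R_Nil R_B tscale_def)
  show "\<exists>c. \<forall>b\<in>B. \<delta> k (bracket_mult i j b) = tscale c (bracket_mult i j (\<delta> k b))" if k: "k \<in> {1..n}" for k
  proof -
    consider "k = i" | "k = j" | "k \<noteq> i" "k \<noteq> j" by blast
    then show ?thesis
    proof cases
      case 1
      have "q i j - inverse (q j i) = 0" using assms by (simp add: inverse_unique mult.commute)
      then have "\<forall>b\<in>B. \<delta> i (bracket_mult i j b) = tscale (q i i * q i j) (bracket_mult i j (\<delta> i b))"
        using assms(1,2,3) by (simp add: contract_bracket_mult_left)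
      then show ?thesis unfolding 1 by blast
    next
      case 2
      then show ?thesis using contract_bracket_mult_right assms(1,2,3) by blast
    next
      case 3
      then show ?thesis using contract_bracket_mult_other assms(1,2) k by blast
    qed
  qed
qed (use assms bracket_mult_B in auto)

lemma dim_rank_le_one:
  assumes "n = 0"
  shows "tensor.dim B \<le> 1"
proof -
  have "B \<subseteq> basic_part"
    by (rule generated) (use assms in \<open>auto simp: basic_part_def tensor.span_base\<close>)
  then have "tensor.dim B \<le> card {unit_tensor :: ('k, 'v) tensor}"
    by (intro tensor.dim_le_card) (auto simp: basic_part_def)
  then show ?thesis by simp
qed

lemma unit_in_tower: "unit_tensor \<in> U \<Longrightarrow> 0 < M \<Longrightarrow> unit_tensor \<in> tensor.tower S M U"
  using tensor.in_tower[of unit_tensor U 0 M S] by simp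

lemma unit_basic_part: "unit_tensor \<in> basic_part"
  by (auto simp: basic_part_def intro: tensor.span_base)

lemma tower_B: "i \<in> {1..n} \<Longrightarrow> U \<subseteq> B \<Longrightarrow> tensor.tower (R i) M U \<subseteq> B"
  by (rule tensor.tower_subset[OF subspace_B]) (auto simp: R_B)

lemma dim_rank_one:
  assumes "n = 1" "q_order (q 1 1) N"
  shows "tensor.dim B \<le> N"
proof -
  have one: "1 \<in> {1..n}" using assms by simp
  have "B \<subseteq> tensor.tower (R 1) N basic_part"
  proof (rule generated)
    show "unit_tensor \<in> tensor.tower (R 1) N basic_part"
      by (rule unit_in_tower[OF unit_basic_part]) (use assms in \<open>simp add: q_order_def\<close>)
    have "R 1 ` tensor.tower (R 1) N basic_part \<subseteq> tensor.tower (R 1) N basic_part"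
      by (rule tensor.tower_stable[OF linear_R[OF one]]) (use R_pow_order[OF one assms(2)] basic_part_B in blast)
    then show "R j b \<in> tensor.tower (R 1) N basic_part"
      if "j \<in> {1..n}" "b \<in> tensor.tower (R 1) N basic_part" for j b
      using that assms(1) by auto
  qed simp
  then have "B = tensor.tower (R 1) N basic_part" using tower_B[OF one basic_part_B] by blast
  then have "tensor.dim B \<le> N * tensor.dim basic_part"
    using tensor.dim_tower_le[OF linear_R[OF one], of "{unit_tensor}" basic_part N]
    by (simp add: basic_part_def)
  then show ?thesis by (simp add: dim_basic_part)
qed

text \<open>
  The generators commute up to scalars, so the monomials \<open>x\<^sub>1\<^sup>a x\<^sub>2\<^sup>b\<close> with exponents below the orders span a
  subspace that is stable under both right multiplications.
\<close>

lemma dim_rank_two: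
  assumes n: "n = 2" and s: "q 1 2 * q 2 1 = 1"
    and N: "q_order (q 1 1) N1" "q_order (q 2 2) N2"
  shows "tensor.dim B \<le> N2 * N1"
proof -
  have ix: "1 \<in> {1..n}" "2 \<in> {1..n}" using n by auto
  note lin = linear_R[OF ix(1)] linear_R[OF ix(2)]
  define U where "U = tensor.tower (R 1) N1 basic_part"
  define T where "T = tensor.tower (R 2) N2 U"
  have U_B: "U \<subseteq> B" unfolding U_def by (rule tower_B[OF ix(1) basic_part_B])
  have T_B: "T \<subseteq> B" unfolding T_def by (rule tower_B[OF ix(2) U_B])
  have U1: "R 1 ` U \<subseteq> U" unfolding U_def
    by (rule tensor.tower_stable[OF lin(1)]) (use R_pow_order[OF ix(1) N(1)] basic_part_B in blast)
  have T2: "R 2 ` T \<subseteq> T" unfolding T_def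
    by (rule tensor.tower_stable[OF lin(2)]) (use R_pow_order[OF ix(2) N(2)] U_B in blast)
  have comm: "R 1 (R 2 b) = tscale (q 2 1) (R 2 (R 1 b))" if "b \<in> B" for b
  proof -
    have "R 2 (R 1 b) = tscale (inverse (q 2 1)) (R 1 (R 2 b))"
      using bracket_mult_eq_0[OF ix _ s that] by (simp add: bracket_mult_def)
    moreover have "tscale (q 2 1) (tscale (inverse (q 2 1)) v) = v" for v :: "('k, 'v) tensor"
      using q_nz[OF ix(2,1)] by simp
    ultimately show ?thesis by metis
  qed
  have comm_pow: "R 1 ((R 2 ^^ a) b) = tscale (q 2 1 ^ a) ((R 2 ^^ a) (R 1 b))" if "b \<in> B" for a b
    using that
  proof (induction a)
    case (Suc a)
    have "R 1 ((R 2 ^^ Suc a) b) = R 1 (R 2 ((R 2 ^^ a) b))" by simp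
    also have "\<dots> = tscale (q 2 1) (R 2 (R 1 ((R 2 ^^ a) b)))"
      by (rule comm) (use R_pow_B ix Suc.prems in blast)
    finally show ?case
      unfolding Suc.IH[OF Suc.prems] by (simp add: tlinear_rules[OF lin(2)])
  qed simp
  have T1: "R 1 x \<in> T" if "x \<in> T" for x
    using that unfolding T_def tensor.tower_def
  proof (induction rule: tensor.span_induct_alt)
    case base
    then show ?case by (metis tlinear_rules(4)[OF lin(1)] tensor.span_zero)
  next
    case (step c x y)
    obtain a u where a: "a < N2" "u \<in> U" "x = (R 2 ^^ a) u" using step(1) by blast
    have "(R 2 ^^ a) (R 1 u) \<in> tensor.span (\<Union>a<N2. (R 2 ^^ a) ` U)"
      using a U1 by (intro tensor.span_base) blast
    moreover have "R 1 x = tscale (q 2 1 ^ a) ((R 2 ^^ a) (R 1 u))"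
      unfolding a(3) by (rule comm_pow) (use a U_B in blast)
    ultimately have "R 1 x \<in> tensor.span (\<Union>a<N2. (R 2 ^^ a) ` U)"
      by (simp only: tensor.span_scale)
    then show ?case using step(2)
      by (simp only: tlinear_rules[OF lin(1)]) (intro tensor.span_add tensor.span_scale)
  qed
  have "B \<subseteq> T"
  proof (rule generated)
    show "tensor.subspace T" by (simp add: T_def)
    show "unit_tensor \<in> T" unfolding T_def U_def
      by (intro unit_in_tower unit_basic_part) (use N in \<open>auto simp: q_order_def\<close>)
    fix j b assume "j \<in> {1..n}" "b \<in> T"
    moreover have "j = 1 \<or> j = 2" using \<open>j \<in> {1..n}\<close> n by auto
    ultimately show "R j b \<in> T" using T1 T2 by blast
  qed
  then have "B = T" using T_B by blast
  obtain A where A: "finite A" "B \<subseteq> tensor.span A" using finite_dim_B by blast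
  have "tensor.dim T \<le> N2 * tensor.dim U"
    unfolding T_def using tensor.dim_tower_le[OF lin(2) A(1)] U_B A(2) by blast
  also have "tensor.dim U \<le> N1 * tensor.dim basic_part"
    unfolding U_def using tensor.dim_tower_le[OF lin(1) A(1)] basic_part_B A(2) by blast
  finally show ?thesis by (simp add: \<open>B = T\<close> dim_basic_part)
qed

lemma double_bracket_deriv_R:
  assumes "i \<in> {1..n}" "j \<in> {1..n}" "i \<noteq> j" "b \<in> B"
  shows "double_bracket_deriv i j (R i b) = tscale ((q i i)\<^sup>2 * q j i) (R i (double_bracket_deriv i j b))"
  using assms q_nz[of j i] q_nz[of i i]
  by (simp add: double_bracket_deriv_def bracket_deriv_R expand_bracket)
    (auto simp: tscale_def fun_eq_iff field_simps power2_eq_square)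

text \<open>
  The lowest tower, spanned by the powers of \<open>x\<^sub>i\<close>: everything but \<open>\<delta>\<^sub>i\<close> kills it.
\<close>

lemma powers_part:
  assumes i: "i \<in> {1..n}" and N: "q_order (q i i) N"
  defines "U \<equiv> tensor.tower (R i) N basic_part"
  shows "part_of_dim N U"
    and "\<And>j u. j \<in> {1..n} \<Longrightarrow> j \<noteq> i \<Longrightarrow> u \<in> U \<Longrightarrow> \<delta> j u = 0"
    and "\<And>j u. j \<in> {1..n} \<Longrightarrow> j \<noteq> i \<Longrightarrow> u \<in> U \<Longrightarrow> bracket_deriv i j u = 0"
    and "\<And>j u. j \<in> {1..n} \<Longrightarrow> j \<noteq> i \<Longrightarrow> u \<in> U \<Longrightarrow> double_bracket_deriv i j u = 0"
proof -
  have RB: "R i ` B \<subseteq> B" using i R_B by blast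
  have R0: "R i 0 = 0" using tlinear_rules(4)[OF linear_R[OF i]] .
  have "part_of_dim (1 * N) U"
    unfolding U_def
    by (rule part_of_dim_tower[OF part_of_dim_basic weyl_pair_generator[OF i self_eigen_q[OF i]]])
      (use kernel_basic_part[OF tlinear_contract contract_unit] q_order_nz[OF N] in auto)
  then show "part_of_dim N U" by simp
  have E0: "bracket_deriv i j unit_tensor = 0" for j
    by (simp add: bracket_deriv_def contract_unit tlinear_rules(4)[OF tlinear_contract])
  have F0: "double_bracket_deriv i j unit_tensor = 0" for j
    by (simp add: double_bracket_deriv_def E0 contract_unit tlinear_rules(4)[OF tlinear_contract] tlinear_rules(4)[OF linear_bracket_deriv])
  note kt = kernel_tower[OF _ linear_R[OF i] RB basic_part_B, rotated -1]
  fix j u assume j: "j \<in> {1..n}" "j \<noteq> i" and u: "u \<in> U"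
  note u = u[unfolded U_def]
  show "\<delta> j u = 0"
    by (rule kt[OF u tlinear_contract kernel_basic_part[OF tlinear_contract contract_unit]])
      (use contract_R_kernel i j in auto)
  show "bracket_deriv i j u = 0"
    by (rule kt[OF u linear_bracket_deriv kernel_basic_part[OF linear_bracket_deriv E0]]) (use bracket_deriv_R i j R0 in auto)
  show "double_bracket_deriv i j u = 0"
    by (rule kt[OF u linear_double_bracket_deriv kernel_basic_part[OF linear_double_bracket_deriv F0]]) (use double_bracket_deriv_R i j R0 in auto)
qed

text \<open>
  The two middle storeys, powers of \<open>w\<close> followed by powers of \<open>x\<^sub>j\<close>.  The order matters: \<open>\<delta>\<^sub>j\<close> kills \<open>w\<close>, so it
  kills everything below the powers of \<open>x\<^sub>j\<close>, whereas \<open>\<delta>\<^sub>i\<close> does not kill \<open>w\<close>.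
\<close>

lemma part_of_dim_bracket_R:
  assumes ij: "i \<in> {1..n}" "j \<in> {1..n}" "i \<noteq> j" "q i j * q j i \<noteq> 1"
    and N: "q_order (q i i * q i j * q j i * q j j) N" "q_order (q j j) Nj"
    and U: "part_of_dim m U" "\<And>u. u \<in> U \<Longrightarrow> bracket_deriv i j u = 0" "\<And>u. u \<in> U \<Longrightarrow> \<delta> j u = 0"
  defines "T \<equiv> tensor.tower (R j) Nj (tensor.tower (bracket_mult i j) N U)"
  shows "part_of_dim (m * N * Nj) T"
    and "\<And>k u. k \<in> {1..n} - {i, j} \<Longrightarrow> (\<And>u. u \<in> U \<Longrightarrow> \<delta> k u = 0) \<Longrightarrow> u \<in> T \<Longrightarrow> \<delta> k u = 0"
proof -
  let ?U = "tensor.tower (bracket_mult i j) N U"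
  have R0: "R l 0 = 0" if "l \<in> {1..n}" for l using tlinear_rules(4)[OF linear_R[OF that]] .
  have W0: "bracket_mult i j 0 = 0" using tlinear_rules(4)[OF linear_bracket_mult[OF ij(1,2)]] .
  have RB: "R j ` B \<subseteq> B" and WB: "bracket_mult i j ` B \<subseteq> B" using ij R_B bracket_mult_B by blast+
  have U_B: "U \<subseteq> B" using U(1) by (simp add: part_of_dim_def)
  have U': "part_of_dim (m * N) ?U"
    by (rule part_of_dim_tower[OF U(1) weyl_pair_bracket[OF ij]]) (use U(2) q_order_nz[OF N(1)] in auto)
  note kt = kernel_tower[OF tlinear_contract linear_bracket_mult[OF ij(1,2)] WB U_B, rotated -1]
  have ker: "\<delta> j u = 0" if "u \<in> ?U" for u
    by (rule kt[OF that U(3)]) (use contract_bracket_mult_right ij W0 in auto)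
  show "part_of_dim (m * N * Nj) T"
    unfolding T_def
    by (rule part_of_dim_tower[OF U' weyl_pair_generator[OF ij(2) self_eigen_q[OF ij(2)]]])
      (use ker q_order_nz[OF N(2)] in auto)
  fix k u assume k: "k \<in> {1..n} - {i, j}" "\<And>u. u \<in> U \<Longrightarrow> \<delta> k u = 0" and u: "u \<in> T"
  have ker: "\<delta> k u = 0" if "u \<in> ?U" for u
    by (rule kt[OF that k(2)]) (use contract_bracket_mult_other[of i j k] k ij W0 in auto)
  have "?U \<subseteq> B" using U' by (simp add: part_of_dim_def)
  show "\<delta> k u = 0"
    by (rule kernel_tower[OF tlinear_contract linear_R[OF ij(2)] RB \<open>?U \<subseteq> B\<close> ker _ u[unfolded T_def]])
      (use contract_R_kernel k ij in auto)
qed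

lemma root_vector_order:
  assumes "i \<in> {1..n}" "j \<in> {1..n}" "i \<noteq> j" "q i j * q j i \<noteq> 1"
  obtains N where "q_order (q i i * q i j * q j i * q j j) N" "N dvd tensor.dim B"
proof -
  have "bracket_deriv i j unit_tensor = 0"
    by (simp add: bracket_deriv_def contract_unit tlinear_rules(4)[OF tlinear_contract])
  then show thesis using weyl_pair_order[OF weyl_pair_bracket[OF assms] lowers_degree_bracket_deriv] that by blast
qed

lemma dim_ge_root_vector:
  assumes ij: "i \<in> {1..n}" "j \<in> {1..n}" "i \<noteq> j" "q i j * q j i \<noteq> 1"
    and N: "q_order (q i i) Ni" "q_order (q i i * q i j * q j i * q j j) N" "q_order (q j j) Nj"
  shows "Ni * N * Nj \<le> tensor.dim B"
  by (rule part_of_dim_le[OF part_of_dim_bracket_R(1)[OF ij N(2,3) powers_part(1)[OF ij(1) N(1)]]])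
    (use powers_part(2,3)[OF ij(1) N(1)] ij in auto)

lemma dim_ge_root_vector_third:
  assumes ij: "i \<in> {1..n}" "j \<in> {1..n}" "i \<noteq> j" "q i j * q j i \<noteq> 1"
    and k: "k \<in> {1..n} - {i, j}"
    and N: "q_order (q i i) Ni" "q_order (q i i * q i j * q j i * q j j) N" "q_order (q j j) Nj"
      "q_order (q k k) Nk"
  shows "Ni * N * Nj * Nk \<le> tensor.dim B"
proof -
  let ?T = "tensor.tower (R j) Nj (tensor.tower (bracket_mult i j) N (tensor.tower (R i) Ni basic_part))"
  note pp = powers_part[OF ij(1) N(1)]
  have T: "part_of_dim (Ni * N * Nj) ?T"
    by (rule part_of_dim_bracket_R(1)[OF ij N(2,3) pp(1)]) (use pp(2,3) ij in auto)
  have "\<delta> k u = 0" if "u \<in> ?T" for u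
    by (rule part_of_dim_bracket_R(2)[OF ij N(2,3) pp(1) _ _ k _ that]) (use pp(2,3) ij k in auto)
  then show ?thesis
    using k self_eigen_q q_order_nz[OF N(4)]
    by (intro part_of_dim_le[OF part_of_dim_tower[OF T weyl_pair_generator]]) auto
qed

text \<open>
  If the iterated commutator is nonzero, its powers 0 and 1 can be inserted between those of \<open>x\<^sub>i\<close> and
  those of \<open>w\<close>.  The exponent 1 is always available, whatever the parameter of its q-Weyl relation.
\<close>

lemma dim_ge_second_root_vector:
  assumes ij: "i \<in> {1..n}" "j \<in> {1..n}" "i \<noteq> j" "q i j * q j i \<noteq> 1"
    and V: "q i i \<noteq> -1" "q i i * q i j * q j i \<noteq> 1"
    and N: "q_order (q i i) Ni" "q_order (q i i * q i j * q j i * q j j) N" "q_order (q j j) Nj"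
  shows "Ni * 2 * N * Nj \<le> tensor.dim B"
proof -
  let ?U = "tensor.tower (R i) Ni basic_part"
  let ?T = "tensor.tower (double_bracket_mult i j) 2 ?U"
  note pp = powers_part[OF ij(1) N(1)]
  have U_B: "?U \<subseteq> B" using pp(1) by (simp add: part_of_dim_def)
  have VB: "double_bracket_mult i j ` B \<subseteq> B" using double_bracket_mult_B ij by blast
  have V0: "double_bracket_mult i j 0 = 0" using tlinear_rules(4)[OF linear_double_bracket_mult[OF ij(1,2)]] .
  have T: "part_of_dim (Ni * 2) ?T"
    by (rule part_of_dim_tower[OF pp(1) weyl_pair_double_bracket[OF ij V]])
      (use pp(4) ij in \<open>auto simp: less_2_cases_iff qint_def\<close>)
  note kt = kernel_tower[OF _ linear_double_bracket_mult[OF ij(1,2)] VB U_B, rotated -1]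
  have "bracket_deriv i j u = 0" if "u \<in> ?T" for u
    by (rule kt[OF that linear_bracket_deriv]) (use pp(3) bracket_deriv_double_mult ij V0 in auto)
  moreover have "\<delta> j u = 0" if "u \<in> ?T" for u
    by (rule kt[OF that tlinear_contract]) (use pp(2) contract_double_bracket_mult_right ij V0 in auto)
  ultimately show ?thesis
    by (intro part_of_dim_le[OF part_of_dim_bracket_R(1)[OF ij N(2,3) T]])
qed

text \<open>
  Write \<open>N(q\<^sub>i\<^sub>i) = p\<^sup>e\<^sup>i\<close> with \<open>e i \<ge> 1\<close>.  The lower bounds say that the exponents involved add up to at
  most 3.  A commutator adds an exponent \<open>f \<ge> 1\<close>, which leaves room only for \<open>n = 2\<close> and exponents 1.
  For the last alternative with \<open>p = 2\<close>, the three parameters of order 2 are all -1, which already gives the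
  relations; for odd \<open>p\<close> no parameter is -1, and the vanishing of the iterated commutators gives them.
\<close>

theorem classification_dim_cube:
  assumes p: "prime p" and d: "tensor.dim B = p ^ 3"
  obtains
    (three) "n = 3" "quantum_linear_space n q" "\<And>i. i \<in> {1..3} \<Longrightarrow> q_order (q i i) p"
  | (two) i j where "n = 2" "{i, j} = {1, 2}" "quantum_linear_space n q" "q_order (q i i) p" "q_order (q j j) (p ^ 2)"
  | (A2) "n = 2" "q 1 2 * q 2 1 \<noteq> 1" "q 1 1 * (q 1 2 * q 2 1) = 1" "q 2 2 = q 1 1" "q_order (q 1 1) p"
  | (one) "n = 1" "q_order (q 1 1) (p ^ 3)"
proof -
  have p2: "2 \<le> p" using p by (rule prime_ge_2_nat)
  have "\<exists>e\<ge>1. q_order (q i i) (p ^ e)" if i: "i \<in> {1..n}" for i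
    using generator_order[OF i self_eigen_q[OF i]] prime_power_order[OF p d] by metis
  then obtain e where e: "\<And>i. i \<in> {1..n} \<Longrightarrow> 1 \<le> e i \<and> q_order (q i i) (p ^ e i)" by metis
  have le3: "a \<le> 3" if "p ^ a \<le> tensor.dim B" for a
    using that p2 unfolding d by (metis power_le_imp_le_exp Suc_1 Suc_le_lessD)
  have "(\<Prod>i=1..n. p ^ e i) \<le> tensor.dim B"
    by (rule ordered_products[of "\<lambda>i. q i i"]) (use e self_eigen_q in auto)
  then have sum3: "(\<Sum>i=1..n. e i) \<le> 3" using le3 by (simp add: power_sum)
  have f: "\<exists>f\<ge>1. q_order (q i i * q i j * q j i * q j j) (p ^ f) \<and> e i + f + e j \<le> 3"
    if ij: "i \<in> {1..n}" "j \<in> {1..n}" "i \<noteq> j" "q i j * q j i \<noteq> 1" for i j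
  proof -
    obtain N where "q_order (q i i * q i j * q j i * q j j) N" "N dvd tensor.dim B"
      using root_vector_order[OF ij] by blast
    then obtain f where f: "1 \<le> f" "q_order (q i i * q i j * q j i * q j j) (p ^ f)"
      using prime_power_order[OF p d] by blast
    have "p ^ e i * p ^ f * p ^ e j \<le> tensor.dim B"
      by (rule dim_ge_root_vector[OF ij]) (use e ij f in auto)
    then show ?thesis using f le3 by (auto simp flip: power_add)
  qed
  have "n \<le> (\<Sum>i=1..n. e i)" using sum_mono[of "{1..n}" "\<lambda>i. 1" e] e by simp
  then have "n \<le> 3" using sum3 by simp
  moreover have "n \<noteq> 0"
  proof
    assume "n = 0"
    then have "p ^ 3 \<le> 1" using dim_rank_le_one d by simp
    then show False using p2 one_less_power[of p 3] by simp
  qed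
  ultimately consider "n = 1" | "n = 2" | "n = 3" by fastforce
  then show thesis
  proof cases
    case 1
    then have "p ^ 3 \<le> p ^ e 1" using dim_rank_one[of "p ^ e 1"] e d by simp
    then have "3 \<le> e 1" using p2 by (simp add: power_le_imp_le_exp)
    moreover have "e 1 \<le> 3" using sum3 1 by simp
    ultimately have "e 1 = 3" by simp
    then show thesis using one[OF 1] e[of 1] 1 by simp
  next
    case 2
    have s12: "e 1 + e 2 \<le> 3" using sum3 2 by (simp add: numeral_2_eq_2)
    have ix: "1 \<in> {1..n}" "2 \<in> {1..n}" "(1::nat) \<noteq> 2" using 2 by auto
    show thesis
    proof (cases "q 1 2 * q 2 1 = 1")
      case True
      have "p ^ 3 \<le> p ^ e 2 * p ^ e 1"
        using dim_rank_two[OF 2 True] e ix d by simp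
      then have "3 \<le> e 2 + e 1" using p2 by (simp add: power_le_imp_le_exp flip: power_add)
      then consider "e 1 = 1" "e 2 = 2" | "e 1 = 2" "e 2 = 1" using s12 e[OF ix(1)] e[OF ix(2)] by linarith
      moreover have "quantum_linear_space n q"
      proof -
        have "i = 1 \<or> i = 2" if "i \<in> {1..n}" for i using that 2 by auto
        then show ?thesis unfolding quantum_linear_space_def
          using True by (metis mult.commute)
      qed
      ultimately show thesis
      proof cases
        case 1
        then show thesis using two[of 1 2] e[OF ix(1)] e[OF ix(2)] 2 \<open>quantum_linear_space n q\<close> by simp
      next
        case 2
        then show thesis using two[of 2 1] e[OF ix(1)] e[OF ix(2)] \<open>n = 2\<close> \<open>quantum_linear_space n q\<close> by auto
      qed
    next
      case False
      have False': "q 2 1 * q 1 2 \<noteq> 1" using False by (simp add: mult.commute)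
      let ?Q = "q 1 1 * q 1 2 * q 2 1 * q 2 2"
      have Qcomm: "q 2 2 * q 2 1 * q 1 2 * q 1 1 = ?Q" by (simp add: mult_ac)
      obtain f where f: "1 \<le> f" "q_order ?Q (p ^ f)" "e 1 + f + e 2 \<le> 3"
        using f[OF ix False] by blast
      then have ef: "e 1 = 1" "e 2 = 1" "f = 1" using e[OF ix(1)] e[OF ix(2)] by linarith+
      then have ord: "q_order (q 1 1) p" "q_order (q 2 2) p" "q_order ?Q p"
        using e[OF ix(1)] e[OF ix(2)] f(2) unfolding ef by simp_all
      \<comment> \<open>a nonzero iterated commutator would add a factor 2 to the lower bound \<open>p\<^sup>3\<close>, which is attained already\<close>
      have big: "\<not> p * 2 * p * p \<le> tensor.dim B"
        using p2 by (simp add: d power3_eq_cube)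
      have V1: "q 1 1 = -1 \<or> q 1 1 * q 1 2 * q 2 1 = 1"
        using dim_ge_second_root_vector[OF ix False _ _ ord(1,3,2)] big by blast
      have V2: "q 2 2 = -1 \<or> q 2 2 * q 2 1 * q 1 2 = 1"
        using dim_ge_second_root_vector[OF ix(2,1) _ False' _ _ ord(2) _ ord(1)] ord(3) big ix
        unfolding Qcomm by metis
      have "q 1 1 * (q 1 2 * q 2 1) = 1 \<and> q 2 2 = q 1 1"
      proof (cases "p = 2")
        case True
        have m1: "x = -1" if "q_order x 2" for x :: 'k
          using that q_order_power[OF that, of 2] q_order_power[OF that, of 1] power2_eq_1_iff[of x] by auto
        have a: "q 1 1 = -1" and b: "q 2 2 = -1" and c: "?Q = -1"
          using ord unfolding True by (blast intro: m1)+
        have "q 1 2 * q 2 1 = -1" using c unfolding a b by simp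
        then show ?thesis unfolding a b by simp
      next
        case False
        then have "odd p" using p by (metis prime_nat_iff' primes_dvd_imp_eq two_is_prime_nat)
        then have "x \<noteq> -1" if "q_order x p" for x :: 'k
          using q_order_power[OF that, of p] by auto
        then have "q 1 1 * (q 1 2 * q 2 1) = 1" "q 2 2 * (q 1 2 * q 2 1) = 1"
          using V1 V2 ord by (auto simp: mult_ac)
        then show ?thesis by (metis mult.commute mult_right_cancel mult_zero_right zero_neq_one)
      qed
      then show thesis using A2[OF 2 False] ord by simp
    qed
  next
    case 3
    have s123: "e 1 + e 2 + e 3 \<le> 3" using sum3 3 by (simp add: numeral_3_eq_3 numeral_2_eq_2)
    have ei: "e i = 1" if "i \<in> {1..3}" for i
    proof -
      have "1 \<le> e 1" "1 \<le> e 2" "1 \<le> e 3" using e 3 by auto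
      moreover have "i = 1 \<or> i = 2 \<or> i = 3" using that by auto
      ultimately show ?thesis using s123 by fastforce
    qed
    have "q i j * q j i = 1" if ij: "i \<in> {1..n}" "j \<in> {1..n}" "i \<noteq> j" for i j
    proof (rule ccontr)
      assume s: "q i j * q j i \<noteq> 1"
      have "\<exists>k. k \<in> {1..n} - {i, j}"
      proof -
        have "card {i, j} < card {1..n}" using 3 card_insert_le_m1[of 2 "{j}" i] by simp
        then have "\<not> {1..n} \<subseteq> {i, j}" by (metis card_mono finite.emptyI finite.insertI not_less)
        then show ?thesis by blast
      qed
      then obtain k where k: "k \<in> {1..n} - {i, j}" by blast
      obtain f where f: "1 \<le> f" "q_order (q i i * q i j * q j i * q j j) (p ^ f)"
        using f[OF ij s] by blast
      have "p ^ e i * p ^ f * p ^ e j * p ^ e k \<le> tensor.dim B"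
        by (rule dim_ge_root_vector_third[OF ij s k]) (use e ij f k in auto)
      then have "e i + f + e j + e k \<le> 3" using le3 by (auto simp flip: power_add)
      then show False using ei[of i] ei[of j] ei[of k] ij k 3 f(1) by auto
    qed
    then have "quantum_linear_space n q" by (simp add: quantum_linear_space_def)
    moreover have "q_order (q i i) p" if "i \<in> {1..3}" for i using e[of i] ei[OF that] that 3 by simp
    ultimately show thesis using three 3 by blast
  qed
qed

end

section \<open>Reduced words of permutations\<close>

unbundle no m_inv_syntax

lemma word_perm_simps [simp]:
  "word_perm [] = id"
  "word_perm (i # ws) = transpose i (Suc i) \<circ> word_perm ws"
  by (simp_all add: word_perm_def)

lemma word_perm_append: "word_perm (us @ ws) = word_perm us \<circ> word_perm ws"
  by (induction us) (auto simp: comp_assoc)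

lemma word_perm_permutes: "set ws \<subseteq> {i. Suc i < n} \<Longrightarrow> word_perm ws permutes {..<n}"
  by (induction ws) (auto intro!: permutes_compose permutes_swap_id simp: permutes_id)

lemma bij_word_perm [simp]: "bij (word_perm ws)"
proof (induction ws)
  case (Cons i ws)
  show ?case unfolding word_perm_simps by (rule bij_comp[OF Cons bij_transpose])
qed (simp only: word_perm_simps bij_id)

text \<open>
  The head of a word acts last.  It exchanges the entries in the positions \<open>i\<close> and \<open>i + 1\<close>, and the condition says
  that these have not been exchanged with each other before.
\<close>

fun ascending :: "nat list \<Rightarrow> bool" where
  "ascending [] \<longleftrightarrow> True"
| "ascending (i # ws) \<longleftrightarrow> ascending ws \<and> inv (word_perm ws) i < inv (word_perm ws) (Suc i)"

definition inversions :: "nat \<Rightarrow> (nat \<Rightarrow> nat) \<Rightarrow> (nat \<times> nat) set" where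
  "inversions n \<sigma> = {(a, b). a < b \<and> b < n \<and> \<sigma> b < \<sigma> a}"

lemma finite_inversions [simp]: "finite (inversions n \<sigma>)"
  by (rule finite_subset[of _ "{..<n} \<times> {..<n}"]) (auto simp: inversions_def)

lemma inversions_id [simp]: "inversions n id = {}"
  by (auto simp: inversions_def)

lemma transpose_Suc_less:
  "{x, y} \<noteq> {i, Suc i} \<Longrightarrow> x \<noteq> y \<Longrightarrow> transpose i (Suc i) x < transpose i (Suc i) y \<longleftrightarrow> x < (y::nat)"
  by (auto simp: transpose_def doubleton_eq_iff)

text \<open>
  Exchanging the values \<open>i\<close> and \<open>i + 1\<close> changes the relative order of one pair only.
\<close>

lemma card_inversions_ascent:
  assumes \<sigma>: "\<sigma> permutes {..<n}" and i: "Suc i < n" and asc: "inv \<sigma> i < inv \<sigma> (Suc i)"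
  shows "card (inversions n (transpose i (Suc i) \<circ> \<sigma>)) = Suc (card (inversions n \<sigma>))"
proof -
  let ?\<tau> = "transpose i (Suc i) \<circ> \<sigma>" and ?a = "inv \<sigma> i" and ?b = "inv \<sigma> (Suc i)"
  have ab: "\<sigma> ?a = i" "\<sigma> ?b = Suc i" using \<sigma> by (auto simp: permutes_inverses)
  have "?b < n" using permutes_in_image[OF permutes_inv[OF \<sigma>], of "Suc i"] i by simp
  have inj: "\<sigma> x = \<sigma> y \<longleftrightarrow> x = y" for x y using \<sigma> by (auto simp: permutes_inj inj_eq)
  have "(x, y) \<in> inversions n ?\<tau> \<longleftrightarrow> (x, y) \<in> insert (?a, ?b) (inversions n \<sigma>)" for x y
    proof (cases "x < y \<and> {\<sigma> x, \<sigma> y} = {i, Suc i}")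
      case True
      then have "x = ?a \<and> y = ?b \<or> x = ?b \<and> y = ?a"
        using ab inj by (metis doubleton_eq_iff)
      then have "x = ?a" "y = ?b" using True asc by auto
      then show ?thesis using asc \<open>?b < n\<close> ab by (simp add: inversions_def)
    next
      case False
      have "(x, y) \<noteq> (?a, ?b)" using False asc ab by (auto simp: insert_commute)
      moreover have "transpose i (Suc i) (\<sigma> y) < transpose i (Suc i) (\<sigma> x) \<longleftrightarrow> \<sigma> y < \<sigma> x" if "x < y"
        using False that by (intro transpose_Suc_less) (auto simp: insert_commute inj)
      ultimately show ?thesis by (auto simp: inversions_def)
    qed
  then have "inversions n ?\<tau> = insert (?a, ?b) (inversions n \<sigma>)"
    by (intro subset_antisym subrelI) blast+
  moreover have "(?a, ?b) \<notin> inversions n \<sigma>" by (simp add: inversions_def ab)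
  ultimately show ?thesis by (metis card_insert_disjoint finite_inversions)
qed

lemma inv_transpose_comp:
  assumes "bij \<sigma>"
  shows "inv (transpose i (Suc i) \<circ> \<sigma>) = inv \<sigma> \<circ> transpose i (Suc i)"
  using assms by (subst o_inv_distrib) auto

lemma card_inversions_descent:
  assumes \<sigma>: "\<sigma> permutes {..<n}" and i: "Suc i < n" and desc: "inv \<sigma> (Suc i) < inv \<sigma> i"
  shows "Suc (card (inversions n (transpose i (Suc i) \<circ> \<sigma>))) = card (inversions n \<sigma>)"
proof -
  let ?\<tau> = "transpose i (Suc i) \<circ> \<sigma>"
  have "?\<tau> permutes {..<n}" using \<sigma> i by (intro permutes_compose permutes_swap_id) auto
  moreover have "inv ?\<tau> i < inv ?\<tau> (Suc i)"
    using desc permutes_bij[OF \<sigma>] by (simp add: inv_transpose_comp)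
  ultimately have "card (inversions n (transpose i (Suc i) \<circ> ?\<tau>)) = Suc (card (inversions n ?\<tau>))"
    using i by (intro card_inversions_ascent)
  moreover have "transpose i (Suc i) \<circ> ?\<tau> = \<sigma>" by (simp add: comp_assoc[symmetric])
  ultimately show ?thesis by simp
qed

text \<open>
  A letter changes the number of inversions by one, upwards exactly if it is ascending.
\<close>

lemma card_inversions_le_length:
  assumes "set ws \<subseteq> {i. Suc i < n}"
  shows "card (inversions n (word_perm ws)) \<le> length ws"
    and "ascending ws \<longleftrightarrow> card (inversions n (word_perm ws)) = length ws"
proof -
  have "card (inversions n (word_perm ws)) \<le> length ws \<and>
    (ascending ws \<longleftrightarrow> card (inversions n (word_perm ws)) = length ws)"
    using assms
  proof (induction ws)
    case Nil
    show ?case unfolding word_perm_simps inversions_id by simp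
  next
    case (Cons i ws)
    let ?\<sigma> = "word_perm ws"
    have i: "Suc i < n" and \<sigma>: "?\<sigma> permutes {..<n}" using Cons.prems word_perm_permutes by auto
    have IH: "card (inversions n ?\<sigma>) \<le> length ws"
      "ascending ws \<longleftrightarrow> card (inversions n ?\<sigma>) = length ws" using Cons by auto
    have "inv ?\<sigma> i \<noteq> inv ?\<sigma> (Suc i)" using permutes_inverses(1)[OF \<sigma>] by (metis n_not_Suc_n)
    then consider "inv ?\<sigma> i < inv ?\<sigma> (Suc i)" | "inv ?\<sigma> (Suc i) < inv ?\<sigma> i" by linarith
    then show ?case
      unfolding word_perm_simps ascending.simps length_Cons
    proof cases
      case 1
      have c: "card (inversions n (transpose i (Suc i) \<circ> ?\<sigma>)) = Suc (card (inversions n ?\<sigma>))"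
        by (rule card_inversions_ascent[OF \<sigma> i 1])
      show "card (inversions n (transpose i (Suc i) \<circ> ?\<sigma>)) \<le> Suc (length ws) \<and>
        (ascending ws \<and> inv ?\<sigma> i < inv ?\<sigma> (Suc i) \<longleftrightarrow>
         card (inversions n (transpose i (Suc i) \<circ> ?\<sigma>)) = Suc (length ws))"
        unfolding c using IH 1 by auto
    next
      case 2
      define t where "t = card (inversions n (transpose i (Suc i) \<circ> ?\<sigma>))"
      have "Suc t = card (inversions n ?\<sigma>)"
        unfolding t_def by (rule card_inversions_descent[OF \<sigma> i 2])
      then show "card (inversions n (transpose i (Suc i) \<circ> ?\<sigma>)) \<le> Suc (length ws) \<and>
        (ascending ws \<and> inv ?\<sigma> i < inv ?\<sigma> (Suc i) \<longleftrightarrow>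
         card (inversions n (transpose i (Suc i) \<circ> ?\<sigma>)) = Suc (length ws))"
        unfolding t_def[symmetric] using IH 2 by auto
    qed
  qed
  then show "card (inversions n (word_perm ws)) \<le> length ws"
    "ascending ws \<longleftrightarrow> card (inversions n (word_perm ws)) = length ws" by auto
qed

lemma increasing_permutation_id:
  assumes \<sigma>: "\<sigma> permutes {..<n}" and mono: "\<And>i. Suc i < n \<Longrightarrow> \<sigma> i < \<sigma> (Suc i)"
  shows "\<sigma> = id"
proof
  have ge: "i < n \<Longrightarrow> i \<le> \<sigma> i" for i
  proof (induction i)
    case (Suc i)
    then show ?case using mono[of i] by simp
  qed simp
  have le: "j < n \<Longrightarrow> \<sigma> (n - Suc j) \<le> n - Suc j" for j
  proof (induction j)
    case 0
    then show ?case using permutes_in_image[OF \<sigma>, of "n - 1"] by simp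
  next
    case (Suc j)
    then show ?case using mono[of "n - Suc (Suc j)"] by (simp add: Suc_diff_Suc)
  qed
  fix i
  show "\<sigma> i = id i"
  proof (cases "i < n")
    case True
    then show ?thesis using ge[of i] le[of "n - Suc i"] by simp
  qed (use permutes_not_in[OF \<sigma>] in auto)
qed

text \<open>
  Bubble sort.
\<close>

lemma ascending_word_exists:
  assumes "\<sigma> permutes {..<n}"
  shows "\<exists>ws. set ws \<subseteq> {i. Suc i < n} \<and> word_perm ws = \<sigma> \<and> length ws = card (inversions n \<sigma>)"
  using assms
proof (induction "card (inversions n \<sigma>)" arbitrary: \<sigma> rule: less_induct)
  case less
  note \<sigma> = less.prems
  show ?case
  proof (cases "\<exists>i. Suc i < n \<and> inv \<sigma> (Suc i) < inv \<sigma> i")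
    case True
    then obtain i where i: "Suc i < n" "inv \<sigma> (Suc i) < inv \<sigma> i" by blast
    let ?\<tau> = "transpose i (Suc i) \<circ> \<sigma>"
    have "?\<tau> permutes {..<n}" using \<sigma> i by (intro permutes_compose permutes_swap_id) auto
    moreover have card: "Suc (card (inversions n ?\<tau>)) = card (inversions n \<sigma>)"
      by (rule card_inversions_descent[OF \<sigma> i])
    ultimately obtain ws where "set ws \<subseteq> {i. Suc i < n}" "word_perm ws = ?\<tau>"
      "length ws = card (inversions n ?\<tau>)" using less.hyps[of ?\<tau>] by auto
    then show ?thesis using i card
      by (intro exI[of _ "i # ws"]) (simp add: comp_assoc[symmetric])
  next
    case False
    have "inv \<sigma> i \<noteq> inv \<sigma> (Suc i)" for i using permutes_inverses(1)[OF \<sigma>] by (metis n_not_Suc_n)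
    then have "inv \<sigma> = id"
      using False by (intro increasing_permutation_id[OF permutes_inv[OF \<sigma>]]) (metis linorder_neqE_nat)
    then have "\<sigma> = id" using permutes_inv_inv[OF \<sigma>] by simp
    then show ?thesis by (intro exI[of _ "[]"]) simp
  qed
qed

text \<open>
  The least possible length is the number of inversions, and the ascending words are those that attain
  it.
\<close>

lemma reduced_word_iff:
  assumes "\<sigma> permutes {..<n}"
  shows "reduced_word n \<sigma> ws \<longleftrightarrow> set ws \<subseteq> {i. Suc i < n} \<and> word_perm ws = \<sigma> \<and> ascending ws"
proof -
  obtain us where us: "set us \<subseteq> {i. Suc i < n}" "word_perm us = \<sigma>" "length us = card (inversions n \<sigma>)"
    using ascending_word_exists[OF assms] by blast
  have le: "card (inversions n \<sigma>) \<le> length vs" if "set vs \<subseteq> {i. Suc i < n}" "word_perm vs = \<sigma>" for vs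
    using card_inversions_le_length(1)[OF that(1)] that(2) by simp
  have asc: "ascending vs \<longleftrightarrow> card (inversions n \<sigma>) = length vs"
    if "set vs \<subseteq> {i. Suc i < n}" "word_perm vs = \<sigma>" for vs
    using card_inversions_le_length(2)[OF that(1)] that(2) by simp
  show ?thesis
  proof
    assume red: "reduced_word n \<sigma> ws"
    then have ws: "set ws \<subseteq> {i. Suc i < n}" "word_perm ws = \<sigma>" by (simp_all add: reduced_word_def)
    moreover have "length ws \<le> length us" using red us(1,2) unfolding reduced_word_def by blast
    ultimately show "set ws \<subseteq> {i. Suc i < n} \<and> word_perm ws = \<sigma> \<and> ascending ws"
      using asc[OF ws] le[OF ws] us(3) by simp
  next
    assume ws: "set ws \<subseteq> {i. Suc i < n} \<and> word_perm ws = \<sigma> \<and> ascending ws"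
    then have "length ws = card (inversions n \<sigma>)" using asc[of ws] by simp
    then show "reduced_word n \<sigma> ws" using ws le unfolding reduced_word_def by metis
  qed
qed

lemma reduced_word_exists: "\<sigma> permutes {..<n} \<Longrightarrow> \<exists>ws. reduced_word n \<sigma> ws"
  using ascending_word_exists[of \<sigma> n] card_inversions_le_length(2)[of _ n]
  by (metis reduced_word_iff)

text \<open>
  The letters \<open>m - 1, \<dots>, a\<close>, of which \<open>a\<close> acts first: the factor \<open>a\<close> moves to the place \<open>m\<close> and those
  between move down by one.  These are the minimal representatives of the cosets of \<open>\<S>\<^sub>m\<close> in \<open>\<S>\<^sub>m\<^sub>+\<^sub>1\<close>.
\<close>

definition last_cycle :: "nat \<Rightarrow> nat \<Rightarrow> nat list" where
  "last_cycle m a = rev [a..<m]"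

lemma last_cycle_simps: "last_cycle a a = []" "a \<le> m \<Longrightarrow> last_cycle (Suc m) a = m # last_cycle m a"
  by (simp_all add: last_cycle_def)

lemma inv_word_perm_last_cycle:
  assumes "a \<le> m"
  shows "inv (word_perm (last_cycle m a)) k = (if k = m then a else if a \<le> k \<and> k < m then Suc k else k)"
  using assms
proof (induction m arbitrary: k rule: dec_induct)
  case base
  then show ?case by (auto simp: last_cycle_simps)
next
  case (step m)
  have "inv (word_perm (last_cycle (Suc m) a)) k = inv (word_perm (last_cycle m a)) (transpose m (Suc m) k)"
    by (simp only: last_cycle_simps(2)[OF step(1)] word_perm_simps inv_transpose_comp[OF bij_word_perm] comp_apply)
  then show ?case using step(1) by (auto simp: step.IH transpose_def)
qed

lemma ascending_append_last_cycle:
  assumes "a \<le> m" "ascending ws" "set ws \<subseteq> {i. Suc i < m}"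
  shows "ascending (ws @ last_cycle m a)"
  using assms(2,3)
proof (induction ws)
  case Nil
  have "ascending (last_cycle m a)"
    using assms(1) by (induction m rule: dec_induct) (auto simp: last_cycle_simps inv_word_perm_last_cycle)
  then show ?case by simp
next
  case (Cons i ws)
  have \<sigma>: "word_perm ws permutes {..<m}" using Cons.prems word_perm_permutes by auto
  have lt: "inv (word_perm ws) k < m" if "k < m" for k
    using permutes_in_image[OF permutes_inv[OF \<sigma>], of k] that by simp
  have "inv (word_perm (ws @ last_cycle m a)) k =
      inv (word_perm (last_cycle m a)) (inv (word_perm ws) k)" for k
    by (simp add: word_perm_append o_inv_distrib)
  then show ?case
    using Cons lt[of i] lt[of "Suc i"] by (auto simp: inv_word_perm_last_cycle[OF assms(1)])
qed

text \<open>
  The coset of a permutation is determined by the factor \<open>a\<close> that it moves to the last place.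
\<close>

lemma bij_betw_last_cycle:
  "bij_betw (\<lambda>(a, \<pi>). \<pi> \<circ> word_perm (last_cycle m a)) ({..m} \<times> {\<pi>. \<pi> permutes {..<m}})
     {\<sigma>. \<sigma> permutes {..<Suc m}}"
proof -
  have \<rho>: "word_perm (last_cycle m a) permutes {..<Suc m}" if "a \<le> m" for a
    by (rule word_perm_permutes) (auto simp: last_cycle_def)
  have \<rho>_a: "word_perm (last_cycle m a) a = m" if "a \<le> m" for a
    using inv_word_perm_last_cycle[OF that, of m] permutes_inverses(1)[OF \<rho>[OF that]] by metis
  show ?thesis
  proof (rule bij_betw_imageI)
    show "inj_on (\<lambda>(a, \<pi>). \<pi> \<circ> word_perm (last_cycle m a)) ({..m} \<times> {\<pi>. \<pi> permutes {..<m}})"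
    proof (rule inj_onI, clarsimp)
      fix a \<pi> b \<pi>' assume *: "a \<le> m" "b \<le> m" "\<pi> permutes {..<m}" "\<pi>' permutes {..<m}"
        and eq: "\<pi> \<circ> word_perm (last_cycle m a) = \<pi>' \<circ> word_perm (last_cycle m b)"
      have "\<pi> m = m" "\<pi>' m = m" using * by (auto simp: permutes_not_in)
      then have ab: "(\<pi>' \<circ> word_perm (last_cycle m b)) a = (\<pi>' \<circ> word_perm (last_cycle m b)) b"
        using \<rho>_a * by (metis comp_apply eq)
      have "inj (\<pi>' \<circ> word_perm (last_cycle m b))"
        using permutes_inj[OF *(4)] permutes_inj[OF \<rho>[OF *(2)]] by (intro inj_compose)
      then have "a = b" using ab by (rule injD)
      moreover have "\<pi> = \<pi>'"
        using eq bij_is_surj[OF bij_word_perm] unfolding \<open>a = b\<close> by (metis surj_fun_eq subset_UNIV UNIV_I comp_apply ext surjD)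
      ultimately show "a = b \<and> \<pi> = \<pi>'" by simp
    qed
    show "(\<lambda>(a, \<pi>). \<pi> \<circ> word_perm (last_cycle m a)) ` ({..m} \<times> {\<pi>. \<pi> permutes {..<m}}) =
        {\<sigma>. \<sigma> permutes {..<Suc m}}" (is "?f ` ?X = ?Y")
    proof
      show "?f ` ?X \<subseteq> ?Y"
        using \<rho> by (auto intro!: permutes_compose intro: permutes_subset)
      show "?Y \<subseteq> ?f ` ?X"
      proof
        fix \<sigma> assume "\<sigma> \<in> ?Y"
        then have \<sigma>: "\<sigma> permutes {..<Suc m}" by simp
        define a where "a = inv \<sigma> m"
        have a: "a \<le> m" using permutes_in_image[OF permutes_inv[OF \<sigma>], of m] by (simp add: a_def)
        let ?\<rho> = "word_perm (last_cycle m a)"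
        define \<pi> where "\<pi> = \<sigma> \<circ> inv ?\<rho>"
        have \<pi>: "\<pi> permutes {..<Suc m}"
          unfolding \<pi>_def by (intro permutes_compose \<sigma> permutes_inv \<rho> a)
        have \<pi>m: "\<pi> m = m"
          using inv_word_perm_last_cycle[OF a, of m] permutes_inverses(1)[OF \<sigma>] by (simp add: \<pi>_def a_def)
        have "x = m" if "x \<in> {..<Suc m} - {..<m}" for x using that by auto
        then have "\<pi> permutes {..<m}"
          using \<pi>m by (intro permutes_superset[OF \<pi>]) blast
        moreover have "\<sigma> = \<pi> \<circ> ?\<rho>"
          unfolding \<pi>_def comp_assoc permutes_inv_o(2)[OF \<rho>[OF a]] comp_id ..
        ultimately show "\<sigma> \<in> ?f ` ?X" using a by (intro image_eqI[of _ _ "(a, \<pi>)"]) simp_all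
      qed
    qed
  qed
qed

section \<open>Braid words on tensor powers\<close>

text \<open>
  Linearity on a subspace: a braiding is a function on all tensors, of which only the values on \<open>V \<otimes> V\<close>
  are known to be linear.
\<close>

definition linear_on :: "('k::field, 'v) tensor set \<Rightarrow> (('k, 'v) tensor \<Rightarrow> ('k, 'v) tensor) \<Rightarrow> bool" where
  "linear_on S f \<longleftrightarrow> (\<forall>s\<in>S. \<forall>t\<in>S. f (s + t) = f s + f t) \<and> (\<forall>a. \<forall>t\<in>S. f (tscale a t) = tscale a (f t))"

lemma linear_on_add: "linear_on S f \<Longrightarrow> s \<in> S \<Longrightarrow> t \<in> S \<Longrightarrow> f (s + t) = f s + f t"
  and linear_on_scale: "linear_on S f \<Longrightarrow> t \<in> S \<Longrightarrow> f (tscale a t) = tscale a (f t)"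
  by (auto simp: linear_on_def)

lemma linear_on_0:
  assumes "linear_on S f" "tensor.subspace S"
  shows "f 0 = 0"
proof -
  have "f (tscale 0 0) = tscale 0 (f 0)" using assms by (intro linear_on_scale tensor.subspace_0)
  then show ?thesis by (simp only: tensor.scale_zero_left)
qed

lemma linear_on_compose:
  "linear_on S f \<Longrightarrow> f ` S \<subseteq> T \<Longrightarrow> linear_on T h \<Longrightarrow> linear_on S (\<lambda>t. h (f t))"
  by (auto simp: linear_on_def image_subset_iff)

lemma tlinear_imp_linear_on: "tlinear f \<Longrightarrow> linear_on S f"
  by (auto simp: linear_on_def tlinear_rules)

lemma linear_on_span_induct:
  assumes "t \<in> tensor.span X" "linear_on (tensor.span X) f" "P 0"
    and "\<And>a x y. x \<in> X \<Longrightarrow> P y \<Longrightarrow> P (tscale a (f x) + y)"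
  shows "P (f t)"
proof -
  have "t \<in> tensor.span X \<and> P (f t)"
    using assms(1)
  proof (induction rule: tensor.span_induct_alt)
    case base
    then show ?case by (metis assms(2,3) linear_on_0 tensor.subspace_span tensor.span_zero)
  next
    case (step a x y)
    have x: "x \<in> tensor.span X" by (rule tensor.span_base[OF step(1)])
    have y: "y \<in> tensor.span X" "P (f y)" using step by blast+
    have "f (tscale a x + y) = tscale a (f x) + f y"
      unfolding linear_on_add[OF assms(2) tensor.span_scale[OF x] y(1)] linear_on_scale[OF assms(2) x] ..
    moreover have "P (tscale a (f x) + f y)" by (rule assms(4)[OF step(1) y(2)])
    moreover have "tscale a x + y \<in> tensor.span X" by (intro tensor.span_add tensor.span_scale x y)
    ultimately show ?case by (simp only:)
  qed
  then show ?thesis ..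
qed

lemma linear_on_span_image:
  assumes "linear_on (tensor.span X) f" "\<And>x. x \<in> X \<Longrightarrow> f x \<in> S" "tensor.subspace S"
    and "t \<in> tensor.span X"
  shows "f t \<in> S"
  using assms(4,1) tensor.subspace_0[OF assms(3)]
  by (rule linear_on_span_induct) (use assms(2,3) in \<open>blast intro: tensor.subspace_add tensor.subspace_scale\<close>)

lemma linear_on_diff_zero:
  assumes "linear_on S f" "linear_on S h"
  shows "linear_on S (\<lambda>t. f t - h t)"
  using assms by (simp add: linear_on_def tensor.scale_right_diff_distrib)

lemma linear_on_eq:
  assumes "linear_on (tensor.span X) f" "linear_on (tensor.span X) h" "\<And>x. x \<in> X \<Longrightarrow> f x = h x"
    and "t \<in> tensor.span X"
  shows "f t = h t"
proof -
  have "f t - h t \<in> {0}"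
    by (rule linear_on_span_image[OF linear_on_diff_zero[OF assms(1,2)] _ _ assms(4)]) (use assms(3) in auto)
  then show ?thesis by (metis singletonD eq_iff_diff_eq_0)
qed

lemma linear_on_sum:
  assumes "\<And>i. i \<in> A \<Longrightarrow> linear_on S (f i)"
  shows "linear_on S (\<lambda>t. \<Sum>i\<in>A. f i t)"
  unfolding linear_on_def
proof (intro conjI allI ballI)
  fix s t assume "s \<in> S" "t \<in> S"
  then show "(\<Sum>i\<in>A. f i (s + t)) = (\<Sum>i\<in>A. f i s) + (\<Sum>i\<in>A. f i t)"
    using assms by (subst sum.distrib[symmetric], intro sum.cong) (auto simp: linear_on_def)
next
  fix a t assume "t \<in> S"
  then show "(\<Sum>i\<in>A. f i (tscale a t)) = tscale a (\<Sum>i\<in>A. f i t)"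
    using assms by (subst tensor.scale_sum_right, intro sum.cong) (auto simp: linear_on_def)
qed

lemma tensor_mult_linear:
  "tensor_mult (s + s') t = tensor_mult s t + tensor_mult s' t"
  "tensor_mult (tscale a s) t = tscale a (tensor_mult s t)"
  "tensor_mult s (t + t') = tensor_mult s t + tensor_mult s t'"
  "tensor_mult s (tscale a t) = tscale a (tensor_mult s t)"
  by (auto simp: tensor_mult_def tscale_def fun_eq_iff sum.distrib algebra_simps sum_distrib_left)

lemma tlinear_tensor_mult: "tlinear (\<lambda>t. tensor_mult t s)" "tlinear (tensor_mult s)"
  by (rule tlinearI; simp only: tensor_mult_linear)+

lemma tensor_mult_span:
  assumes "s \<in> tensor.span S" "t \<in> tensor.span T" "\<And>a b. a \<in> S \<Longrightarrow> b \<in> T \<Longrightarrow> tensor_mult a b \<in> U"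
    and "tensor.subspace U"
  shows "tensor_mult s t \<in> U"
proof -
  have "tensor_mult a t \<in> U" if "a \<in> S" for a
    by (rule linear_on_span_image[OF tlinear_imp_linear_on[OF tlinear_tensor_mult(2)] _ assms(4,2)])
      (use assms(3) that in blast)
  then show ?thesis
    by (intro linear_on_span_image[OF tlinear_imp_linear_on[OF tlinear_tensor_mult(1)] _ assms(4,1)])
qed

lemma list_split_two:
  assumes "Suc i < length vs"
  obtains us v w ws where "vs = us @ [v, w] @ ws" "length us = i"
proof
  show "vs = take i vs @ [vs ! i, vs ! Suc i] @ drop (i + 2) vs"
    using append_take_drop_id[of i vs] Cons_nth_drop_Suc[of i vs] Cons_nth_drop_Suc[of "Suc i" vs] assms
    by simp
  show "length (take i vs) = i" using assms by simp
qed

locale braided_vector_space =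
  fixes scale :: "'k::field \<Rightarrow> 'v::ab_group_add \<Rightarrow> 'v"
    and c :: "('k, 'v) tensor \<Rightarrow> ('k, 'v) tensor"
  assumes vector_space_scale: "vector_space scale"
    and braided: "braided_pair scale c"
begin

abbreviation T :: "nat \<Rightarrow> ('k, 'v) tensor set" where
  "T m \<equiv> tensor_power scale m"

lemma subspace_T [simp]: "tensor.subspace (T m)"
  by (simp add: tensor_power_def)

lemma pure_T: "length vs = m \<Longrightarrow> pure scale vs \<in> T m"
  by (auto simp: tensor_power_def intro: tensor.span_base)

lemma tensor_mult_T: "s \<in> T k \<Longrightarrow> t \<in> T m \<Longrightarrow> tensor_mult s t \<in> T (k + m)"
  unfolding tensor_power_def[of _ k] tensor_power_def[of _ m]
  by (rule tensor_mult_span) (auto simp: tensor_mult_pure pure_T)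

lemma c_linear: "linear_on (T 2) c"
  using braided by (auto simp: braided_pair_def linear_on_def)

lemma c_T: "t \<in> T 2 \<Longrightarrow> c t \<in> T 2"
  using braided by (auto simp: braided_pair_def bij_betw_def)

lemma T_ext:
  assumes "s \<in> T m" "t \<in> T m" "\<And>fs. length fs = m \<Longrightarrow> s fs = t fs"
  shows "s = t"
proof
  fix fs
  show "s fs = t fs"
    using assms(3) tensor_power_eval[OF assms(1)] tensor_power_eval[OF assms(2)] by (cases "length fs = m") auto
qed

text \<open>
  The element of \<open>V \<otimes> V\<close> to which \<open>braid_at\<close> applies \<open>c\<close>.
\<close>

definition slice :: "nat \<Rightarrow> ('v \<Rightarrow> 'k) list \<Rightarrow> ('k, 'v) tensor \<Rightarrow> ('k, 'v) tensor" where
  "slice i fs t = (\<lambda>gs. if length gs = 2 then t (take i fs @ gs @ drop (i + 2) fs) else 0)"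

lemma braid_at_slice: "braid_at c i t fs = (if Suc i < length fs then c (slice i fs t) [fs ! i, fs ! Suc i] else t fs)"
  by (simp add: braid_at_def slice_def)

lemma linear_slice: "tlinear (slice i fs)"
  by (rule tlinearI) (auto simp: slice_def tscale_def fun_eq_iff)

lemma slice_T:
  assumes t: "t \<in> T m" and i: "Suc i < length fs"
  shows "slice i fs t \<in> T 2"
proof (rule linear_on_span_image[OF tlinear_imp_linear_on[OF linear_slice] _ subspace_T
      t[unfolded tensor_power_def]])
  fix s assume "s \<in> pure scale ` {vs. length vs = m}"
  then obtain vs where vs: "s = pure scale vs" "length vs = m" by auto
  show "slice i fs s \<in> T 2"
  proof (cases "length fs = m")
    case True
    obtain us v w ws where vs': "vs = us @ [v, w] @ ws" and len: "length us = i"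
      using list_split_two i vs True by metis
    define a where "a = pure scale us (take i fs) * pure scale ws (drop (i + 2) fs)"
    have "pure scale vs (take i fs @ gs @ drop (i + 2) fs) = a * pure scale [v, w] gs"
      if "length gs = 2" for gs
      using that i len by (subst vs', subst pure_append, simp, subst pure_append) (auto simp: a_def)
    then have "slice i fs s = tscale a (pure scale [v, w])"
      by (auto simp: slice_def vs tscale_def fun_eq_iff pure_eq_0)
    then show ?thesis by (simp add: pure_T tensor.subspace_scale)
  next
    case False
    then have "slice i fs s = 0"
      using i by (auto simp: slice_def vs fun_eq_iff pure_eq_0)
    then show ?thesis by (simp only: tensor.subspace_0 subspace_T)
  qed
qed

lemma linear_braid_at: "linear_on (T m) (braid_at c i)"
proof -
  have "c (slice i fs (s + t)) = c (slice i fs s) + c (slice i fs t)"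
    if "s \<in> T m" "t \<in> T m" "Suc i < length fs" for s t fs
    using that by (simp add: tlinear_rules[OF linear_slice] linear_on_add[OF c_linear] slice_T)
  moreover have "c (slice i fs (tscale a t)) = tscale a (c (slice i fs t))"
    if "t \<in> T m" "Suc i < length fs" for a t fs
    using that by (simp add: tlinear_rules[OF linear_slice] linear_on_scale[OF c_linear] slice_T)
  ultimately show ?thesis
    unfolding linear_on_def by (auto simp: fun_eq_iff braid_at_slice tscale_def)
qed

lemma braid_at_T:
  assumes "t \<in> T m" "Suc i < m"
  shows "braid_at c i t \<in> T m"
proof (rule linear_on_span_image[OF linear_braid_at[of m, unfolded tensor_power_def] _ subspace_T
      assms(1)[unfolded tensor_power_def]])
  fix s assume "s \<in> pure scale ` {vs. length vs = m}"
  then obtain vs where vs: "s = pure scale vs" "length vs = m" by auto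
  then obtain us v w ws where vs': "vs = us @ [v, w] @ ws" "length us = i"
    using list_split_two assms(2) by metis
  have "tensor_mult (pure scale us) (tensor_mult (c (pure scale [v, w])) (pure scale ws)) \<in> T (length us + (2 + length ws))"
    by (intro tensor_mult_T c_T pure_T) auto
  moreover have "length us + (2 + length ws) = m" using vs vs' by simp
  ultimately show "braid_at c i s \<in> T m"
    using braid_at_pure[OF braided, of us v w ws] unfolding vs(1) vs'(1)
    by (simp add: vs'(2))
qed

lemma braid_word_simps: "braid_word c [] t = t" "braid_word c (i # ws) t = braid_at c i (braid_word c ws t)"
  by (simp_all add: braid_word_def)

lemma braid_word_append: "braid_word c (us @ ws) t = braid_word c us (braid_word c ws t)"
  by (simp add: braid_word_def)

lemma braid_word_T: "set ws \<subseteq> {i. Suc i < m} \<Longrightarrow> t \<in> T m \<Longrightarrow> braid_word c ws t \<in> T m"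
  by (induction ws) (auto simp: braid_word_simps braid_at_T)

lemma linear_braid_word: "set ws \<subseteq> {i. Suc i < m} \<Longrightarrow> linear_on (T m) (braid_word c ws)"
proof (induction ws)
  case Nil
  then show ?case by (auto simp: linear_on_def braid_word_simps)
next
  case (Cons i ws)
  have "braid_word c ws ` T m \<subseteq> T m" using Cons.prems braid_word_T[of ws m] by auto
  then have "linear_on (T m) (\<lambda>t. braid_at c i (braid_word c ws t))"
    using Cons by (intro linear_on_compose[OF _ _ linear_braid_at[of m]]) auto
  then show ?case by (simp add: braid_word_simps[abs_def])
qed

lemma contract_pure:
  "contract f (pure scale (vs @ [v])) = tscale (if Vector_Spaces.linear scale (*) f then f v else 0) (pure scale vs)"
proof
  fix fs
  show "contract f (pure scale (vs @ [v])) fs =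
      tscale (if Vector_Spaces.linear scale (*) f then f v else 0) (pure scale vs) fs"
  proof (cases "length fs = length vs")
    case True
    then show ?thesis by (simp add: contract_def pure_append pure_simps tscale_def)
  qed (simp add: contract_def tscale_def pure_eq_0)
qed

lemma contract_T:
  assumes "t \<in> T (Suc m)"
  shows "contract f t \<in> T m"
proof (rule linear_on_span_image[OF tlinear_imp_linear_on[OF tlinear_contract] _ subspace_T
      assms[unfolded tensor_power_def]])
  fix s assume "s \<in> pure scale ` {vs. length vs = Suc m}"
  then obtain vs where vs: "s = pure scale vs" "length vs = Suc m" by auto
  then obtain us v where "vs = us @ [v]" "length us = m" by (metis length_Suc_conv_rev)
  then show "contract f s \<in> T m"
    unfolding vs(1) by (simp only: contract_pure) (intro tensor.subspace_scale subspace_T pure_T)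
qed

lemma contract_braid_at:
  assumes "t \<in> T (Suc m)" "Suc i < m"
  shows "contract f (braid_at c i t) = braid_at c i (contract f t)"
proof (rule T_ext)
  show "contract f (braid_at c i t) \<in> T m" "braid_at c i (contract f t) \<in> T m"
    using assms by (auto intro!: contract_T braid_at_T)
  fix fs :: "('v \<Rightarrow> 'k) list" assume "length fs = m"
  then have "slice i (fs @ [f]) t = slice i fs (contract f t)"
    using assms by (auto simp: slice_def contract_def fun_eq_iff)
  then show "contract f (braid_at c i t) fs = braid_at c i (contract f t) fs"
    using assms \<open>length fs = m\<close> by (simp add: contract_def[of _ "braid_at c i t"] braid_at_slice nth_append)
qed

text \<open>
  Letters below \<open>m - 1\<close> do not touch the last of \<open>m + 1\<close> factors.
\<close>

lemma contract_braid_word: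
  assumes "set ws \<subseteq> {i. Suc i < m}" "t \<in> T (Suc m)"
  shows "contract f (braid_word c ws t) = braid_word c ws (contract f t)"
  using assms(1)
proof (induction ws)
  case (Cons i ws)
  then have "braid_word c ws t \<in> T (Suc m)" by (intro braid_word_T assms) auto
  then show ?case using Cons by (simp add: braid_word_simps contract_braid_at)
qed (simp add: braid_word_simps)

text \<open>
  In the grading of \<open>V\<close> by the group generated by the \<open>g\<^sub>i\<close>, this says that \<open>v\<close> is homogeneous of degree \<open>\<gamma>\<close>.
\<close>

definition braids_by :: "('v \<Rightarrow> 'v) \<Rightarrow> 'v \<Rightarrow> bool" where
  "braids_by \<gamma> v \<longleftrightarrow> (\<forall>u. c (pure scale [v, u]) = pure scale [\<gamma> u, v])"

lemma braid_at_braids_by: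
  "braids_by \<gamma> v \<Longrightarrow> length us = i \<Longrightarrow>
    braid_at c i (pure scale (us @ [v, u] @ ws)) = pure scale (us @ [\<gamma> u, v] @ ws)"
  using braid_at_pure[OF braided, of us v u ws] by (simp add: braids_by_def tensor_mult_pure)

lemma braid_word_last_cycle:
  assumes "braids_by \<gamma> v" "length us = a"
  shows "braid_word c (last_cycle (a + length ws) a) (pure scale (us @ [v] @ ws @ vs)) =
    pure scale (us @ map \<gamma> ws @ [v] @ vs)"
proof (induction ws arbitrary: vs rule: rev_induct)
  case Nil
  then show ?case by (simp add: last_cycle_simps braid_word_simps)
next
  case (snoc u ws)
  have "braid_word c (last_cycle (a + length ws) a) (pure scale (us @ [v] @ ws @ [u] @ vs)) =
      pure scale ((us @ map \<gamma> ws) @ [v, u] @ vs)" using snoc[of "[u] @ vs"] by simp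
  then show ?case
    using braid_at_braids_by[OF assms(1), of "us @ map \<gamma> ws" "a + length ws" u vs] assms(2)
    by (simp add: last_cycle_simps braid_word_simps)
qed

end

section \<open>Braidings of group type\<close>

locale group_type_braiding = braided_vector_space scale c
  for scale :: "'k::field \<Rightarrow> 'v::ab_group_add \<Rightarrow> 'v" and c +
  fixes n :: nat and x :: "nat \<Rightarrow> 'v" and g :: "nat \<Rightarrow> 'v \<Rightarrow> 'v"
  assumes basis: "basis_family scale n x"
    and linear_g: "i \<in> {1..n} \<Longrightarrow> Vector_Spaces.linear scale scale (g i)"
    and bij_g: "i \<in> {1..n} \<Longrightarrow> bij (g i)"
    and braids_x: "i \<in> {1..n} \<Longrightarrow> braids_by (g i) (x i)"
begin

sublocale V: vector_space scale by (rule vector_space_scale)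

sublocale dual: vector_space_pair scale "(*) :: 'k \<Rightarrow> 'k \<Rightarrow> 'k"
  by unfold_locales (auto simp: algebra_simps)

text \<open>
  The dual basis.
\<close>

definition \<xi> :: "nat \<Rightarrow> 'v \<Rightarrow> 'k" where
  "\<xi> i = dual.construct (x ` {1..n}) (\<lambda>v. if v = x i then 1 else 0)"

lemma indep: "V.independent (x ` {1..n})" and inj_x: "inj_on x {1..n}"
  and span_x: "V.span (x ` {1..n}) = UNIV"
  using basis by (auto simp: basis_family_def)

lemma linear_\<xi>: "Vector_Spaces.linear scale (*) (\<xi> i)"
  unfolding \<xi>_def by (rule dual.linear_construct[OF indep])

lemma \<xi>_x: "i \<in> {1..n} \<Longrightarrow> j \<in> {1..n} \<Longrightarrow> \<xi> i (x j) = (if j = i then 1 else 0)"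
  unfolding \<xi>_def using inj_x by (subst dual.construct_basis[OF indep]) (auto dest: inj_onD)

lemma x_nonzero: "i \<in> {1..n} \<Longrightarrow> x i \<noteq> 0"
  using indep V.dependent_zero by force

lemma expand_x: "v = (\<Sum>i=1..n. scale (\<xi> i v) (x i))"
proof -
  have "v \<in> V.span (x ` {1..n})" unfolding span_x by (rule UNIV_I)
  then show ?thesis
  proof (induction rule: V.span_induct_alt)
    case base
    then show ?case by (simp add: dual.linear_0[OF linear_\<xi>])
  next
    case (step a v w)
    then obtain j where j: "j \<in> {1..n}" "v = x j" by blast
    have "(\<Sum>i=1..n. scale (\<xi> i (scale a v + w)) (x i)) =
      scale a (\<Sum>i=1..n. scale (\<xi> i v) (x i)) + (\<Sum>i=1..n. scale (\<xi> i w) (x i))"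
      by (simp add: dual.linear_add[OF linear_\<xi>] dual.linear_scale[OF linear_\<xi>]
          V.scale_left_distrib sum.distrib V.scale_sum_right)
    also have "(\<Sum>i=1..n. scale (\<xi> i v) (x i)) = (\<Sum>i=1..n. if i = j then x j else 0)"
      using j by (intro sum.cong) (auto simp: \<xi>_x)
    finally show ?case using j step.IH by simp
  qed
qed

lemma pure_snoc_linear: "pure scale (vs @ [scale a u + v]) = tscale a (pure scale (vs @ [u])) + pure scale (vs @ [v])"
  using pure_linear_entry[OF vector_space_scale, of vs a u v "[]"] by simp

lemma pure_snoc_0: "pure scale (vs @ [0]) = 0"
proof -
  have "pure scale (vs @ [0]) = tscale 1 (pure scale (vs @ [0])) + pure scale (vs @ [0])"
    using pure_snoc_linear[of vs 1 0 0] by simp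
  then show ?thesis by (simp only: tensor.scale_one add_cancel_right_right)
qed

lemma pure_snoc_expand: "pure scale (vs @ [v]) = (\<Sum>i=1..n. tscale (\<xi> i v) (pure scale (vs @ [x i])))"
proof -
  have "pure scale (vs @ [\<Sum>i\<in>A. scale (a i) (x i)]) = (\<Sum>i\<in>A. tscale (a i) (pure scale (vs @ [x i])))"
    if "finite A" for a :: "nat \<Rightarrow> 'k" and A
    using that
  proof (induction A)
    case (insert i A)
    then show ?case using pure_snoc_linear by simp
  qed (simp add: pure_snoc_0)
  from this[of "{1..n}" "\<lambda>i. \<xi> i v"] show ?thesis using expand_x[of v] by simp
qed

definition word :: "nat list \<Rightarrow> ('k, 'v) tensor" where
  "word js = pure scale (map x js)"

definition Words :: "nat \<Rightarrow> nat list set" where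
  "Words m = {js. length js = m \<and> set js \<subseteq> {1..n}}"

lemma T_word: "T m = tensor.span (word ` Words m)"
proof
  show "tensor.span (word ` Words m) \<subseteq> T m"
    by (intro tensor.span_minimal subspace_T) (auto simp: word_def Words_def pure_T)
  have "pure scale vs \<in> tensor.span (word ` Words (length vs))" for vs
  proof (induction vs rule: rev_induct)
    case Nil
    then show ?case by (intro tensor.span_base) (auto simp: word_def Words_def image_def)
  next
    case (snoc v vs)
    have "pure scale (vs @ [x i]) \<in> tensor.span (word ` Words (length (vs @ [v])))" if i: "i \<in> {1..n}" for i
    proof -
      have "tensor_mult a b \<in> tensor.span (word ` Words (length (vs @ [v])))"
        if ab: "a \<in> word ` Words (length vs)" "b \<in> {word [i]}" for a b
      proof -
        obtain js where js: "js \<in> Words (length vs)" "a = word js" using ab by blast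
        have "js @ [i] \<in> Words (length (vs @ [v]))" using js i by (simp add: Words_def)
        moreover have "tensor_mult a b = word (js @ [i])" using js ab by (simp add: word_def tensor_mult_pure)
        ultimately show ?thesis by (metis tensor.span_base imageI)
      qed
      then have "tensor_mult (pure scale vs) (word [i]) \<in> tensor.span (word ` Words (length (vs @ [v])))"
        by (intro tensor_mult_span[OF snoc, of _ "{word [i]}"]) (auto intro: tensor.span_base)
      then show ?thesis by (simp add: word_def tensor_mult_pure)
    qed
    then show ?case
      by (subst pure_snoc_expand) (intro tensor.span_sum tensor.span_scale)
  qed
  then show "T m \<subseteq> tensor.span (word ` Words m)"
    unfolding tensor_power_def by (intro tensor.span_minimal) auto
qed

lemma T_eqI:
  assumes "linear_on (T m) f" "linear_on (T m) h" "\<And>js. js \<in> Words m \<Longrightarrow> f (word js) = h (word js)" "t \<in> T m"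
  shows "f t = h t"
  by (rule linear_on_eq[OF assms(1,2)[unfolded T_word] _ assms(4)[unfolded T_word]]) (use assms(3) in auto)

text \<open>
  \<open>h\<close> maps vectors of degree \<open>\<gamma>\<close> to vectors of degree \<open>\<delta> = h \<gamma> h\<^sup>-\<^sup>1\<close>; for bijective \<open>h\<close> this means
  that \<open>c\<close> commutes with \<open>h \<otimes> h\<close>.
\<close>

definition equivariant :: "('v \<Rightarrow> 'v) \<Rightarrow> bool" where
  "equivariant h \<longleftrightarrow> (\<forall>\<gamma> w. braids_by \<gamma> w \<longrightarrow> (\<exists>\<delta>. braids_by \<delta> (h w) \<and> (\<forall>u. \<delta> (h u) = h (\<gamma> u))))"

lemma braid_at_0: "braid_at c 0 (pure scale [u, v, w]) = tensor_mult (c (pure scale [u, v])) (pure scale [w])"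
proof -
  have "tensor_mult (pure scale []) t = t" for t
  proof
    fix fs show "tensor_mult (pure scale []) t fs = t fs"
      by (subst tensor_mult_eval[OF pure_eq_0[of _ "[]"]]) (auto simp: pure_Nil)
  qed
  then show ?thesis using braid_at_pure[OF braided, of "[]" u v "[w]"] by simp
qed

text \<open>
  Compare both sides of the braid equation on \<open>x\<^sub>i \<otimes> w \<otimes> u\<close>.  Both end in the factor \<open>x\<^sub>i\<close>, which
  \<open>\<xi>\<^sub>i\<close> removes.
\<close>

lemma braids_by_image:
  assumes i: "i \<in> {1..n}" and w: "braids_by \<gamma> w"
  shows "c (pure scale [g i w, g i u]) = pure scale [g i (\<gamma> u), g i w]"
proof -
  note gi = braids_x[OF i]
  have b0: "braid_at c 0 (pure scale ([] @ [x i, v] @ ws)) = pure scale ([] @ [g i v, x i] @ ws)" for v ws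
    by (rule braid_at_braids_by[OF gi]) simp
  have b1: "braid_at c 1 (pure scale ([u] @ [x i, v] @ ws)) = pure scale ([u] @ [g i v, x i] @ ws)" for u v ws
    by (rule braid_at_braids_by[OF gi]) simp
  have w1: "braid_at c 1 (pure scale ([u'] @ [w, v] @ ws)) = pure scale ([u'] @ [\<gamma> v, w] @ ws)" for u' v ws
    by (rule braid_at_braids_by[OF w]) simp
  let ?t = "pure scale [x i, w, u]"
  have "?t \<in> tensor_power scale 3" by (rule pure_T) simp
  then have "braid_at c 0 (braid_at c 1 (braid_at c 0 ?t)) = braid_at c 1 (braid_at c 0 (braid_at c 1 ?t))"
    using braided unfolding braided_pair_def by blast
  moreover have "braid_at c 0 (braid_at c 1 (braid_at c 0 ?t)) =
      tensor_mult (c (pure scale [g i w, g i u])) (pure scale [x i])"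
    using b0[of w "[u]"] b1[of "g i w" u "[]"] braid_at_0 by simp
  moreover have "braid_at c 1 (braid_at c 0 (braid_at c 1 ?t)) = pure scale [g i (\<gamma> u), g i w, x i]"
    using w1[of "x i" u "[]"] b0[of "\<gamma> u" "[w]"] b1[of "g i (\<gamma> u)" w "[]"] by simp
  ultimately have eq: "tensor_mult (c (pure scale [g i w, g i u])) (pure scale [x i]) =
      pure scale ([g i (\<gamma> u), g i w] @ [x i])" by simp
  show ?thesis
  proof (rule T_ext)
    show cT: "c (pure scale [g i w, g i u]) \<in> T 2" "pure scale [g i (\<gamma> u), g i w] \<in> T 2"
      by (auto intro!: c_T pure_T)
    fix fs :: "('v \<Rightarrow> 'k) list" assume fs: "length fs = 2"
    have "tensor_mult (c (pure scale [g i w, g i u])) (pure scale [x i]) (fs @ [\<xi> i]) =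
        c (pure scale [g i w, g i u]) fs"
      using fs i by (simp add: tensor_mult_eval[OF tensor_power_eval[OF cT(1)]] pure_simps linear_\<xi> \<xi>_x)
    moreover have "pure scale ([g i (\<gamma> u), g i w] @ [x i]) (fs @ [\<xi> i]) = pure scale [g i (\<gamma> u), g i w] fs"
      using fs i by (subst pure_append) (auto simp: pure_simps linear_\<xi> \<xi>_x)
    ultimately show "c (pure scale [g i w, g i u]) fs = pure scale [g i (\<gamma> u), g i w] fs"
      using eq by simp
  qed
qed

lemma equivariant_g:
  assumes i: "i \<in> {1..n}"
  shows "equivariant (g i)"
  unfolding equivariant_def
proof (intro allI impI)
  fix \<gamma> w assume w: "braids_by \<gamma> w"
  have surj: "g i (inv (g i) u) = u" and inj: "inv (g i) (g i u) = u" for u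
    using bij_g[OF i] by (simp_all add: bij_is_surj surj_f_inv_f bij_is_inj)
  show "\<exists>\<delta>. braids_by \<delta> (g i w) \<and> (\<forall>u. \<delta> (g i u) = g i (\<gamma> u))"
  proof (intro exI[of _ "\<lambda>u. g i (\<gamma> (inv (g i) u))"] conjI allI)
    show "braids_by (\<lambda>u. g i (\<gamma> (inv (g i) u))) (g i w)"
      using braids_by_image[OF i w, of "inv (g i) u" for u] by (simp add: braids_by_def surj)
  qed (simp add: inj)
qed

lemma equivariant_id: "equivariant (\<lambda>u. u)"
  by (auto simp: equivariant_def)

lemma equivariant_comp: "equivariant h \<Longrightarrow> equivariant k \<Longrightarrow> equivariant (\<lambda>u. h (k u))"
  unfolding equivariant_def by metis

text \<open>
  The factors are named by their initial places.  Those in \<open>A\<close> that \<open>\<sigma>\<close> puts behind \<open>a\<close> have passed over the factor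
  \<open>a\<close>, which is acted on by the degrees that they had at the start, in the order of \<open>A\<close>.  The degrees change on the way by
  conjugation, but the changes cancel (\<open>braid_word_ascending\<close>).
\<close>

definition act :: "(nat \<Rightarrow> nat) \<Rightarrow> nat list \<Rightarrow> nat \<Rightarrow> nat list \<Rightarrow> 'v \<Rightarrow> 'v" where
  "act \<sigma> js a A u = foldr (\<lambda>b u. if \<sigma> b > \<sigma> a then g (js ! b) u else u) A u"

lemma act_simps:
  "act \<sigma> js a [] u = u"
  "act \<sigma> js a (b # A) u = (if \<sigma> b > \<sigma> a then g (js ! b) (act \<sigma> js a A u) else act \<sigma> js a A u)"
  by (simp_all add: act_def)

lemma act_append: "act \<sigma> js a (A @ A') u = act \<sigma> js a A (act \<sigma> js a A' u)"
  by (simp add: act_def)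

lemma act_cong:
  "(\<And>b. b \<in> set A \<Longrightarrow> \<sigma> b > \<sigma> a \<longleftrightarrow> \<tau> b > \<tau> a') \<Longrightarrow> act \<sigma> js a A u = act \<tau> js a' A u"
  by (induction A) (auto simp: act_simps)

lemma equivariant_act:
  assumes "set js \<subseteq> {1..n}" "set A \<subseteq> {..<length js}"
  shows "equivariant (act \<sigma> js a A)"
  using assms(2)
proof (induction A)
  case Nil
  show ?case by (simp add: act_simps[abs_def] equivariant_id)
next
  case (Cons b A)
  then have "js ! b \<in> {1..n}" using assms(1) nth_mem by fastforce
  then show ?case using Cons equivariant_comp[OF equivariant_g, of "js ! b" "act \<sigma> js a A"]
    by (cases "\<sigma> b > \<sigma> a") (simp_all add: act_simps[abs_def])
qed

lemma upt_split_two: "Suc i < m \<Longrightarrow> [0..<m] = [0..<i] @ [i, Suc i] @ [i + 2..<m]"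
  using upt_add_eq_append[of 0 i "m - i"] by (simp add: upt_conv_Cons)

text \<open>
  A closed formula for the action of a word along which no two factors cross twice.  In the induction step
  the factors \<open>a < b\<close> stand in adjacent places with vectors \<open>P x\<^sub>a\<close> and \<open>P M\<close>, where \<open>P\<close> collects the factors
  before \<open>a\<close> and \<open>M\<close> is \<open>x\<^sub>b\<close> acted on by the factors between \<open>a\<close> and \<open>b\<close>.  As \<open>P\<close> is equivariant, \<open>c\<close> turns them
  into \<open>P g\<^sub>a M\<close> and \<open>P x\<^sub>a\<close>, which is the formula for the longer word.
\<close>

lemma braid_word_ascending:
  assumes "set W \<subseteq> {i. Suc i < m}" "ascending W" "js \<in> Words m"
  defines "\<sigma> \<equiv> word_perm W"
  shows "braid_word c W (word js) =
    pure scale (map (\<lambda>k. act \<sigma> js (inv \<sigma> k) [0..<inv \<sigma> k] (x (js ! inv \<sigma> k))) [0..<m])"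
  using assms(1,2) unfolding \<sigma>_def
proof (induction W)
  case Nil
  have "act id js k [0..<k] u = u" for k u
  proof -
    have aux: "act id js k A u = u" if "set A \<subseteq> {..<k}" for A
      using that by (induction A) (auto simp: act_simps)
    show ?thesis by (rule aux) auto
  qed
  then have "map (\<lambda>k. act id js (inv id k) [0..<inv id k] (x (js ! inv id k))) [0..<m] = map x js"
    using assms(3) by (intro nth_equalityI) (auto simp: Words_def inv_id)
  then show ?case by (simp only: word_perm_simps braid_word_simps word_def)
next
  case (Cons i W)
  define \<sigma> where "\<sigma> = word_perm W"
  define \<tau> where "\<tau> = word_perm (i # W)"
  have \<tau>_\<sigma>: "\<tau> e = transpose i (Suc i) (\<sigma> e)" for e by (simp add: \<tau>_def \<sigma>_def)
  have inv_\<tau>: "inv \<tau> k = inv \<sigma> (transpose i (Suc i) k)" for k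
    unfolding \<tau>_def \<sigma>_def word_perm_simps inv_transpose_comp[OF bij_word_perm] comp_apply ..
  have im: "Suc i < m" using Cons.prems by simp
  have js: "length js = m" "set js \<subseteq> {1..n}" using assms(3) by (auto simp: Words_def)
  have perm: "\<sigma> permutes {..<m}" using word_perm_permutes Cons.prems by (auto simp: \<sigma>_def)
  have \<sigma>_inv: "\<sigma> (inv \<sigma> k) = k" "inv \<sigma> (\<sigma> k) = k" for k using permutes_inverses[OF perm] by auto
  define a b where "a = inv \<sigma> i" and "b = inv \<sigma> (Suc i)"
  have ab: "\<sigma> a = i" "\<sigma> b = Suc i" by (simp_all add: a_def b_def \<sigma>_inv)
  have lt: "a < b" using Cons.prems(2) by (simp add: a_def b_def \<sigma>_def)
  have bm: "b < m" using permutes_in_image[OF permutes_inv[OF perm], of "Suc i"] im by (simp add: b_def)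
  have \<sigma>_eq: "\<sigma> e = i \<longleftrightarrow> e = a" "\<sigma> e = Suc i \<longleftrightarrow> e = b" for e
    using ab \<sigma>_inv by (metis a_def, metis b_def)
  define val where "val \<rho> k = act \<rho> js (inv \<rho> k) [0..<inv \<rho> k] (x (js ! inv \<rho> k))" for \<rho> k
  define P where "P = act \<sigma> js a [0..<a]"
  define M where "M = act \<sigma> js b [Suc a..<b] (x (js ! b))"
  have split: "[0..<b] = [0..<a] @ [a] @ [Suc a..<b]"
    using lt upt_add_eq_append[of 0 a "b - a"] by (simp add: upt_conv_Cons)
  have val_i: "val \<sigma> i = P (x (js ! a))"
    by (simp add: val_def P_def a_def)
  \<comment> \<open>as \<open>a\<close> and \<open>b\<close> stand in adjacent places, the factors before \<open>a\<close> that have passed \<open>a\<close> are those that have passed \<open>b\<close>\<close>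
  have val_Suc_i: "val \<sigma> (Suc i) = P M"
  proof -
    have "act \<sigma> js b [0..<a] u = P u" for u
      unfolding P_def
    proof (rule act_cong)
      fix e assume "e \<in> set [0..<a]"
      then have "\<sigma> e \<noteq> i" "\<sigma> e \<noteq> Suc i" using lt \<sigma>_eq by auto
      then show "\<sigma> b < \<sigma> e \<longleftrightarrow> \<sigma> a < \<sigma> e" by (simp add: ab; arith)
    qed
    then show ?thesis
      unfolding val_def b_def[symmetric] split act_append M_def by (simp add: act_simps ab)
  qed
  have val_\<tau>_i: "val \<tau> i = P (g (js ! a) M)"
  proof -
    have inv: "inv \<tau> i = b" by (simp add: inv_\<tau> b_def)
    have 1: "act \<tau> js b [0..<a] u = P u" for u
      unfolding P_def
    proof (rule act_cong)
      fix e assume "e \<in> set [0..<a]"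
      then have "\<sigma> e \<noteq> i" "\<sigma> e \<noteq> Suc i" using lt \<sigma>_eq by auto
      then show "\<tau> b < \<tau> e \<longleftrightarrow> \<sigma> a < \<sigma> e" by (simp add: ab \<tau>_\<sigma>; arith)
    qed
    have 2: "act \<tau> js b [Suc a..<b] u = act \<sigma> js b [Suc a..<b] u" for u
    proof (rule act_cong)
      fix e assume "e \<in> set [Suc a..<b]"
      then have "\<sigma> e \<noteq> i" "\<sigma> e \<noteq> Suc i" using lt \<sigma>_eq by auto
      then show "\<tau> b < \<tau> e \<longleftrightarrow> \<sigma> b < \<sigma> e" by (simp add: ab \<tau>_\<sigma>; arith)
    qed
    show ?thesis
      unfolding val_def inv split act_append 1 2 M_def by (simp add: act_simps ab \<tau>_\<sigma>)
  qed
  have val_\<tau>_Suc_i: "val \<tau> (Suc i) = P (x (js ! a))"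
  proof -
    have inv: "inv \<tau> (Suc i) = a" by (simp add: inv_\<tau> a_def)
    have "act \<tau> js a [0..<a] u = P u" for u
      unfolding P_def
    proof (rule act_cong)
      fix e assume "e \<in> set [0..<a]"
      then have "\<sigma> e \<noteq> i" "\<sigma> e \<noteq> Suc i" using lt \<sigma>_eq by auto
      then show "\<tau> a < \<tau> e \<longleftrightarrow> \<sigma> a < \<sigma> e" by (simp add: ab \<tau>_\<sigma>; arith)
    qed
    then show ?thesis unfolding val_def inv by simp
  qed
  have val_other: "val \<tau> k = val \<sigma> k" if k: "k \<noteq> i" "k \<noteq> Suc i" for k
  proof -
    have inv: "inv \<tau> k = inv \<sigma> k" using k by (simp add: inv_\<tau>)
    have "\<tau> (inv \<sigma> k) < \<tau> e \<longleftrightarrow> \<sigma> (inv \<sigma> k) < \<sigma> e" for e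
    proof (cases "\<sigma> e = k")
      case False
      then show ?thesis unfolding \<tau>_\<sigma> \<sigma>_inv using k
        by (intro transpose_Suc_less) (auto simp: doubleton_eq_iff)
    qed (simp add: \<tau>_\<sigma> \<sigma>_inv)
    then show ?thesis unfolding val_def inv by (intro act_cong)
  qed
  let ?us = "map (val \<sigma>) [0..<i]" and ?ws = "map (val \<sigma>) [i + 2..<m]"
  have "js ! a \<in> {1..n}" using js lt bm nth_mem[of a js] by force
  moreover have "equivariant P" unfolding P_def using js lt bm by (intro equivariant_act) auto
  ultimately obtain \<delta> where \<delta>: "braids_by \<delta> (P (x (js ! a)))" "\<And>u. \<delta> (P u) = P (g (js ! a) u)"
    using braids_x unfolding equivariant_def by blast
  have "braid_word c (i # W) (word js) = braid_at c i (pure scale (map (val \<sigma>) [0..<m]))"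
    using Cons unfolding braid_word_simps val_def \<sigma>_def by simp
  also have "map (val \<sigma>) [0..<m] = ?us @ [P (x (js ! a)), P M] @ ?ws"
    unfolding upt_split_two[OF im] by (simp add: val_i val_Suc_i)
  also have "braid_at c i (pure scale \<dots>) = pure scale (?us @ [\<delta> (P M), P (x (js ! a))] @ ?ws)"
    by (rule braid_at_braids_by[OF \<delta>(1)]) simp
  also have "?us @ [\<delta> (P M), P (x (js ! a))] @ ?ws = map (val \<tau>) [0..<m]"
    unfolding upt_split_two[OF im] by (simp add: \<delta>(2) val_\<tau>_i val_\<tau>_Suc_i val_other)
  finally show ?case unfolding val_def \<tau>_def .
qed

text \<open>
  Matsumoto's theorem for these braidings: the formula of \<open>braid_word_ascending\<close> involves only the
  permutation of the word.
\<close>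

lemma braid_word_perm_eq:
  assumes "set W \<subseteq> {i. Suc i < m}" "ascending W" "set W' \<subseteq> {i. Suc i < m}" "ascending W'"
    and "word_perm W = word_perm W'" "t \<in> T m"
  shows "braid_word c W t = braid_word c W' t"
  by (rule T_eqI[OF linear_braid_word[OF assms(1)] linear_braid_word[OF assms(3)] _ assms(6)])
    (use braid_word_ascending[OF assms(1,2)] braid_word_ascending[OF assms(3,4)] assms(5) in simp)

lemma matsumoto_lift_eq:
  assumes "set W \<subseteq> {i. Suc i < m}" "ascending W" "t \<in> T m"
  shows "matsumoto_lift c m (word_perm W) t = braid_word c W t"
proof -
  have perm: "word_perm W permutes {..<m}" using assms word_perm_permutes by blast
  have "reduced_word m (word_perm W) (SOME ws. reduced_word m (word_perm W) ws)"
    using reduced_word_exists[OF perm] by (rule someI_ex)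
  then show ?thesis
    unfolding matsumoto_lift_def reduced_word_iff[OF perm] using assms by (intro braid_word_perm_eq) auto
qed

lemma matsumoto_lift_word:
  assumes "\<pi> permutes {..<m}"
  obtains W where "set W \<subseteq> {i. Suc i < m}" "ascending W" "word_perm W = \<pi>" "matsumoto_lift c m \<pi> = braid_word c W"
  using someI_ex[OF reduced_word_exists[OF assms]] that
  unfolding matsumoto_lift_def reduced_word_iff[OF assms] by blast

lemma linear_quantum_symmetrizer: "linear_on (T m) (quantum_symmetrizer c m)"
  unfolding quantum_symmetrizer_def[abs_def]
proof (rule linear_on_sum)
  fix \<pi> :: "nat \<Rightarrow> nat" assume "\<pi> \<in> {\<pi>. \<pi> permutes {..<m}}"
  then show "linear_on (T m) (matsumoto_lift c m \<pi>)"
    using matsumoto_lift_word[of \<pi> m] linear_braid_word by (metis mem_Collect_eq)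
qed

lemma quantum_symmetrizer_T: "t \<in> T m \<Longrightarrow> quantum_symmetrizer c m t \<in> T m"
  unfolding quantum_symmetrizer_def
proof (rule tensor.subspace_sum[OF subspace_T])
  fix \<pi> :: "nat \<Rightarrow> nat" assume "t \<in> T m" "\<pi> \<in> {\<pi>. \<pi> permutes {..<m}}"
  then show "matsumoto_lift c m \<pi> t \<in> T m"
    using matsumoto_lift_word[of \<pi> m] braid_word_T by (metis mem_Collect_eq)
qed

text \<open>
  Write a permutation as \<open>\<pi> \<circ> \<rho>\<close> with \<open>\<rho>\<close> moving the factor \<open>a\<close> to the last place and \<open>\<pi>\<close> fixing that
  place.  The lengths add up, so the lift of the product is the product of the lifts, and the lift of \<open>\<pi>\<close> commutes with
  the contraction of the last factor.
\<close>

lemma contract_quantum_symmetrizer: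
  assumes t: "t \<in> T (Suc m)"
  shows "contract f (quantum_symmetrizer c (Suc m) t) =
    (\<Sum>a\<le>m. quantum_symmetrizer c m (contract f (braid_word c (last_cycle m a) t)))"
proof -
  have csum: "contract f (\<Sum>i\<in>A. h i) = (\<Sum>i\<in>A. contract f (h i))" for h :: "'i \<Rightarrow> ('k, 'v) tensor" and A
    by (rule ext) (simp add: contract_def sum_fun_apply)
  have cyc: "set (last_cycle m a) \<subseteq> {i. Suc i < Suc m}" for a by (auto simp: last_cycle_def)
  have step: "contract f (matsumoto_lift c (Suc m) (\<pi> \<circ> word_perm (last_cycle m a)) t) =
      matsumoto_lift c m \<pi> (contract f (braid_word c (last_cycle m a) t))"
    if "a \<le> m" "\<pi> permutes {..<m}" for a \<pi>
  proof -
    obtain W where W: "set W \<subseteq> {i. Suc i < m}" "ascending W" "word_perm W = \<pi>"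
      "matsumoto_lift c m \<pi> = braid_word c W"
      using matsumoto_lift_word[OF \<open>\<pi> permutes {..<m}\<close>] by blast
    have "matsumoto_lift c (Suc m) (word_perm (W @ last_cycle m a)) t = braid_word c (W @ last_cycle m a) t"
      using W cyc[of a] by (intro matsumoto_lift_eq ascending_append_last_cycle that t) auto
    then show ?thesis
      unfolding W(4) word_perm_append W(3) braid_word_append
      using contract_braid_word[OF W(1) braid_word_T[OF cyc t]] by simp
  qed
  have "contract f (quantum_symmetrizer c (Suc m) t) =
      (\<Sum>\<sigma> | \<sigma> permutes {..<Suc m}. contract f (matsumoto_lift c (Suc m) \<sigma> t))"
    unfolding quantum_symmetrizer_def by (rule csum)
  also have "\<dots> = (\<Sum>(a, \<pi>) \<in> {..m} \<times> {\<pi>. \<pi> permutes {..<m}}.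
      contract f (matsumoto_lift c (Suc m) (\<pi> \<circ> word_perm (last_cycle m a)) t))"
    by (subst sum.reindex_bij_betw[OF bij_betw_last_cycle, symmetric]) (simp add: case_prod_unfold)
  also have "\<dots> = (\<Sum>(a, \<pi>) \<in> {..m} \<times> {\<pi>. \<pi> permutes {..<m}}.
      matsumoto_lift c m \<pi> (contract f (braid_word c (last_cycle m a) t)))"
    by (rule sum.cong) (auto simp: step)
  also have "\<dots> = (\<Sum>a\<le>m. \<Sum>\<pi> | \<pi> permutes {..<m}. matsumoto_lift c m \<pi> (contract f (braid_word c (last_cycle m a) t)))"
    by (rule sum.cartesian_product[symmetric])
  finally show ?thesis by (simp only: quantum_symmetrizer_def)
qed

end

section \<open>The Nichols map and its skew derivations\<close>

context group_type_braiding
begin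

abbreviation Letters :: "nat list set" where
  "Letters \<equiv> {js. set js \<subseteq> {1..n}}"

abbreviation TA :: "('k, 'v) tensor set" where
  "TA \<equiv> tensor_algebra scale"

abbreviation rmult :: "'v \<Rightarrow> ('k, 'v) tensor \<Rightarrow> ('k, 'v) tensor" where
  "rmult v t \<equiv> tensor_mult t (pure scale [v])"

lemma T_subset_TA: "T m \<subseteq> TA"
  unfolding tensor_power_def tensor_algebra_def by (intro tensor.span_mono) auto

lemma subspace_TA [simp]: "tensor.subspace TA"
  by (simp add: tensor_algebra_def)

lemma word_T: "set js \<subseteq> {1..n} \<Longrightarrow> word js \<in> T (length js)"
  by (simp add: word_def pure_T)

lemma word_TA: "word js \<in> TA"
  unfolding word_def tensor_algebra_def by (rule tensor.span_base) simp

lemma pure_TA: "pure scale vs \<in> TA"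
  unfolding tensor_algebra_def by (rule tensor.span_base) simp

lemma TA_word: "TA = tensor.span (word ` Letters)"
proof
  show "tensor.span (word ` Letters) \<subseteq> TA"
    by (intro tensor.span_minimal subspace_TA) (auto simp: word_TA)
  have "T m \<subseteq> tensor.span (word ` Letters)" for m
    unfolding T_word by (intro tensor.span_mono image_mono) (auto simp: Words_def)
  then have "range (pure scale) \<subseteq> tensor.span (word ` Letters)" using pure_T by blast
  then show "TA \<subseteq> tensor.span (word ` Letters)"
    unfolding tensor_algebra_def by (intro tensor.span_minimal) auto
qed

lemma TA_eqI:
  assumes "linear_on TA f" "linear_on TA h" "\<And>js. set js \<subseteq> {1..n} \<Longrightarrow> f (word js) = h (word js)" "t \<in> TA"
  shows "f t = h t"
  by (rule linear_on_eq[OF assms(1,2)[unfolded TA_word] _ assms(4)[unfolded TA_word]]) (use assms(3) in auto)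

lemma TA_image:
  assumes "linear_on TA f" "tensor.subspace S" "\<And>js. set js \<subseteq> {1..n} \<Longrightarrow> f (word js) \<in> S" "t \<in> TA"
  shows "f t \<in> S"
  by (rule linear_on_span_image[OF assms(1)[unfolded TA_word] _ assms(2) assms(4)[unfolded TA_word]])
    (use assms(3) in auto)

lemma rmult_TA: "t \<in> TA \<Longrightarrow> rmult v t \<in> TA"
  by (rule TA_image[OF tlinear_imp_linear_on[OF tlinear_tensor_mult(1)] subspace_TA])
    (auto simp: word_def tensor_mult_pure pure_TA)

lemma tlinear_degree_part: "tlinear (degree_part k)"
  by (rule tlinearI) (auto simp: degree_part_def tscale_def fun_eq_iff)

lemma degree_part_T: "t \<in> T m \<Longrightarrow> degree_part k t = (if k = m then t else 0)"
  using tensor_power_eval[of t scale m] by (auto simp: degree_part_def fun_eq_iff)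

lemma degree_part_TA:
  assumes "t \<in> TA"
  shows "degree_part k t \<in> T k"
proof (rule TA_image[OF tlinear_imp_linear_on[OF tlinear_degree_part] subspace_T _ assms])
  fix js assume js: "set js \<subseteq> {1..n}"
  show "degree_part k (word js) \<in> T k"
    unfolding degree_part_T[OF word_T[OF js]] using word_T[OF js] tensor.subspace_0[OF subspace_T] by metis
qed

text \<open>
  Maps such as \<open>nichols_map\<close> are given degree by degree, the degree being read off from the number of
  arguments; on a tensor of degree \<open>m\<close> only the component \<open>m\<close> contributes.
\<close>

lemma graded_map_T:
  assumes "\<And>k. linear_on (T k) (f k)" "\<And>s. s \<in> T m \<Longrightarrow> f m s \<in> T m" "t \<in> T m"
  shows "(\<lambda>fs. f (length fs) (degree_part (length fs) t) fs) = f m t"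
proof
  fix fs
  show "f (length fs) (degree_part (length fs) t) fs = f m t fs"
  proof (cases "length fs = m")
    case False
    have "f (length fs) 0 = 0" using linear_on_0[OF assms(1) subspace_T] .
    moreover have "degree_part (length fs) t = 0" using False by (subst degree_part_T[OF assms(3)]) (simp only: if_False)
    moreover have "f m t fs = 0" using tensor_power_eval[OF assms(2)[OF assms(3)] False] .
    ultimately show ?thesis by (metis zero_fun_apply)
  qed (simp add: degree_part_T[OF assms(3)])
qed

lemma graded_map_linear:
  assumes "\<And>k. linear_on (T k) (f k)"
  shows "linear_on TA (\<lambda>t fs. f (length fs) (degree_part (length fs) t) fs)"
  unfolding linear_on_def
proof (intro conjI allI ballI ext)
  fix s t and fs :: "('v \<Rightarrow> 'k) list" assume "s \<in> TA" "t \<in> TA"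
  then have "f (length fs) (degree_part (length fs) (s + t)) =
      f (length fs) (degree_part (length fs) s) + f (length fs) (degree_part (length fs) t)"
    unfolding tlinear_rules[OF tlinear_degree_part]
    by (intro linear_on_add[OF assms] degree_part_TA)
  then show "f (length fs) (degree_part (length fs) (s + t)) fs =
      ((\<lambda>fs. f (length fs) (degree_part (length fs) s) fs) + (\<lambda>fs. f (length fs) (degree_part (length fs) t) fs)) fs"
    by simp
next
  fix a t and fs :: "('v \<Rightarrow> 'k) list" assume "t \<in> TA"
  then have "f (length fs) (degree_part (length fs) (tscale a t)) =
      tscale a (f (length fs) (degree_part (length fs) t))"
    unfolding tlinear_rules[OF tlinear_degree_part]
    by (intro linear_on_scale[OF assms] degree_part_TA)
  then show "f (length fs) (degree_part (length fs) (tscale a t)) fs =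
      tscale a (\<lambda>fs. f (length fs) (degree_part (length fs) t) fs) fs"
    by (simp add: tscale_def)
qed

abbreviation F :: "('k, 'v) tensor \<Rightarrow> ('k, 'v) tensor" where
  "F \<equiv> nichols_map c"

lemma F_T: "t \<in> T m \<Longrightarrow> F t = quantum_symmetrizer c m t"
  unfolding nichols_map_def
  by (rule graded_map_T[OF linear_quantum_symmetrizer quantum_symmetrizer_T])

lemma linear_F: "linear_on TA F"
  unfolding nichols_map_def[abs_def] by (rule graded_map_linear[OF linear_quantum_symmetrizer])

lemma F_0: "F 0 = 0"
  by (rule linear_on_0[OF linear_F subspace_TA])

lemma F_TA:
  assumes "t \<in> TA"
  shows "F t \<in> TA"
proof (rule TA_image[OF linear_F subspace_TA _ assms])
  fix js assume js: "set js \<subseteq> {1..n}"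
  show "F (word js) \<in> TA"
    unfolding F_T[OF word_T[OF js]]
    by (rule subsetD[OF T_subset_TA quantum_symmetrizer_T[OF word_T[OF js]]])
qed

lemma F_sum:
  assumes "\<And>i. i \<in> A \<Longrightarrow> h i \<in> TA"
  shows "F (\<Sum>i\<in>A. h i) = (\<Sum>i\<in>A. F (h i))"
  using assms
proof (induction A rule: infinite_finite_induct)
  case (insert i A)
  have eq: "F (h i + (\<Sum>i\<in>A. h i)) = F (h i) + F (\<Sum>i\<in>A. h i)"
    using insert by (intro linear_on_add[OF linear_F] tensor.subspace_sum[OF subspace_TA]) auto
  have IH: "F (\<Sum>i\<in>A. h i) = (\<Sum>i\<in>A. F (h i))" using insert by blast
  show ?case unfolding sum.insert[OF insert(1,2)] eq IH ..
next
  case (infinite A)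
  show ?case unfolding sum.infinite[OF infinite(1)] by (rule F_0)
next
  case empty
  show ?case unfolding sum.empty by (rule F_0)
qed

lemma F_short:
  assumes "set js \<subseteq> {1..n}" "length js \<le> 1"
  shows "F (word js) = word js"
proof -
  have "{..<length js} = {} \<or> {..<length js} = {0}" using assms(2) by (cases js) auto
  then have "\<pi> permutes {..<length js} \<longleftrightarrow> \<pi> = id" for \<pi> :: "nat \<Rightarrow> nat"
    using permutes_empty permutes_sing[of _ 0] permutes_id by metis
  then have "quantum_symmetrizer c (length js) (word js) = matsumoto_lift c (length js) id (word js)"
    by (simp add: quantum_symmetrizer_def)
  also have "\<dots> = word js"
    using matsumoto_lift_eq[of "[]", OF _ _ word_T[OF assms(1)]] by (simp add: braid_word_simps)
  finally show ?thesis using F_T[OF word_T[OF assms(1)]] by simp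
qed

lemma word_Nil: "word [] = unit_tensor"
  by (auto simp: word_def unit_tensor_def pure_Nil fun_eq_iff)

lemma F_unit: "F unit_tensor = unit_tensor"
  using F_short[of "[]"] by (simp add: word_Nil)

abbreviation delete_letter :: "nat \<Rightarrow> nat list \<Rightarrow> nat \<Rightarrow> ('k, 'v) tensor" where
  "delete_letter i js a \<equiv> pure scale (map x (take a js) @ map (g i) (map x (drop (Suc a) js)))"

text \<open>
  The skew derivation \<open>\<delta>\<^sub>i\<close> on words: every letter \<open>i\<close> is deleted in turn, and \<open>g\<^sub>i\<close> acts on all letters to its
  right.
\<close>

definition word_deriv :: "nat \<Rightarrow> nat list \<Rightarrow> ('k, 'v) tensor" where
  "word_deriv i js = (\<Sum>a<length js. if js ! a = i
     then delete_letter i js a else 0)"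

lemma word_deriv_TA: "word_deriv i js \<in> TA"
  unfolding word_deriv_def
proof (rule tensor.subspace_sum[OF subspace_TA])
  fix a
  show "(if js ! a = i then delete_letter i js a else 0) \<in> TA"
    using pure_TA tensor.subspace_0[OF subspace_TA] by metis
qed

text \<open>
  The factor \<open>a\<close> on its way to the last place acts by its degree on all factors that it passes.
\<close>

lemma contract_F_word:
  assumes js: "set js \<subseteq> {1..n}" and i: "i \<in> {1..n}"
  shows "contract (\<xi> i) (F (word js)) = F (word_deriv i js)"
proof (cases "length js")
  case 0
  then show ?thesis by (simp add: word_Nil F_unit contract_unit word_deriv_def F_0)
next
  case (Suc m)
  define p where "p a = delete_letter i js a" for a
  have p: "p a \<in> T m" if "a \<le> m" for a using that Suc by (auto simp: p_def intro!: pure_T)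
  have "quantum_symmetrizer c m (contract (\<xi> i) (braid_word c (last_cycle m a) (word js))) =
      F (if js ! a = i then p a else 0)" if a: "a \<le> m" for a
  proof -
    have ja: "js ! a \<in> {1..n}" using js Suc a by (metis in_mono le_imp_less_Suc nth_mem)
    have "js = take a js @ [js ! a] @ drop (Suc a) js"
      using a Suc by (simp add: id_take_nth_drop)
    then have "map x js = map x (take a js) @ [x (js ! a)] @ map x (drop (Suc a) js) @ []"
      by (metis append_Nil2 list.simps(8,9) map_append)
    moreover have "a + length (map x (drop (Suc a) js)) = m" using a Suc by simp
    moreover have "length (map x (take a js)) = a" using a Suc by simp
    ultimately have "braid_word c (last_cycle m a) (word js) =
        pure scale ((map x (take a js) @ map (g (js ! a)) (map x (drop (Suc a) js))) @ [x (js ! a)])"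
      using braid_word_last_cycle[OF braids_x[OF ja], of "map x (take a js)" a "map x (drop (Suc a) js)" "[]"]
      unfolding word_def by (metis append_assoc append_Nil2)
    then have "contract (\<xi> i) (braid_word c (last_cycle m a) (word js)) =
        tscale (\<xi> i (x (js ! a))) (pure scale (map x (take a js) @ map (g (js ! a)) (map x (drop (Suc a) js))))"
      by (simp only: contract_pure linear_\<xi> if_True)
    also have "\<dots> = (if js ! a = i then p a else 0)"
      unfolding \<xi>_x[OF i ja] p_def
      by (cases "js ! a = i") (simp_all only: refl if_True if_False tensor.scale_one tensor.scale_zero_left)
    finally have eq: "contract (\<xi> i) (braid_word c (last_cycle m a) (word js)) = (if js ! a = i then p a else 0)" .
    have "(if js ! a = i then p a else 0) \<in> T m" using p[OF a] tensor.subspace_0[OF subspace_T] by metis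
    then show ?thesis unfolding eq by (rule F_T[symmetric])
  qed
  moreover have "word js \<in> T (Suc m)" using word_T[OF js] Suc by simp
  ultimately have "contract (\<xi> i) (F (word js)) = (\<Sum>a\<le>m. F (if js ! a = i then p a else 0))"
    by (simp add: F_T contract_quantum_symmetrizer)
  also have "\<dots> = F (\<Sum>a\<le>m. if js ! a = i then p a else 0)"
  proof (rule F_sum[symmetric])
    fix a show "(if js ! a = i then p a else 0) \<in> TA"
      unfolding p_def using pure_TA tensor.subspace_0[OF subspace_TA] by metis
  qed
  finally show ?thesis
    unfolding word_deriv_def Suc p_def lessThan_Suc_atMost .
qed

lemma inj_word: "inj_on word Letters" and independent_words: "tensor.independent (word ` Letters)"
proof -
  have "map x ` Letters = lists (x ` {1..n})" 
    using lists_image[of x "{1..n}"] by (simp only: lists_eq_set)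
  then have "word ` Letters = pure scale ` lists (x ` {1..n})"
    by (metis (no_types, lifting) image_cong image_image word_def)
  then show "tensor.independent (word ` Letters)"
    using independent_pure(2)[OF vector_space_scale indep] by simp
  have "inj_on (map x) Letters"
  proof (rule inj_onI)
    fix js ks assume "js \<in> Letters" "ks \<in> Letters" "map x js = map x ks"
    then show "js = ks" using inj_x by (intro map_inj_on[of x js ks]) (auto intro: inj_on_subset)
  qed
  then show "inj_on word Letters"
    using independent_pure(1)[OF vector_space_scale indep] \<open>map x ` Letters = _\<close>
    unfolding word_def[abs_def] using comp_inj_on[of "map x" Letters "pure scale"] by (simp add: o_def)
qed

sublocale tt: vector_space_pair "tscale :: 'k \<Rightarrow> ('k, 'v) tensor \<Rightarrow> _" "tscale :: 'k \<Rightarrow> ('k, 'v) tensor \<Rightarrow> _"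
  by unfold_locales

text \<open>
  The linear extension of \<open>word_deriv\<close> to the tensor algebra.
\<close>

definition skew_deriv :: "nat \<Rightarrow> ('k, 'v) tensor \<Rightarrow> ('k, 'v) tensor" where
  "skew_deriv i = tt.construct (word ` Letters) (\<lambda>t. word_deriv i (inv_into Letters word t))"

lemma tlinear_skew_deriv: "tlinear (skew_deriv i)"
  unfolding skew_deriv_def by (rule tt.linear_construct[OF independent_words])

lemma skew_deriv_word: "set js \<subseteq> {1..n} \<Longrightarrow> skew_deriv i (word js) = word_deriv i js"
  unfolding skew_deriv_def using inj_word by (subst tt.construct_basis[OF independent_words]) (auto simp: inv_into_f_f)

lemma skew_deriv_TA: "t \<in> TA \<Longrightarrow> skew_deriv i t \<in> TA"
  by (rule TA_image[OF tlinear_imp_linear_on[OF tlinear_skew_deriv] subspace_TA]) (auto simp: skew_deriv_word word_deriv_TA)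

lemma contract_F: "i \<in> {1..n} \<Longrightarrow> t \<in> TA \<Longrightarrow> contract (\<xi> i) (F t) = F (skew_deriv i t)"
proof (rule TA_eqI[where f = "\<lambda>t. contract (\<xi> i) (F t)" and h = "\<lambda>t. F (skew_deriv i t)"])
  show "linear_on TA (\<lambda>t. contract (\<xi> i) (F t))"
    by (rule linear_on_compose[OF linear_F _ tlinear_imp_linear_on[OF tlinear_contract, of TA]]) (auto simp: F_TA)
  show "linear_on TA (\<lambda>t. F (skew_deriv i t))"
    by (rule linear_on_compose[OF tlinear_imp_linear_on[OF tlinear_skew_deriv] _ linear_F]) (auto simp: skew_deriv_TA)
qed (auto simp: skew_deriv_word contract_F_word)

lemma word_deriv_snoc:
  "word_deriv i (js @ [j]) = (if i = j then word js else 0) + rmult (g i (x j)) (word_deriv i js)"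
proof -
  have sum: "rmult v (\<Sum>a\<in>A. h a) = (\<Sum>a\<in>A. rmult v (h a))" for v and A :: "nat set" and h
    by (rule tlinear_sum[OF tlinear_tensor_mult(1)])
  have "word_deriv i (js @ [j]) = (\<Sum>a<length js. if js ! a = i
       then pure scale ((map x (take a js) @ map (g i) (map x (drop (Suc a) js))) @ [g i (x j)]) else 0) +
     (if i = j then word js else 0)"
    unfolding word_deriv_def length_append_singleton sum.lessThan_Suc
    by (rule arg_cong2[where f = "(+)"], rule sum.cong) (auto simp: nth_append word_def)
  also have "(\<Sum>a<length js. if js ! a = i
       then pure scale ((map x (take a js) @ map (g i) (map x (drop (Suc a) js))) @ [g i (x j)]) else 0) =
     rmult (g i (x j)) (word_deriv i js)"
    unfolding word_deriv_def sum
  proof (rule sum.cong)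
    fix a
    show "(if js ! a = i then pure scale ((map x (take a js) @ map (g i) (map x (drop (Suc a) js))) @ [g i (x j)]) else 0) =
      rmult (g i (x j)) (if js ! a = i then delete_letter i js a else 0)"
      by (cases "js ! a = i") (simp_all only: refl if_True if_False tensor_mult_pure tlinear_rules[OF tlinear_tensor_mult(1)])
  qed simp
  finally show ?thesis by (subst add.commute)
qed

lemma skew_deriv_rmult:
  assumes "i \<in> {1..n}" "j \<in> {1..n}" "t \<in> TA"
  shows "skew_deriv i (rmult (x j) t) = (if i = j then t else 0) + rmult (g i (x j)) (skew_deriv i t)"
proof (rule TA_eqI[where f = "\<lambda>t. skew_deriv i (rmult (x j) t)" and h = "\<lambda>t. (if i = j then t else 0) + rmult (g i (x j)) (skew_deriv i t)"])
  show "linear_on TA (\<lambda>t. skew_deriv i (rmult (x j) t))"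
    by (simp only: linear_on_def tlinear_rules[OF tlinear_skew_deriv] tlinear_rules[OF tlinear_tensor_mult(1)]) blast
  show "linear_on TA (\<lambda>t. (if i = j then t else 0) + rmult (g i (x j)) (skew_deriv i t))"
    by (cases "i = j") (auto simp: linear_on_def tlinear_rules[OF tlinear_skew_deriv] tensor_mult_linear
        tensor.scale_right_distrib add_ac)
  fix js assume js: "set js \<subseteq> {1..n}"
  have "rmult (x j) (word js) = word (js @ [j])" by (simp add: word_def tensor_mult_pure)
  then show "skew_deriv i (rmult (x j) (word js)) = (if i = j then word js else 0) + rmult (g i (x j)) (skew_deriv i (word js))"
    using js assms skew_deriv_word[of "js @ [j]" i] by (simp add: word_deriv_snoc skew_deriv_word)
qed (rule assms)

definition below :: "nat \<Rightarrow> ('k, 'v) tensor set" where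
  "below d = tensor.span (word ` {js. set js \<subseteq> {1..n} \<and> length js < d})"

lemma below_mono: "d \<le> e \<Longrightarrow> below d \<subseteq> below e"
  unfolding below_def by (intro tensor.span_mono) auto

lemma subspace_below [simp]: "tensor.subspace (below d)"
  by (simp add: below_def)

lemma T_below: "m < d \<Longrightarrow> T m \<subseteq> below d"
  unfolding T_word below_def by (intro tensor.span_mono) (auto simp: Words_def)

lemma TA_below: "t \<in> TA \<Longrightarrow> \<exists>d. t \<in> below d"
  unfolding TA_word
proof (induction rule: tensor.span_induct_alt)
  case base
  then show ?case using tensor.subspace_0[OF subspace_below] by blast
next
  case (step a u v)
  then obtain d js where d: "v \<in> below d" "u = word js" "set js \<subseteq> {1..n}" by auto
  define e where "e = max d (Suc (length js))"
  have "u \<in> below e"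
    unfolding d(2) by (rule subsetD[OF T_below word_T[OF d(3)]]) (simp add: e_def)
  moreover have "v \<in> below e" using d(1) below_mono[of d e] by (auto simp: e_def)
  ultimately have "tscale a u + v \<in> below e" by (intro tensor.subspace_add tensor.subspace_scale subspace_below)
  then show ?case by blast
qed

lemma skew_deriv_below:
  assumes "t \<in> below (Suc d)"
  shows "skew_deriv i t \<in> below d"
proof (rule linear_on_span_image[OF tlinear_imp_linear_on[OF tlinear_skew_deriv] _ subspace_below assms[unfolded below_def]])
  fix u assume "u \<in> word ` {js. set js \<subseteq> {1..n} \<and> length js < Suc d}"
  then obtain js where js: "u = word js" "set js \<subseteq> {1..n}" "length js \<le> d" by auto
  show "skew_deriv i u \<in> below d"
    unfolding js(1) skew_deriv_word[OF js(2)] word_deriv_def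
  proof (rule tensor.subspace_sum[OF subspace_below])
    fix a assume a: "a \<in> {..<length js}"
    have "delete_letter i js a \<in> T (length js - 1)"
      using a by (intro pure_T) auto
    then have "delete_letter i js a \<in> below d"
      by (rule subsetD[OF T_below, rotated]) (use a js(3) in auto)
    then show "(if js ! a = i then delete_letter i js a else 0) \<in> below d"
      using tensor.subspace_0[OF subspace_below] by metis
  qed
qed

lemma below_0: "t \<in> below 0 \<Longrightarrow> t = 0"
  by (simp add: below_def)

lemma contract_expand:
  assumes f: "Vector_Spaces.linear scale (*) f" and t: "t \<in> TA"
  shows "contract f t = (\<Sum>i=1..n. tscale (f (x i)) (contract (\<xi> i) t))"
proof (rule TA_eqI[where f = "contract f" and h = "\<lambda>t. \<Sum>i=1..n. tscale (f (x i)) (contract (\<xi> i) t)"])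
  show "linear_on TA (contract f)" by (rule tlinear_imp_linear_on[OF tlinear_contract])
  show "linear_on TA (\<lambda>t. \<Sum>i=1..n. tscale (f (x i)) (contract (\<xi> i) t))"
    by (rule linear_on_sum)
      (simp add: linear_on_def tlinear_rules[OF tlinear_contract] tensor.scale_right_distrib mult.commute)
  fix js assume js: "set js \<subseteq> {1..n}"
  show "contract f (word js) = (\<Sum>i=1..n. tscale (f (x i)) (contract (\<xi> i) (word js)))"
  proof (cases js rule: rev_cases)
    case Nil
    then show ?thesis by (simp only: word_Nil contract_unit tensor.scale_zero_right sum.neutral_const)
  next
    case (snoc ks j)
    then have j: "j \<in> {1..n}" using js by simp
    have w: "contract h (word js) = tscale (h (x j)) (word ks)" if "Vector_Spaces.linear scale (*) h" for h
      using that by (simp add: snoc word_def contract_pure)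
    have "(\<Sum>i=1..n. tscale (f (x i)) (contract (\<xi> i) (word js))) =
      (\<Sum>i=1..n. if i = j then tscale (f (x j)) (word ks) else 0)"
      using j by (intro sum.cong) (auto simp: w[OF linear_\<xi>] \<xi>_x)
    then show ?thesis using j by (simp add: w[OF f])
  qed
qed (rule t)

lemma contract_nonlinear:
  assumes f: "\<not> Vector_Spaces.linear scale (*) f" and t: "t \<in> TA"
  shows "contract f t = 0"
proof -
  have "contract f t \<in> {0}"
  proof (rule TA_image[OF tlinear_imp_linear_on[OF tlinear_contract] _ _ t])
    fix js
    show "contract f (word js) \<in> {0}"
    proof (cases js rule: rev_cases)
      case Nil
      then show ?thesis by (simp add: word_Nil contract_unit)
    next
      case (snoc ks j)
      then show ?thesis using f by (simp add: word_def contract_pure)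
    qed
  qed auto
  then show ?thesis by simp
qed

text \<open>
  A tensor is determined by its values on lists of coordinate functions.
\<close>

lemma TA_separated:
  assumes t: "t \<in> TA" "t [] = 0" and c: "\<And>i. i \<in> {1..n} \<Longrightarrow> contract (\<xi> i) t = 0"
  shows "t = 0"
proof
  fix fs
  show "t fs = 0 fs"
  proof (cases fs rule: rev_cases)
    case Nil
    then show ?thesis using t by simp
  next
    case (snoc gs f)
    have "contract f t = 0"
    proof (cases "Vector_Spaces.linear scale (*) f")
      case True
      show ?thesis unfolding contract_expand[OF True t(1)]
        by (rule sum.neutral) (use c in \<open>metis tensor.scale_zero_right\<close>)
    qed (rule contract_nonlinear[OF _ t(1)])
    then have "contract f t gs = 0" by simp
    then show ?thesis by (simp add: snoc contract_def)
  qed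
qed

lemma F_Nil:
  assumes "t \<in> TA"
  shows "F t [] = t []"
proof -
  have "quantum_symmetrizer c 0 (degree_part 0 t) = degree_part 0 t"
  proof (rule T_eqI[OF linear_quantum_symmetrizer _ _ degree_part_TA[OF assms]])
    show "linear_on (T 0) (\<lambda>t. t)" by (simp add: linear_on_def)
    show "quantum_symmetrizer c 0 (word js) = word js" if "js \<in> Words 0" for js
      using that F_T[OF word_T[of js]] F_short[of js] by (auto simp: Words_def)
  qed
  then show ?thesis by (simp add: nichols_map_def degree_part_def)
qed

lemma F_kernel:
  assumes "t \<in> TA" "t [] = 0" "\<And>i. i \<in> {1..n} \<Longrightarrow> F (skew_deriv i t) = 0"
  shows "F t = 0"
  by (rule TA_separated[OF F_TA]) (use assms in \<open>auto simp: F_Nil contract_F\<close>)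

lemma rmult_Nil: "rmult v t [] = 0"
  by (simp add: tensor_mult_def pure_simps)

lemma rmult_expand: "rmult v t = (\<Sum>i=1..n. tscale (\<xi> i v) (rmult (x i) t))"
proof -
  have sum: "tensor_mult t (\<Sum>i\<in>A. h i) = (\<Sum>i\<in>A. tensor_mult t (h i))" for A :: "nat set" and h
    by (rule tlinear_sum[OF tlinear_tensor_mult(2)])
  have "pure scale [v] = (\<Sum>i=1..n. tscale (\<xi> i v) (pure scale [x i]))"
    using pure_snoc_expand[of "[]" v] by simp
  then have "rmult v t = tensor_mult t (\<Sum>i=1..n. tscale (\<xi> i v) (pure scale [x i]))" by (rule arg_cong)
  then show ?thesis by (simp only: sum tensor_mult_linear)
qed

lemma F_rmult_expand:
  assumes "t \<in> TA"
  shows "F (rmult v t) = (\<Sum>i=1..n. tscale (\<xi> i v) (F (rmult (x i) t)))"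
proof -
  have "F (rmult v t) = (\<Sum>i=1..n. F (tscale (\<xi> i v) (rmult (x i) t)))"
    unfolding rmult_expand[of t v] by (rule F_sum) (intro tensor.subspace_scale subspace_TA rmult_TA assms)
  then show ?thesis using assms by (simp only: linear_on_scale[OF linear_F] rmult_TA)
qed

text \<open>
  The kernel of the Nichols map is a right ideal.  Induction on the degree: if \<open>F t = 0\<close>, every
  skew derivative of \<open>t\<close> is in the kernel as well, and hence so is every skew derivative of \<open>t v\<close>.
\<close>

lemma F_rmult_kernel:
  assumes "t \<in> TA" "F t = 0"
  shows "F (rmult v t) = 0"
proof -
  obtain d where "t \<in> below d" using TA_below assms by blast
  then show ?thesis using assms
  proof (induction d arbitrary: t v)
    case 0
    then have "rmult v t = 0" using below_0 tlinear_rules(4)[OF tlinear_tensor_mult(1)] by metis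
    then show ?case by (simp only: F_0)
  next
    case (Suc d)
    have zero: "F (rmult (x j) t) = 0" if j: "j \<in> {1..n}" for j
    proof (rule F_kernel[OF rmult_TA[OF Suc.prems(2)] rmult_Nil])
      fix i assume i: "i \<in> {1..n}"
      have skew_deriv: "skew_deriv i t \<in> TA" "skew_deriv i t \<in> below d" using skew_deriv_TA skew_deriv_below Suc.prems by auto
      have "F (skew_deriv i t) = 0"
        using contract_F[OF i Suc.prems(2)] Suc.prems(3) tlinear_rules(4)[OF tlinear_contract] by metis
      then have "F (rmult (g i (x j)) (skew_deriv i t)) = 0" using Suc.IH skew_deriv by blast
      moreover have "F (if i = j then t else 0) = 0"
        by (cases "i = j") (simp_all only: refl if_True if_False Suc.prems(3) F_0)
      moreover have "(if i = j then t else 0) \<in> TA" using Suc.prems(2) tensor.subspace_0[OF subspace_TA] by metis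
      ultimately show "F (skew_deriv i (rmult (x j) t)) = 0"
        unfolding skew_deriv_rmult[OF i j Suc.prems(2)]
        using linear_on_add[OF linear_F _ rmult_TA[OF skew_deriv(1)]] by (simp only: add_0_left)
    qed
    have "F (rmult v t) = (\<Sum>i=1..n. tscale (\<xi> i v) (F (rmult (x i) t)))"
      by (rule F_rmult_expand[OF Suc.prems(2)])
    also have "\<dots> = 0"
    proof (rule sum.neutral, rule ballI)
      fix i assume i: "i \<in> {1..n}"
      show "tscale (\<xi> i v) (F (rmult (x i) t)) = 0"
        unfolding zero[OF i] by (rule tensor.scale_zero_right)
    qed
    finally show ?case .
  qed
qed

lemma F_diff:
  assumes "s \<in> TA" "t \<in> TA"
  shows "F (s - t) = F s - F t"
proof -
  have "F (tscale (-1) t + s) = tscale (-1) (F t) + F s"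
    unfolding linear_on_add[OF linear_F tensor.subspace_scale[OF subspace_TA assms(2)] assms(1)]
      linear_on_scale[OF linear_F assms(2)] ..
  moreover have "tscale (-1) u + v = v - u" for u v :: "('k, 'v) tensor"
    by (auto simp: tscale_def fun_eq_iff)
  ultimately show ?thesis by metis
qed

abbreviation NA :: "('k, 'v) tensor set" where
  "NA \<equiv> nichols_algebra scale c"

lemma F_NA: "t \<in> TA \<Longrightarrow> F t \<in> NA"
  unfolding nichols_algebra_def by (rule imageI)

lemma NA_cases:
  assumes "b \<in> NA"
  obtains t where "t \<in> TA" "b = F t"
  using assms unfolding nichols_algebra_def by blast

lemma subspace_NA: "tensor.subspace NA"
  unfolding tensor.subspace_def
proof (intro conjI ballI allI)
  show "0 \<in> NA" using F_NA[OF tensor.subspace_0[OF subspace_TA]] unfolding F_0 .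
  fix u assume "u \<in> NA"
  then obtain s where s: "s \<in> TA" "u = F s" by (rule NA_cases)
  show "tscale a u \<in> NA" for a
    unfolding s(2) linear_on_scale[OF linear_F s(1), symmetric]
    by (rule F_NA[OF tensor.subspace_scale[OF subspace_TA s(1)]])
  fix v assume "v \<in> NA"
  then obtain t where t: "t \<in> TA" "v = F t" by (rule NA_cases)
  show "u + v \<in> NA"
    unfolding s(2) t(2) linear_on_add[OF linear_F s(1) t(1), symmetric]
    by (rule F_NA[OF tensor.subspace_add[OF subspace_TA s(1) t(1)]])
qed

text \<open>
  Multiplication by \<open>x\<^sub>j\<close> computed on a representative; off the Nichols algebra its values are arbitrary, and
  \<open>R\<close> below replaces them by those of a linear map.
\<close>

definition R0 :: "nat \<Rightarrow> ('k, 'v) tensor \<Rightarrow> ('k, 'v) tensor" where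
  "R0 j b = F (rmult (x j) (SOME t. t \<in> TA \<and> F t = b))"

lemma R0_F:
  assumes "t \<in> TA"
  shows "R0 j (F t) = F (rmult (x j) t)"
proof -
  define s where "s = (SOME s. s \<in> TA \<and> F s = F t)"
  have s: "s \<in> TA" "F s = F t" using someI_ex[of "\<lambda>s. s \<in> TA \<and> F s = F t"] assms by (auto simp: s_def)
  have st: "s - t \<in> TA" using s assms by (intro tensor.subspace_diff subspace_TA)
  have "F (s - t) = 0" unfolding F_diff[OF s(1) assms] s(2) by (rule diff_self)
  then have "F (rmult (x j) (s - t)) = 0" by (rule F_rmult_kernel[OF st])
  then have "F (rmult (x j) s) - F (rmult (x j) t) = 0"
    unfolding tlinear_rules(2)[OF tlinear_tensor_mult(1)] F_diff[OF rmult_TA[OF s(1)] rmult_TA[OF assms]] .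
  then show ?thesis unfolding R0_def s_def[symmetric] by (rule right_minus_eq[THEN iffD1])
qed

lemma linear_R0: "linear_on NA (R0 j)"
  unfolding linear_on_def
proof (intro conjI allI ballI)
  fix u v assume "u \<in> NA" "v \<in> NA"
  then obtain s t where st: "s \<in> TA" "t \<in> TA" "u = F s" "v = F t"
    unfolding nichols_algebra_def by blast
  show "R0 j (u + v) = R0 j u + R0 j v"
    unfolding st(3,4) linear_on_add[OF linear_F st(1,2), symmetric] R0_F[OF st(1)] R0_F[OF st(2)]
      R0_F[OF tensor.subspace_add[OF subspace_TA st(1,2)]] tensor_mult_linear(1)
    by (rule linear_on_add[OF linear_F rmult_TA[OF st(1)] rmult_TA[OF st(2)]])
next
  fix a u assume "u \<in> NA"
  then obtain s where st: "s \<in> TA" "u = F s" by (rule NA_cases)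
  show "R0 j (tscale a u) = tscale a (R0 j u)"
    unfolding st(2) linear_on_scale[OF linear_F st(1), symmetric] R0_F[OF st(1)]
      R0_F[OF tensor.subspace_scale[OF subspace_TA st(1)]] tensor_mult_linear(2)
    by (rule linear_on_scale[OF linear_F rmult_TA[OF st(1)]])
qed

definition basis_NA :: "('k, 'v) tensor set" where
  "basis_NA = (SOME C. tensor.independent C \<and> tensor.span C = NA)"

lemma basis_NA: "tensor.independent basis_NA" "tensor.span basis_NA = NA"
proof -
  obtain C where C: "C \<subseteq> NA" "tensor.independent C" "NA \<subseteq> tensor.span C"
    by (rule tensor.maximal_independent_subset)
  have "tensor.independent C \<and> tensor.span C = NA"
    using C(2,3) tensor.span_minimal[OF C(1) subspace_NA] by simp
  then have "tensor.independent basis_NA \<and> tensor.span basis_NA = NA"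
    unfolding basis_NA_def by (rule someI)
  then show "tensor.independent basis_NA" "tensor.span basis_NA = NA" by simp_all
qed

definition R :: "nat \<Rightarrow> ('k, 'v) tensor \<Rightarrow> ('k, 'v) tensor" where
  "R j = tt.construct basis_NA (R0 j)"

lemma tlinear_R: "tlinear (R j)"
  unfolding R_def by (rule tt.linear_construct[OF basis_NA(1)])

lemma R_F:
  assumes "t \<in> TA"
  shows "R j (F t) = F (rmult (x j) t)"
proof -
  have "R j (F t) = R0 j (F t)"
  proof (rule linear_on_eq[where f = "R j" and h = "R0 j" and t = "F t" and X = basis_NA])
    show "linear_on (tensor.span basis_NA) (R j)" by (rule tlinear_imp_linear_on[OF tlinear_R])
    show "linear_on (tensor.span basis_NA) (R0 j)" using linear_R0 by (simp only: basis_NA)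
    show "F t \<in> tensor.span basis_NA" using F_NA[OF assms] by (simp only: basis_NA)
  qed (simp add: R_def tt.construct_basis[OF basis_NA(1)])
  then show ?thesis using R0_F[OF assms] by simp
qed

definition G :: "nat \<Rightarrow> nat \<Rightarrow> nat \<Rightarrow> 'k" where
  "G i l j = \<xi> l (g i (x j))"

lemma below_vanishes:
  assumes "t \<in> below d"
  shows "vanishes_from d t"
  using assms unfolding below_def
proof (induction rule: tensor.span_induct_alt)
  case (step a u v)
  then obtain js where "u = word js" "length js < d" by auto
  then show ?case using step.IH by (auto simp: vanishes_from_def tscale_def word_def pure_eq_0)
qed (simp add: vanishes_from_def)

lemma contract_R_F:
  assumes "i \<in> {1..n}" "j \<in> {1..n}" "b \<in> NA"
  shows "contract (\<xi> i) (R j b) = (if i = j then b else 0) + (\<Sum>l=1..n. tscale (G i l j) (R l (contract (\<xi> i) b)))"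
proof -
  obtain t where t: "t \<in> TA" "b = F t" by (rule NA_cases[OF assms(3)])
  have skew_deriv: "skew_deriv i t \<in> TA" by (rule skew_deriv_TA[OF t(1)])
  have "contract (\<xi> i) (R j b) = F (skew_deriv i (rmult (x j) t))"
    unfolding t(2) R_F[OF t(1)] by (rule contract_F[OF assms(1) rmult_TA[OF t(1)]])
  also have "\<dots> = F (if i = j then t else 0) + F (rmult (g i (x j)) (skew_deriv i t))"
    unfolding skew_deriv_rmult[OF assms(1,2) t(1)]
  proof (rule linear_on_add[OF linear_F])
    show "(if i = j then t else 0) \<in> TA" using t(1) tensor.subspace_0[OF subspace_TA] by metis
  qed (rule rmult_TA[OF skew_deriv])
  also have "F (if i = j then t else 0) = (if i = j then b else 0)" using t(2) F_0 by metis
  also have "F (rmult (g i (x j)) (skew_deriv i t)) = (\<Sum>l=1..n. tscale (G i l j) (F (rmult (x l) (skew_deriv i t))))"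
    unfolding G_def by (rule F_rmult_expand[OF skew_deriv])
  finally show ?thesis unfolding t(2) contract_F[OF assms(1) t(1)] R_F[OF skew_deriv] .
qed

end

section \<open>Nichols algebras as algebras with skew derivations\<close>

text \<open>
  The rank is 0 by convention if the Nichols algebra is infinite-dimensional, so a nonzero rank makes it
  finite-dimensional.
\<close>

locale finite_rank_braiding = group_type_braiding scale c n x g
  for scale :: "'k::field_char_0 \<Rightarrow> 'v::ab_group_add \<Rightarrow> 'v" and c n x g +
  assumes rank_nonzero: "nichols_rank scale c \<noteq> 0"
begin

lemma finite_basis_NA: "finite basis_NA"
proof -
  have "tensor.dim (tensor.span basis_NA) = card basis_NA"
    by (rule tensor.dim_span_eq_card_independent[OF basis_NA(1)])
  then have "card basis_NA = nichols_rank scale c"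
    unfolding basis_NA(2) nichols_rank_def by (rule sym)
  then show ?thesis using rank_nonzero card.infinite[of basis_NA] by linarith
qed

lemma NA_TA: "NA \<subseteq> TA"
  unfolding nichols_algebra_def using F_TA by blast

lemma NA_bounded: "\<exists>m. \<forall>b\<in>NA. vanishes_from m b"
proof -
  have "\<exists>m. \<forall>b\<in>C. vanishes_from m b" if "finite C" "C \<subseteq> NA" for C
    using that
  proof (induction C)
    case (insert b C)
    then obtain m where m: "\<forall>b\<in>C. vanishes_from m b" by auto
    obtain d where "b \<in> below d" using TA_below insert.prems NA_TA by blast
    then have "vanishes_from d b" by (rule below_vanishes)
    then have "\<forall>b\<in>insert b C. vanishes_from (max m d) b" using m by (auto simp: vanishes_from_def)
    then show ?case by blast
  qed simp
  then obtain m where m: "\<forall>b\<in>basis_NA. vanishes_from m b"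
    using finite_basis_NA tensor.span_superset[of basis_NA] unfolding basis_NA(2) by blast
  have "vanishes_from m b" if "b \<in> NA" for b
    using that unfolding basis_NA(2)[symmetric]
  proof (induction rule: tensor.span_induct_alt)
    case (step a u v)
    then show ?case using m by (auto simp: vanishes_from_def tscale_def)
  qed (simp add: vanishes_from_def)
  then show ?thesis by blast
qed

lemma F_word_snoc: "F (word (js @ [j])) = R j (F (word js))"
  using R_F[OF word_TA, of j js] by (simp add: word_def tensor_mult_pure)

sublocale nichols: nichols_calculus NA n \<xi> R G
proof (rule nichols_calculus.intro)
  show "tensor.subspace NA" by (rule subspace_NA)
  show "\<exists>A. finite A \<and> NA \<subseteq> tensor.span A"
    by (intro exI[of _ basis_NA] conjI finite_basis_NA) (simp only: basis_NA(2) order_refl)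
  show "unit_tensor \<in> NA"
    using F_NA[OF word_TA[of "[]"]] by (simp add: word_Nil F_unit)
  show "tlinear (R j)" for j by (rule tlinear_R)
  show "R j b \<in> NA" if "b \<in> NA" for j b
    using that by (rule NA_cases) (simp add: R_F F_NA rmult_TA)
  show "contract (\<xi> i) b \<in> NA" if "i \<in> {1..n}" "b \<in> NA" for i b
    using that(2) by (rule NA_cases) (simp add: contract_F[OF that(1)] F_NA skew_deriv_TA)
  show "contract (\<xi> i) (R j b) = (if i = j then b else 0) + (\<Sum>l=1..n. tscale (G i l j) (R l (contract (\<xi> i) b)))"
    if "i \<in> {1..n}" "j \<in> {1..n}" "b \<in> NA" for i j b
    using that by (rule contract_R_F)
  show "R j b [] = 0" if "b \<in> NA" for j b
    using that by (rule NA_cases) (simp add: R_F F_Nil rmult_TA rmult_Nil)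
  show "\<exists>m. \<forall>b\<in>NA. vanishes_from m b" by (rule NA_bounded)
  show "b = 0" if "b \<in> NA" "b [] = 0" "\<And>i. i \<in> {1..n} \<Longrightarrow> contract (\<xi> i) b = 0" for b
    by (rule TA_separated[OF subsetD[OF NA_TA that(1)] that(2,3)])
  show "NA \<subseteq> S" if S: "tensor.subspace S" "unit_tensor \<in> S"
    "\<And>j b. j \<in> {1..n} \<Longrightarrow> b \<in> S \<Longrightarrow> b \<in> NA \<Longrightarrow> R j b \<in> S" for S
  proof
    fix b assume "b \<in> NA"
    then obtain t where t: "t \<in> TA" "b = F t" by (rule NA_cases)
    have "F (word js) \<in> S" if "set js \<subseteq> {1..n}" for js
      using that
    proof (induction js rule: rev_induct)
      case Nil
      then show ?case using S(2) by (simp add: word_Nil F_unit)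
    next
      case (snoc j js)
      then show ?case using S(3) F_NA[OF word_TA] by (simp add: F_word_snoc)
    qed
    then show "b \<in> S" unfolding t(2) by (intro TA_image[OF linear_F S(1) _ t(1)])
  qed
qed

end

locale diagonal_type_braiding = group_type_braiding scale c n x g
  for scale :: "'k::field \<Rightarrow> 'v::ab_group_add \<Rightarrow> 'v" and c n x g +
  fixes q :: "nat \<Rightarrow> nat \<Rightarrow> 'k"
  assumes g_x: "i \<in> {1..n} \<Longrightarrow> j \<in> {1..n} \<Longrightarrow> g i (x j) = scale (q i j) (x j)"
begin

lemma q_nonzero:
  assumes "i \<in> {1..n}" "j \<in> {1..n}"
  shows "q i j \<noteq> 0"
proof
  assume "q i j = 0"
  then have "g i (x j) = 0" using g_x[OF assms] by simp
  moreover have "g i 0 = 0"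
    using linear_g[OF assms(1)] by (simp add: linear_iff_module_hom module_hom.zero)
  ultimately have "x j = 0" using bij_g[OF assms(1)] by (metis bij_is_inj injD)
  then show False using x_nonzero[OF assms(2)] by simp
qed

lemma G_diagonal: "i \<in> {1..n} \<Longrightarrow> l \<in> {1..n} \<Longrightarrow> j \<in> {1..n} \<Longrightarrow> G i l j = (if l = j then q i j else 0)"
  by (auto simp: G_def g_x dual.linear_scale[OF linear_\<xi>] \<xi>_x)

lemma diagonal_braiding_q: "diagonal_braiding scale c n x q"
  unfolding diagonal_braiding_def
proof (intro conjI ballI)
  fix i j assume ij: "i \<in> {1..n}" "j \<in> {1..n}"
  have "pure scale [scale (q i j) (x j), x i] = tscale (q i j) (pure scale [x j, x i])"
    using pure_linear_entry[OF vector_space_scale, of "[]" "q i j" "x j" 0 "[x i]"]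
      pure_linear_entry[OF vector_space_scale, of "[]" 1 0 0 "[x i]"]
    by (simp add: tensor.scale_one)
  then show "c (pure scale [x i, x j]) = tscale (q i j) (pure scale [x j, x i])"
    using braids_x[OF ij(1)] g_x[OF ij] by (simp add: braids_by_def)
qed (use basis q_nonzero in auto)

text \<open>
  The diagonal action of \<open>g\<^sub>i\<close> on tensors, expressed on the arguments; see \<open>group_act_pure\<close>.
\<close>

definition group_act :: "nat \<Rightarrow> ('k, 'v) tensor \<Rightarrow> ('k, 'v) tensor" where
  "group_act i t = (\<lambda>fs. t (map (\<lambda>f. f \<circ> g i) fs))"

abbreviation lmult :: "nat \<Rightarrow> ('k, 'v) tensor \<Rightarrow> ('k, 'v) tensor" where
  "lmult i t \<equiv> tensor_mult (pure scale [x i]) t"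

lemma tlinear_group_act: "tlinear (group_act i)"
  by (rule tlinearI) (auto simp: group_act_def tscale_def fun_eq_iff)

text \<open>
  As \<open>g\<^sub>i\<close> is invertible, composition with it preserves and reflects linearity of the arguments.
\<close>

lemma group_act_pure:
  assumes i: "i \<in> {1..n}"
  shows "group_act i (pure scale vs) = pure scale (map (g i) vs)"
proof -
  have lin: "Vector_Spaces.linear scale (*) (f \<circ> g i) \<longleftrightarrow> Vector_Spaces.linear scale (*) f" for f :: "'v \<Rightarrow> 'k"
  proof
    assume f: "Vector_Spaces.linear scale (*) (f \<circ> g i)"
    interpret gg: vector_space_pair scale scale ..
    obtain h where h: "Vector_Spaces.linear scale scale h" "h \<circ> g i = id"
      using gg.linear_injective_left_inverse[OF linear_g[OF i]] bij_g[OF i] by (auto simp: bij_def)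
    have "g i \<circ> h = id" using h(2) bij_g[OF i]
      by (metis bij_is_surj comp_assoc comp_id fun.map_id surj_iff inv_unique_comp)
    then have "f = (f \<circ> g i) \<circ> h" by (simp add: comp_assoc)
    then show "Vector_Spaces.linear scale (*) f" using Vector_Spaces.linear_compose[OF h(1) f] by simp
  next
    assume "Vector_Spaces.linear scale (*) f"
    then show "Vector_Spaces.linear scale (*) (f \<circ> g i)" by (rule Vector_Spaces.linear_compose[OF linear_g[OF i]])
  qed
  have "pure scale vs (map (\<lambda>f. f \<circ> g i) fs) = pure scale (map (g i) vs) fs" for fs
    by (auto simp: pure_def lin)
  then show ?thesis by (simp add: group_act_def fun_eq_iff)
qed

lemma group_act_TA: "i \<in> {1..n} \<Longrightarrow> t \<in> TA \<Longrightarrow> group_act i t \<in> TA"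
  by (rule TA_image[OF tlinear_imp_linear_on[OF tlinear_group_act] subspace_TA])
    (auto simp: group_act_pure word_def pure_TA)

lemma lmult_TA: "t \<in> TA \<Longrightarrow> lmult i t \<in> TA"
  by (rule TA_image[OF tlinear_imp_linear_on[OF tlinear_tensor_mult(2)] subspace_TA])
    (auto simp: word_def tensor_mult_pure pure_TA)

lemma lmult_word: "lmult j (word js) = word (j # js)"
  by (simp add: word_def tensor_mult_pure)

lemma group_act_word_Cons:
  assumes "i \<in> {1..n}" "j \<in> {1..n}"
  shows "group_act i (word (j # js)) = tscale (q i j) (lmult j (group_act i (word js)))"
proof -
  have "pure scale ([] @ (scale (q i j) (x j) + 0) # map (g i) (map x js)) =
      tscale (q i j) (pure scale ([] @ x j # map (g i) (map x js))) + pure scale ([] @ 0 # map (g i) (map x js))"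
    by (rule pure_linear_entry[OF vector_space_scale])
  moreover have "pure scale ([] @ 0 # vs) = 0" for vs
    using pure_linear_entry[OF vector_space_scale, of "[]" 1 0 0 vs] by (simp add: tensor.scale_one)
  ultimately show ?thesis
    using assms by (simp add: word_def group_act_pure g_x tensor_mult_pure)
qed

lemma group_act_lmult:
  assumes "i \<in> {1..n}" "j \<in> {1..n}" "t \<in> TA"
  shows "group_act i (lmult j t) = tscale (q i j) (lmult j (group_act i t))"
proof (rule TA_eqI[where f = "\<lambda>t. group_act i (lmult j t)" and h = "\<lambda>t. tscale (q i j) (lmult j (group_act i t))"])
  show "linear_on TA (\<lambda>t. group_act i (lmult j t))" "linear_on TA (\<lambda>t. tscale (q i j) (lmult j (group_act i t)))"
    by (auto simp: linear_on_def tlinear_rules[OF tlinear_group_act] tensor_mult_linear tensor.scale_right_distrib mult.commute)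
  show "group_act i (lmult j (word js)) = tscale (q i j) (lmult j (group_act i (word js)))" for js
    using assms by (simp only: lmult_word group_act_word_Cons)
qed (rule assms)

lemma group_act_commute:
  assumes "i \<in> {1..n}" "k \<in> {1..n}" "t \<in> TA"
  shows "group_act i (group_act k t) = group_act k (group_act i t)"
proof (rule TA_eqI[where f = "\<lambda>t. group_act i (group_act k t)" and h = "\<lambda>t. group_act k (group_act i t)"])
  show "linear_on TA (\<lambda>t. group_act i (group_act k t))" "linear_on TA (\<lambda>t. group_act k (group_act i t))"
    by (auto simp: linear_on_def tlinear_rules[OF tlinear_group_act])
  fix js assume "set js \<subseteq> {1..n}"
  then show "group_act i (group_act k (word js)) = group_act k (group_act i (word js))"
  proof (induction js)
    case Nil
    then show ?case using assms by (simp add: word_def group_act_pure)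
  next
    case (Cons j js)
    then have j: "j \<in> {1..n}" and IH: "group_act i (group_act k (word js)) = group_act k (group_act i (word js))" by auto
    have "group_act i (group_act k (word (j # js))) = tscale (q i j * q k j) (lmult j (group_act i (group_act k (word js))))" if "i \<in> {1..n}" "k \<in> {1..n}" for i k
      using that j by (simp add: group_act_word_Cons tlinear_rules[OF tlinear_group_act] group_act_lmult group_act_TA word_TA mult.commute)
    then show ?case using assms IH by (simp add: mult.commute)
  qed
qed (rule assms)

lemma word_deriv_Cons:
  "word_deriv i (j # js) = (if i = j then pure scale (map (g i) (map x js)) else 0) + lmult j (word_deriv i js)"
proof -
  have "word_deriv i (j # js) = (if j = i then pure scale (map (g i) (map x js)) else 0) +
     (\<Sum>a<length js. if js ! a = i then pure scale (x j # map x (take a js) @ map (g i) (map x (drop (Suc a) js))) else 0)"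
    unfolding word_deriv_def length_Cons sum.lessThan_Suc_shift
    by (rule arg_cong2[where f = "(+)"], simp, rule sum.cong) auto
  also have "(\<Sum>a<length js. if js ! a = i then pure scale (x j # map x (take a js) @ map (g i) (map x (drop (Suc a) js))) else 0) =
     lmult j (word_deriv i js)"
    unfolding word_deriv_def tlinear_sum[OF tlinear_tensor_mult(2)]
  proof (rule sum.cong)
    fix a
    show "(if js ! a = i then pure scale (x j # map x (take a js) @ map (g i) (map x (drop (Suc a) js))) else 0) =
      lmult j (if js ! a = i then delete_letter i js a else 0)"
      by (cases "js ! a = i")
        (simp_all only: refl if_True if_False tensor_mult_pure tlinear_rules[OF tlinear_tensor_mult(2)] append_Cons append_Nil)
  qed simp
  finally show ?thesis unfolding eq_commute[of j i] .
qed

lemma skew_deriv_lmult: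
  assumes "i \<in> {1..n}" "j \<in> {1..n}" "t \<in> TA"
  shows "skew_deriv i (lmult j t) = (if i = j then group_act i t else 0) + lmult j (skew_deriv i t)"
proof (rule TA_eqI[where f = "\<lambda>t. skew_deriv i (lmult j t)" and h = "\<lambda>t. (if i = j then group_act i t else 0) + lmult j (skew_deriv i t)"])
  show "linear_on TA (\<lambda>t. skew_deriv i (lmult j t))"
    by (auto simp: linear_on_def tlinear_rules[OF tlinear_skew_deriv] tensor_mult_linear)
  show "linear_on TA (\<lambda>t. (if i = j then group_act i t else 0) + lmult j (skew_deriv i t))"
    by (cases "i = j") (auto simp: linear_on_def tlinear_rules[OF tlinear_skew_deriv] tlinear_rules[OF tlinear_group_act]
        tensor_mult_linear tensor.scale_right_distrib add_ac)
  fix js assume js: "set js \<subseteq> {1..n}"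
  have jjs: "set (j # js) \<subseteq> {1..n}" using assms js by simp
  have gw: "group_act i (word js) = pure scale (map (g i) (map x js))"
    unfolding word_def by (rule group_act_pure[OF assms(1)])
  show "skew_deriv i (lmult j (word js)) = (if i = j then group_act i (word js) else 0) + lmult j (skew_deriv i (word js))"
    unfolding lmult_word skew_deriv_word[OF js] skew_deriv_word[OF jjs] word_deriv_Cons gw ..
qed (rule assms)

lemma skew_deriv_group_act:
  assumes "i \<in> {1..n}" "k \<in> {1..n}" "t \<in> TA"
  shows "skew_deriv i (group_act k t) = tscale (q k i) (group_act k (skew_deriv i t))"
proof (rule TA_eqI[where f = "\<lambda>t. skew_deriv i (group_act k t)" and h = "\<lambda>t. tscale (q k i) (group_act k (skew_deriv i t))"])
  show "linear_on TA (\<lambda>t. skew_deriv i (group_act k t))" "linear_on TA (\<lambda>t. tscale (q k i) (group_act k (skew_deriv i t)))"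
    by (auto simp: linear_on_def tlinear_rules[OF tlinear_skew_deriv] tlinear_rules[OF tlinear_group_act]
        tensor.scale_right_distrib mult.commute)
  fix js assume "set js \<subseteq> {1..n}"
  then show "skew_deriv i (group_act k (word js)) = tscale (q k i) (group_act k (skew_deriv i (word js)))"
  proof (induction js)
    case Nil
    have "skew_deriv i (group_act k (word [])) = 0" "skew_deriv i (word []) = 0"
      using assms skew_deriv_word[of "[]" i] by (auto simp: word_def group_act_pure word_deriv_def)
    then show ?case using tlinear_rules(4)[OF tlinear_group_act] by (metis tensor.scale_zero_right)
  next
    case (Cons j js)
    then have j: "j \<in> {1..n}" and IH: "skew_deriv i (group_act k (word js)) = tscale (q k i) (group_act k (skew_deriv i (word js)))" by auto
    note ik = assms(1,2)
    have w: "group_act k (word js) \<in> TA" by (rule group_act_TA[OF ik(2) word_TA])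
    have "skew_deriv i (group_act k (word (j # js))) = tscale (q k j) (skew_deriv i (lmult j (group_act k (word js))))"
      by (simp only: group_act_word_Cons[OF ik(2) j] tlinear_rules[OF tlinear_skew_deriv])
    also have "skew_deriv i (lmult j (group_act k (word js))) =
        (if i = j then group_act i (group_act k (word js)) else 0) + tscale (q k i) (lmult j (group_act k (skew_deriv i (word js))))"
      by (simp only: skew_deriv_lmult[OF ik(1) j w] IH tensor_mult_linear)
    finally have L: "skew_deriv i (group_act k (word (j # js))) = tscale (q k j)
        ((if i = j then group_act i (group_act k (word js)) else 0) + tscale (q k i) (lmult j (group_act k (skew_deriv i (word js)))))" .
    have "skew_deriv i (word (j # js)) = (if i = j then group_act i (word js) else 0) + lmult j (skew_deriv i (word js))"
      using skew_deriv_lmult[OF ik(1) j word_TA, of js] by (simp only: lmult_word)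
    then have "group_act k (skew_deriv i (word (j # js))) =
        (if i = j then group_act k (group_act i (word js)) else 0) + tscale (q k j) (lmult j (group_act k (skew_deriv i (word js))))"
      using group_act_lmult[OF ik(2) j skew_deriv_TA[OF word_TA], of i js]
      by (cases "i = j") (simp_all only: refl if_True if_False tlinear_rules[OF tlinear_group_act])
    then have Rr: "tscale (q k i) (group_act k (skew_deriv i (word (j # js)))) = tscale (q k i)
        ((if i = j then group_act k (group_act i (word js)) else 0) + tscale (q k j) (lmult j (group_act k (skew_deriv i (word js)))))"
      by (rule arg_cong)
    show ?case
      unfolding L Rr group_act_commute[OF ik word_TA]
      by (cases "i = j") (simp_all only: refl if_True if_False tensor.scale_right_distrib tensor.scale_scale
          mult.commute add_0_left tensor.scale_zero_right)
  qed
qed (rule assms)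

text \<open>
  The induction of \<open>F_rmult_kernel\<close> for other operators: it suffices that the skew derivatives of \<open>P t\<close> are
  in the kernel whenever \<open>P\<close> maps those of \<open>t\<close> into the kernel.
\<close>

lemma F_kernel_induct:
  assumes P: "tlinear P" "\<And>t. t \<in> TA \<Longrightarrow> P t \<in> TA"
    and Nil: "\<And>t. t \<in> TA \<Longrightarrow> F t = 0 \<Longrightarrow> P t [] = 0"
    and step: "\<And>t i. t \<in> TA \<Longrightarrow> F t = 0 \<Longrightarrow> i \<in> {1..n} \<Longrightarrow> F (P (skew_deriv i t)) = 0 \<Longrightarrow> F (skew_deriv i (P t)) = 0"
    and t: "t \<in> TA" "F t = 0"
  shows "F (P t) = 0"
proof -
  obtain d where "t \<in> below d" using TA_below t by blast
  then show ?thesis using t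
  proof (induction d arbitrary: t)
    case 0
    then have "P t = 0" using below_0 tlinear_rules(4)[OF P(1)] by metis
    then show ?case by (simp only: F_0)
  next
    case (Suc d)
    show ?case
    proof (rule F_kernel[OF P(2)[OF Suc.prems(2)] Nil[OF Suc.prems(2,3)]])
      fix i assume i: "i \<in> {1..n}"
      have "F (skew_deriv i t) = 0"
        using contract_F[OF i Suc.prems(2)] unfolding Suc.prems(3) tlinear_rules(4)[OF tlinear_contract] by simp
      then have "F (P (skew_deriv i t)) = 0"
        by (rule Suc.IH[OF skew_deriv_below[OF Suc.prems(1)] skew_deriv_TA[OF Suc.prems(2)]])
      then show "F (skew_deriv i (P t)) = 0" by (rule step[OF Suc.prems(2,3) i])
    qed
  qed
qed

lemma F_group_act_kernel:
  assumes k: "k \<in> {1..n}" and t: "t \<in> TA" "F t = 0"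
  shows "F (group_act k t) = 0"
proof (rule F_kernel_induct[OF tlinear_group_act group_act_TA[OF k] _ _ t])
  fix t assume t: "t \<in> TA" "F t = 0"
  have "t [] = 0" using F_Nil[OF t(1)] t(2) by simp
  then show "group_act k t [] = 0" by (simp add: group_act_def)
  fix i assume i: "i \<in> {1..n}" and "F (group_act k (skew_deriv i t)) = 0"
  then show "F (skew_deriv i (group_act k t)) = 0"
    unfolding skew_deriv_group_act[OF i k t(1)] linear_on_scale[OF linear_F group_act_TA[OF k skew_deriv_TA[OF t(1)]]]
    by (simp only: tensor.scale_zero_right)
qed

lemma F_lmult_kernel:
  assumes j: "j \<in> {1..n}" and t: "t \<in> TA" "F t = 0"
  shows "F (lmult j t) = 0"
proof (rule F_kernel_induct[OF tlinear_tensor_mult(2) lmult_TA _ _ t])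
  fix t assume t: "t \<in> TA" "F t = 0"
  show "lmult j t [] = 0" by (simp add: tensor_mult_def pure_simps)
  fix i assume i: "i \<in> {1..n}" and *: "F (lmult j (skew_deriv i t)) = 0"
  have m: "(if i = j then group_act i t else 0) \<in> TA"
    using group_act_TA[OF i t(1)] tensor.subspace_0[OF subspace_TA] by metis
  have "F (if i = j then group_act i t else 0) = 0"
    by (cases "i = j") (simp_all only: refl if_True if_False F_0 F_group_act_kernel[OF j t])
  then show "F (skew_deriv i (lmult j t)) = 0"
    unfolding skew_deriv_lmult[OF i j t(1)] linear_on_add[OF linear_F m lmult_TA[OF skew_deriv_TA[OF t(1)]]] *
    by (simp only: add_0_left)
qed

lemma braid_past_T:
  assumes "t \<in> T (Suc m)"
  shows "braid_past c t = braid_word c (last_cycle m 0) t"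
proof -
  have letters: "set (last_cycle (k - 1) 0) \<subseteq> {i. Suc i < k}" for k by (auto simp: last_cycle_def)
  have "braid_past c t = (\<lambda>fs. braid_word c (last_cycle (length fs - 1) 0) (degree_part (length fs) t) fs)"
    by (simp add: braid_past_def braid_word_def last_cycle_def foldr_conv_fold)
  also have "\<dots> = braid_word c (last_cycle (Suc m - 1) 0) t"
    by (rule graded_map_T[where f = "\<lambda>k. braid_word c (last_cycle (k - 1) 0)"])
      (use linear_braid_word[OF letters] braid_word_T[OF letters[of "Suc m"]] assms in auto)
  finally show ?thesis by simp
qed

lemma linear_braid_past: "linear_on TA (braid_past c)"
proof -
  have letters: "set (last_cycle (k - 1) 0) \<subseteq> {i. Suc i < k}" for k by (auto simp: last_cycle_def)
  have "braid_past c = (\<lambda>t fs. braid_word c (last_cycle (length fs - 1) 0) (degree_part (length fs) t) fs)"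
    by (simp add: braid_past_def[abs_def] braid_word_def last_cycle_def foldr_conv_fold)
  then show ?thesis
    using graded_map_linear[of "\<lambda>k. braid_word c (last_cycle (k - 1) 0)"] linear_braid_word[OF letters] by simp
qed

lemma braid_past_lmult:
  assumes i: "i \<in> {1..n}" and t: "t \<in> TA"
  shows "braid_past c (lmult i t) = rmult (x i) (group_act i t)"
proof (rule TA_eqI[where f = "\<lambda>t. braid_past c (lmult i t)" and h = "\<lambda>t. rmult (x i) (group_act i t)"])
  show "linear_on TA (\<lambda>t. braid_past c (lmult i t))"
    by (rule linear_on_compose[OF tlinear_imp_linear_on[OF tlinear_tensor_mult(2)] _ linear_braid_past])
      (auto simp: lmult_TA)
  show "linear_on TA (\<lambda>t. rmult (x i) (group_act i t))"
    by (auto simp: linear_on_def tlinear_rules[OF tlinear_group_act] tensor_mult_linear)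
  fix js assume js: "set js \<subseteq> {1..n}"
  have "word (i # js) \<in> T (Suc (length js))" using word_T[of "i # js"] js i by simp
  then have "braid_past c (word (i # js)) = braid_word c (last_cycle (length js) 0) (word (i # js))"
    by (rule braid_past_T)
  also have "\<dots> = pure scale (map (g i) (map x js) @ [x i])"
    using braid_word_last_cycle[OF braids_x[OF i], of "[]" 0 "map x js" "[]"] by (simp add: word_def)
  finally show "braid_past c (lmult i (word js)) = rmult (x i) (group_act i (word js))"
    using i by (simp add: lmult_word) (simp add: word_def group_act_pure tensor_mult_pure)
qed (rule t)

lemma tensor_Ad_eq:
  "i \<in> {1..n} \<Longrightarrow> t \<in> TA \<Longrightarrow> tensor_Ad scale c (x i) t = lmult i t - rmult (x i) (group_act i t)"
  by (simp only: tensor_Ad_def braid_past_lmult)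

lemma tensor_Ad_TA: "i \<in> {1..n} \<Longrightarrow> t \<in> TA \<Longrightarrow> tensor_Ad scale c (x i) t \<in> TA"
  unfolding tensor_Ad_eq by (intro tensor.subspace_diff subspace_TA lmult_TA rmult_TA group_act_TA)

text \<open>
  The kernel of the Nichols map is stable under \<open>g\<^sub>i\<close> and under multiplication by \<open>x\<^sub>i\<close> from both sides, so the
  choice of a representative in \<open>nichols_Ad\<close> does not matter.
\<close>

lemma nichols_Ad_F:
  assumes i: "i \<in> {1..n}" and t: "t \<in> TA"
  shows "nichols_Ad scale c (x i) (F t) = F (tensor_Ad scale c (x i) t)"
proof -
  define s where "s = (SOME s. s \<in> tensor_algebra scale \<and> F s = F t)"
  have s: "s \<in> TA" "F s = F t" using someI_ex[of "\<lambda>s. s \<in> TA \<and> F s = F t"] t by (auto simp: s_def)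
  let ?d = "s - t"
  have d: "?d \<in> TA" using s t by (intro tensor.subspace_diff subspace_TA)
  have Fd: "F ?d = 0" unfolding F_diff[OF s(1) t] s(2) by (rule diff_self)
  have "tensor_Ad scale c (x i) ?d = tensor_Ad scale c (x i) s - tensor_Ad scale c (x i) t"
    unfolding tensor_Ad_eq[OF i s(1)] tensor_Ad_eq[OF i t] tensor_Ad_eq[OF i d]
    by (simp add: tlinear_rules[OF tlinear_group_act] tlinear_rules(2)[OF tlinear_tensor_mult(1)]
        tlinear_rules(2)[OF tlinear_tensor_mult(2)])
  moreover have "F (tensor_Ad scale c (x i) ?d) = 0"
    unfolding tensor_Ad_eq[OF i d] F_diff[OF lmult_TA[OF d] rmult_TA[OF group_act_TA[OF i d]]]
      F_lmult_kernel[OF i d Fd] F_rmult_kernel[OF group_act_TA[OF i d] F_group_act_kernel[OF i d Fd]]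
    by (rule diff_self)
  ultimately have "F (tensor_Ad scale c (x i) s) - F (tensor_Ad scale c (x i) t) = 0"
    using F_diff[OF tensor_Ad_TA[OF i s(1)] tensor_Ad_TA[OF i t]] by simp
  then have "F (tensor_Ad scale c (x i) s) = F (tensor_Ad scale c (x i) t)"
    by (rule right_minus_eq[THEN iffD1])
  then show ?thesis unfolding nichols_Ad_def s_def .
qed

end

section \<open>The adjoint action and the grading by the group\<close>

context diagonal_type_braiding
begin

lemma tensor_Ad_word:
  assumes "i \<in> {1..n}" "j \<in> {1..n}"
  shows "tensor_Ad scale c (x i) (word [j]) = word [i, j] - tscale (q i j) (word [j, i])"
proof -
  have g: "group_act i (word [j]) = tscale (q i j) (word [j])"
    using group_act_word_Cons[OF assms, of "[]"] assms by (simp add: word_def group_act_pure tensor_mult_pure)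
  show ?thesis unfolding tensor_Ad_eq[OF assms(1) word_TA] g
    by (simp add: word_def tensor_mult_linear tensor_mult_pure)
qed

text \<open>
  The tensor \<open>z\<close> represents \<open>Ad x\<^sub>i (x\<^sub>j)\<close>; its skew derivative \<open>\<delta>\<^sub>j z = (1 - q\<^sub>i\<^sub>j q\<^sub>j\<^sub>i) x\<^sub>i\<close> is not zero.  The tensor
  \<open>y\<close> represents \<open>Ad x\<^sub>i\<^sup>2 (x\<^sub>j)\<close>.  Here \<open>\<delta>\<^sub>i y\<close> vanishes identically, and \<open>\<delta>\<^sub>j y\<close> is \<open>x\<^sub>i\<^sup>2\<close> times
  \<open>(1 - q\<^sub>i\<^sub>j q\<^sub>j\<^sub>i)(1 - q\<^sub>i\<^sub>i q\<^sub>i\<^sub>j q\<^sub>j\<^sub>i)\<close>.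
\<close>

lemma type_A2_vanishing:
  assumes i: "i \<in> {1..n}" and j: "j \<in> {1..n}" and ij: "i \<noteq> j"
    and s: "q i j * q j i \<noteq> 1" and r: "q i i * (q i j * q j i) = 1"
    and n: "{1..n} = {i, j}"
  shows "has_nilpotency_order (nichols_Ad scale c (x i)) (pure scale [x j]) 2"
proof -
  let ?T = "nichols_Ad scale c (x i)"
  define z where "z = word [i, j] - tscale (q i j) (word [j, i])"
  define y where "y = tensor_Ad scale c (x i) z"
  have z: "z \<in> TA" unfolding z_def by (intro tensor.subspace_diff tensor.subspace_scale subspace_TA word_TA)
  have y: "y \<in> TA" unfolding y_def by (rule tensor_Ad_TA[OF i z])
  have T1: "?T (pure scale [x j]) = F z"
  proof -
    have "pure scale [x j] = F (word [j])" using F_short[of "[j]"] j by (simp add: word_def)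
    then show ?thesis using nichols_Ad_F[OF i word_TA, of "[j]"] tensor_Ad_word[OF i j] by (simp add: z_def)
  qed
  have T2: "?T (F z) = F y" unfolding y_def by (rule nichols_Ad_F[OF i z])
  have gw: "group_act k (word js) = tscale (\<Prod>l\<leftarrow>js. q k l) (word js)" if "k \<in> {1..n}" "set js \<subseteq> {1..n}" for k js
    using that(2)
  proof (induction js)
    case Nil
    then show ?case using that(1) by (simp add: word_def group_act_pure)
  next
    case (Cons l js)
    then show ?case using that(1)
      by (simp add: group_act_word_Cons tensor_mult_linear lmult_word)
  qed
  have rm: "rmult (x k) (word js) = word (js @ [k])" for k js by (simp add: word_def tensor_mult_pure)
  have skew_deriv_Cons: "skew_deriv k (word (l # js)) = (if k = l then group_act k (word js) else 0) + lmult l (skew_deriv k (word js))"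
    if "k \<in> {1..n}" "l \<in> {1..n}" for k l js
    using skew_deriv_lmult[OF that word_TA, of js] by (simp only: lmult_word)
  have skew_deriv_Nil: "skew_deriv k (word []) = 0" for k using skew_deriv_word[of "[]" k] by (simp add: word_deriv_def)
  have lm0: "lmult k 0 = 0" for k by (rule tlinear_rules(4)[OF tlinear_tensor_mult(2)])
  have sdz: "skew_deriv j z = tscale (1 - q i j * q j i) (word [i])"
    unfolding z_def using i j ij
    by (simp add: tlinear_rules[OF tlinear_skew_deriv] skew_deriv_Cons skew_deriv_Nil lm0 gw lmult_word tensor_mult_linear
        tensor.scale_left_diff_distrib)
  have "F z \<noteq> 0"
  proof
    assume "F z = 0"
    then have "F (skew_deriv j z) = 0"
      using contract_F[OF j z] tlinear_rules(4)[OF tlinear_contract] by metis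
    then have "tscale (1 - q i j * q j i) (word [i]) = 0"
      unfolding sdz linear_on_scale[OF linear_F word_TA] using F_short[of "[i]"] i by simp
    then have "word [i] = 0" using s by (simp add: tensor.scale_eq_0_iff)
    then have "word [i] [\<xi> i] = 0" by simp
    then show False using i by (simp add: word_def pure_simps linear_\<xi> \<xi>_x)
  qed
  have y_eq: "y = word [i, i, j] - tscale (q i j) (word [i, j, i]) -
      (tscale (q i i * q i j) (word [i, j, i]) - tscale (q i i * q i j * q i j) (word [j, i, i]))"
  proof -
    have "group_act i z = tscale (q i i * q i j) (word [i, j]) - tscale (q i i * q i j * q i j) (word [j, i])"
    proof -
      have g1: "group_act i (word [i, j]) = tscale (q i i * q i j) (word [i, j])"
        and g2: "group_act i (word [j, i]) = tscale (q i j * q i i) (word [j, i])"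
        using gw[OF i, of "[i, j]"] gw[OF i, of "[j, i]"] i j by simp_all
      have "q i j * (q i j * q i i) = q i i * q i j * q i j" by simp
      then show ?thesis
        unfolding z_def tlinear_rules(2,3)[OF tlinear_group_act] g1 g2 tensor.scale_scale by (simp only:)
    qed
    then have "rmult (x i) (group_act i z) =
        tscale (q i i * q i j) (word [i, j, i]) - tscale (q i i * q i j * q i j) (word [j, i, i])"
      by (simp only: tlinear_rules(2)[OF tlinear_tensor_mult(1)] tensor_mult_linear rm append_Cons append_Nil)
    moreover have "lmult i z = word [i, i, j] - tscale (q i j) (word [i, j, i])"
      unfolding z_def by (simp only: tlinear_rules(2)[OF tlinear_tensor_mult(2)] tensor_mult_linear lmult_word)
    ultimately show ?thesis unfolding y_def tensor_Ad_eq[OF i z] by (simp only:)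
  qed
  have coef: "1 - q i j * q j i - q i i * q i j * q j i + q i i * q i j * q i j * q j i * q j i = 0"
    using r by algebra
  note skew_deriv_simps = skew_deriv_Cons skew_deriv_Nil lm0 gw lmult_word tensor_mult_linear
  have wj: "skew_deriv j (word [i, i, j]) = word [i, i]" "skew_deriv j (word [i, j, i]) = tscale (q j i) (word [i, i])"
    "skew_deriv j (word [j, i, i]) = tscale (q j i * q j i) (word [i, i])"
    using i j ij by (simp_all add: skew_deriv_simps)
  have wi: "skew_deriv i (word [i, i, j]) = tscale (q i i * q i j) (word [i, j]) + tscale (q i j) (word [i, j])"
    "skew_deriv i (word [i, j, i]) = tscale (q i j * q i i) (word [j, i]) + word [i, j]"
    "skew_deriv i (word [j, i, i]) = tscale (q i i) (word [j, i]) + word [j, i]"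
    using i j ij by (simp_all add: skew_deriv_simps)
  have "skew_deriv j y = tscale (1 - q i j * q j i - q i i * q i j * q j i + q i i * q i j * q i j * q j i * q j i) (word [i, i])"
    by (subst y_eq, simp only: tlinear_rules(2,3)[OF tlinear_skew_deriv] wj, rule ext,
        simp only: tscale_def minus_apply plus_fun_apply zero_fun_apply, algebra)
  then have sdj: "skew_deriv j y = 0" unfolding coef by (simp only: tensor.scale_zero_left)
  have sdi: "skew_deriv i y = 0"
    by (subst y_eq, simp only: tlinear_rules(2,3)[OF tlinear_skew_deriv] wi, rule ext,
        simp only: tscale_def minus_apply plus_fun_apply zero_fun_apply, algebra)
  have "F y = 0"
  proof (rule F_kernel[OF y])
    have "word (k # js) [] = 0" for k js by (simp add: word_def pure_simps)
    then show "y [] = 0" unfolding y_eq by (simp add: tscale_def)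
    fix k assume "k \<in> {1..n}"
    then have "k \<in> {i, j}" unfolding n .
    then consider "k = i" | "k = j" by blast
    then show "F (skew_deriv k y) = 0" by cases (simp_all only: sdi sdj F_0)
  qed
  then have "(?T ^^ (1 + 1)) (pure scale [x j]) = 0" by (simp add: T1 T2)
  moreover have "(?T ^^ 1) (pure scale [x j]) \<noteq> 0" using \<open>F z \<noteq> 0\<close> by (simp add: T1)
  ultimately show ?thesis unfolding has_nilpotency_order_def by (intro exI[of _ 1]) simp
qed

end

context group_type_braiding
begin

lemma pure_first_expand: "pure scale [v, u] = (\<Sum>i=1..n. tscale (\<xi> i v) (pure scale [x i, u]))"
proof -
  have lin: "pure scale [scale a w + v, u] = tscale a (pure scale [w, u]) + pure scale [v, u]" for a w v
    using pure_linear_entry[OF vector_space_scale, of "[]" a w v "[u]"] by simp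
  have zero: "pure scale [0, u] = 0"
    using lin[of 1 0 0] by (simp add: tensor.scale_one)
  have "pure scale [\<Sum>i\<in>A. scale (a i) (x i), u] = (\<Sum>i\<in>A. tscale (a i) (pure scale [x i, u]))"
    if "finite A" for a :: "nat \<Rightarrow> 'k" and A
    using that
  proof (induction A)
    case (insert i A)
    then show ?case using lin by simp
  qed (simp add: zero)
  from this[of "{1..n}" "\<lambda>i. \<xi> i v"] show ?thesis using expand_x[of v] by simp
qed

lemma vector_eqI: "(\<And>i. i \<in> {1..n} \<Longrightarrow> \<xi> i u = \<xi> i v) \<Longrightarrow> u = v"
  using expand_x[of u] expand_x[of v] by (metis (no_types, lifting) sum.cong)

text \<open>
  A vector of degree \<open>\<delta>\<close> has components only along the basis vectors of degree \<open>\<delta>\<close>.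
\<close>

lemma braids_by_coeff:
  assumes v: "braids_by \<delta> v" and l: "l \<in> {1..n}" "\<xi> l v \<noteq> 0"
  shows "\<delta> u = g l u"
proof -
  have csum: "c (\<Sum>i\<in>A. h i) = (\<Sum>i\<in>A. c (h i))" if "finite A" "\<And>i. i \<in> A \<Longrightarrow> h i \<in> T 2" for A :: "nat set" and h
    using that
  proof (induction A)
    case empty
    show ?case unfolding sum.empty by (rule linear_on_0[OF c_linear subspace_T])
  next
    case (insert i A)
    have "c (h i + (\<Sum>i\<in>A. h i)) = c (h i) + c (\<Sum>i\<in>A. h i)"
      using insert by (intro linear_on_add[OF c_linear] tensor.subspace_sum[OF subspace_T]) auto
    moreover have "c (\<Sum>i\<in>A. h i) = (\<Sum>i\<in>A. c (h i))" using insert by blast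
    ultimately show ?case unfolding sum.insert[OF insert(1,2)] by (simp only:)
  qed
  have contr: "contract (\<xi> l) (pure scale [u, w]) = tscale (\<xi> l w) (pure scale [u])" for u w
    using contract_pure[of "\<xi> l" "[u]" w] by (simp add: linear_\<xi>)
  have "pure scale [\<delta> u, v] = c (pure scale [v, u])"
    using v by (simp add: braids_by_def)
  also have "\<dots> = c (\<Sum>i=1..n. tscale (\<xi> i v) (pure scale [x i, u]))"
    by (rule arg_cong[OF pure_first_expand])
  also have "\<dots> = (\<Sum>i=1..n. tscale (\<xi> i v) (pure scale [g i u, x i]))"
  proof (subst csum)
    show "tscale (\<xi> i v) (pure scale [x i, u]) \<in> T 2" for i
      by (intro tensor.subspace_scale subspace_T pure_T) simp
    show "(\<Sum>i=1..n. c (tscale (\<xi> i v) (pure scale [x i, u]))) = (\<Sum>i=1..n. tscale (\<xi> i v) (pure scale [g i u, x i]))"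
    proof (rule sum.cong)
      fix i assume "i \<in> {1..n}"
      then have "c (pure scale [x i, u]) = pure scale [g i u, x i]" using braids_x by (simp add: braids_by_def)
      moreover have "pure scale [x i, u] \<in> T 2" by (rule pure_T) simp
      ultimately show "c (tscale (\<xi> i v) (pure scale [x i, u])) = tscale (\<xi> i v) (pure scale [g i u, x i])"
        using linear_on_scale[OF c_linear] by metis
    qed simp
  qed simp
  finally have "tscale (\<xi> l v) (pure scale [\<delta> u]) = contract (\<xi> l) (\<Sum>i=1..n. tscale (\<xi> i v) (pure scale [g i u, x i]))"
    using contr by metis
  also have "\<dots> = (\<Sum>i=1..n. contract (\<xi> l) (tscale (\<xi> i v) (pure scale [g i u, x i])))"
    by (rule tlinear_sum[OF tlinear_contract])
  also have "\<dots> = (\<Sum>i=1..n. if i = l then tscale (\<xi> l v) (pure scale [g l u]) else 0)"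
    using l(1) by (intro sum.cong) (auto simp: tlinear_rules[OF tlinear_contract] contr \<xi>_x)
  finally have "tscale (\<xi> l v) (pure scale [\<delta> u]) = tscale (\<xi> l v) (pure scale [g l u])" using l(1) by simp
  then have eq: "pure scale [\<delta> u] = pure scale [g l u]" using l(2) by (simp add: tensor.scale_cancel_left)
  show ?thesis
  proof (rule vector_eqI)
    fix i assume "i \<in> {1..n}"
    have "pure scale [\<delta> u] [\<xi> i] = pure scale [g l u] [\<xi> i]" by (simp only: eq)
    then show "\<xi> i (\<delta> u) = \<xi> i (g l u)" by (simp add: pure_simps linear_\<xi>)
  qed
qed

text \<open>
  The degree of \<open>g\<^sub>i x\<^sub>j\<close> is the conjugate of \<open>g\<^sub>j\<close> by \<open>g\<^sub>i\<close>.
\<close>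

lemma G_support:
  assumes "i \<in> {1..n}" "j \<in> {1..n}" "l \<in> {1..n}" "G i l j \<noteq> 0"
  shows "g l (g i u) = g i (g j u)"
proof -
  obtain \<delta> where "braids_by \<delta> (g i (x j))" "\<And>u. \<delta> (g i u) = g i (g j u)"
    using equivariant_g[OF assms(1)] braids_x[OF assms(2)] unfolding equivariant_def by blast
  then show ?thesis using braids_by_coeff[of \<delta> "g i (x j)" l] assms by (simp add: G_def)
qed

end

context finite_rank_braiding
begin

text \<open>
  If \<open>g\<^sub>i\<close> and \<open>g\<^sub>j\<close> do not commute, a component of \<open>g\<^sub>i x\<^sub>j\<close> yields a third basis vector whose degree is
  their conjugate.  The three degrees are distinct, which by \<open>G_support\<close> makes the coefficients vanish that
  \<open>no_three_cycle\<close> asks for.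
\<close>

lemma commuting_if_dim_cube:
  assumes p: "prime p" and d: "nichols_rank scale c = p ^ 3"
    and eig: "\<And>i. i \<in> {1..n} \<Longrightarrow> \<exists>a. g i (x i) = scale a (x i)"
    and ij: "i \<in> {1..n}" "j \<in> {1..n}"
  shows "g i (g j u) = g j (g i u)"
proof (rule ccontr)
  assume nc: "g i (g j u) \<noteq> g j (g i u)"
  have d': "tensor.dim NA = p ^ 3" using d by (simp add: nichols_rank_def)
  have p2: "2 \<le> p" using p by (rule prime_ge_2_nat)
  have "\<exists>Q e. nichols.self_eigen k Q \<and> 1 \<le> e \<and> q_order Q (p ^ e)" if k: "k \<in> {1..n}" for k
  proof -
    obtain a where a: "g k (x k) = scale a (x k)" using eig[OF k] by blast
    have self: "nichols.self_eigen k a"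
      using k by (auto simp: nichols.self_eigen_def G_def a dual.linear_scale[OF linear_\<xi>] \<xi>_x)
    obtain N where N: "q_order a N" "N dvd tensor.dim NA" using nichols.generator_order[OF k self] by blast
    obtain e where "1 \<le> e" "q_order a (p ^ e)" by (rule nichols.prime_power_order[OF p d' N])
    then show ?thesis using self by blast
  qed
  then obtain Q e where Qe: "\<And>k. k \<in> {1..n} \<Longrightarrow> nichols.self_eigen k (Q k) \<and> 1 \<le> e k \<and> q_order (Q k) (p ^ e k)"
    by metis
  have "(\<Prod>k=1..n. p ^ e k) \<le> p ^ 3"
    unfolding d'[symmetric] by (rule nichols.ordered_products[of Q]) (use Qe in auto)
  then have "(\<Sum>k=1..n. e k) \<le> 3"
    using p2 by (simp add: power_sum[symmetric] power_le_imp_le_exp)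
  moreover have "n \<le> (\<Sum>k=1..n. e k)" using sum_mono[of "{1..n}" "\<lambda>k. 1" e] Qe by simp
  ultimately have n3: "n \<le> 3" by simp
  have inj: "g k a = g k b \<longleftrightarrow> a = b" if "k \<in> {1..n}" for k a b
    using bij_g[OF that] by (simp add: bij_is_inj inj_eq)
  have surj: "\<exists>b. g k b = a" if "k \<in> {1..n}" for k a
    using bij_g[OF that] by (metis bij_is_surj surjD)
  have "g i (x j) \<noteq> 0"
  proof
    assume "g i (x j) = 0"
    moreover have "g i 0 = 0" using linear_g[OF ij(1)] by (simp add: linear_iff_module_hom module_hom.zero)
    ultimately show False using inj[OF ij(1)] x_nonzero[OF ij(2)] by metis
  qed
  then obtain l where l: "l \<in> {1..n}" "G i l j \<noteq> 0"
    using vector_eqI[of "g i (x j)" 0] dual.linear_0[OF linear_\<xi>] unfolding G_def by metis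
  have conj: "g l (g i v) = g i (g j v)" for v by (rule G_support[OF ij l])
  have neq: "i \<noteq> j" using nc by auto
  have "l \<noteq> j" using conj nc by metis
  have "l \<noteq> i"
  proof
    assume "l = i"
    then have "g i v = g j v" for v using conj inj[OF ij(1)] by metis
    then show False using nc by metis
  qed
  have "{i, j, l} \<subseteq> {1..n}" "card {i, j, l} = 3" using ij l neq \<open>l \<noteq> j\<close> \<open>l \<noteq> i\<close> by auto
  have "G j i j = 0"
  proof (rule ccontr)
    assume "G j i j \<noteq> 0"
    then have "g i (g j v) = g j (g j v)" for v by (rule G_support[OF ij(2) ij(2) ij(1)])
    then have "g i v = g j v" for v using surj[OF ij(2)] by metis
    then show False using nc by metis
  qed
  moreover have "G j i i = 0"
  proof (rule ccontr)
    assume "G j i i \<noteq> 0"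
    then show False using G_support[OF ij(2) ij(1) ij(1)] nc by metis
  qed
  moreover have "G l j l = 0"
  proof (rule ccontr)
    assume "G l j l \<noteq> 0"
    then have "g j (g l v) = g l (g l v)" for v by (rule G_support[OF l(1) l(1) ij(2)])
    then have "g j v = g l v" for v using surj[OF l(1)] by metis
    then show False using conj nc by metis
  qed
  moreover have "tensor.dim NA \<le> p ^ e j * p ^ e i * p ^ e l"
  proof -
    have "3 \<le> e j + e i + e l" using Qe[OF ij(1)] Qe[OF ij(2)] Qe[OF l(1)] by linarith
    then have "p ^ 3 \<le> p ^ (e j + e i + e l)" using p2 by (intro power_increasing) auto
    then show ?thesis unfolding d' by (simp add: power_add)
  qed
  ultimately show False
    using nichols.no_three_cycle[of i j l Q "\<lambda>k. p ^ e k"] ij l(1) neq \<open>l \<noteq> j\<close> \<open>l \<noteq> i\<close> Qe by auto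
qed

end

section \<open>Operators of finite order\<close>

lemma pderiv_double_root:
  fixes P :: "'k::field poly"
  assumes "P = [:-a, 1:] * ([:-a, 1:] * C)"
  shows "poly (pderiv P) a = 0"
  unfolding assms by (simp only: pderiv_mult poly_add poly_mult) simp

text \<open>
  The polynomial \<open>X\<^sup>m - 1\<close> splits, and a double root would be a root of its derivative \<open>m X\<^sup>m\<^sup>-\<^sup>1\<close>.
\<close>

lemma card_roots_of_unity:
  assumes m: "0 < m"
  shows "m \<le> card {z::'k::{alg_closed_field, field_char_0}. z ^ m = 1}"
proof -
  define P :: "'k poly" where "P = monom 1 m + [:-1:]"
  have P: "poly P z = z ^ m - 1" for z by (simp add: P_def poly_monom)
  have deg: "degree P = m"
    unfolding P_def using m by (subst degree_add_eq_left) (auto simp: degree_monom_eq)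
  have "P \<noteq> 0" using deg m by auto
  then obtain A where A: "size A = degree P" "P = smult (lead_coeff P) (\<Prod>z\<in>#A. [:-z, 1:])"
    using alg_closed_imp_factorization by blast
  have root: "z ^ m = 1" if zA: "z \<in># A" for z
  proof -
    have "[:-z, 1:] dvd P"
    proof -
      obtain A' where "A = add_mset z A'" using multi_member_split[OF zA] by blast
      then have "(\<Prod>z\<in>#A. [:-z, 1:]) = [:-z, 1:] * (\<Prod>z\<in>#A'. [:-z, 1:])"
        by (simp only: image_mset_add_mset prod_mset.add_mset)
      then show ?thesis using A(2) by (metis dvd_smult dvd_triv_left)
    qed
    then have "poly P z = 0" by (simp add: poly_eq_0_iff_dvd)
    then show ?thesis by (simp add: P)
  qed
  have "count A z \<le> 1" for z
  proof (rule ccontr)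
    assume "\<not> count A z \<le> 1"
    then obtain A' where A': "A = add_mset z (add_mset z A')"
    proof -
      have "z \<in># A" using \<open>\<not> count A z \<le> 1\<close> by (metis count_eq_zero_iff zero_le_one)
      from multi_member_split[OF this] obtain A1 where A1: "A = add_mset z A1" by blast
      then have "count A1 z \<noteq> 0" using \<open>\<not> count A z \<le> 1\<close> by simp
      then have "z \<in># A1" by (simp add: count_eq_zero_iff)
      from multi_member_split[OF this] obtain A2 where "A1 = add_mset z A2" by blast
      then show thesis using that A1 by blast
    qed
    have "z \<in># A" by (simp add: A')
    then have z: "z ^ m = 1" by (rule root)
    have "P = [:-z, 1:] * ([:-z, 1:] * smult (lead_coeff P) (\<Prod>z\<in>#A'. [:-z, 1:]))"
      by (subst A(2)) (simp only: A' image_mset_add_mset prod_mset.add_mset mult_smult_right)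
    then have "poly (pderiv P) z = 0" by (rule pderiv_double_root)
    then have "of_nat m * z ^ (m - 1) = 0"
      by (simp add: P_def pderiv_add pderiv_monom pderiv_pCons poly_monom)
    then have "z = 0" using m by (simp split: if_splits)
    then show False using z m by (simp add: power_0_left)
  qed
  then have "size A = card (set_mset A)"
  proof -
    assume le: "\<And>z. count A z \<le> 1"
    have "count A z = 1" if "z \<in> set_mset A" for z
      using le[of z] that count_greater_zero_iff[of A z] by linarith
    then have "(\<Sum>z\<in>set_mset A. count A z) = (\<Sum>z\<in>set_mset A. 1)" by (rule sum.cong[OF refl])
    then show ?thesis by (simp add: size_multiset_overloaded_eq)
  qed
  moreover have "finite {z::'k. z ^ m = 1}"
  proof -
    have "{z. z ^ m = 1} = {z. poly P z = 0}" by (simp add: P)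
    then show ?thesis using poly_roots_finite[OF \<open>P \<noteq> 0\<close>] by simp
  qed
  ultimately show ?thesis using A(1) deg root card_mono[of "{z. z ^ m = 1}" "set_mset A"] by auto
qed

lemma finite_roots_of_unity:
  assumes m: "0 < m"
  shows "finite {z::'k::field. z ^ m = 1}" and "card {z::'k. z ^ m = 1} \<le> m"
proof -
  define P :: "'k poly" where "P = monom 1 m + [:-1:]"
  have deg: "degree P = m"
    unfolding P_def using m by (subst degree_add_eq_left) (auto simp: degree_monom_eq)
  then have "P \<noteq> 0" using m by auto
  have "{z. z ^ m = 1} = {z. poly P z = 0}" by (simp add: P_def poly_monom)
  then show "finite {z::'k. z ^ m = 1}" "card {z::'k. z ^ m = 1} \<le> m"
    using poly_roots_finite[OF \<open>P \<noteq> 0\<close>] card_poly_roots_bound[OF \<open>P \<noteq> 0\<close>] deg by auto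
qed

text \<open>
  There are more than \<open>j\<close> roots, so one of them, \<open>w\<close>, has \<open>w\<^sup>j \<noteq> 1\<close>; multiplication by \<open>w\<close> permutes the roots and
  multiplies the sum by \<open>w\<^sup>j\<close>.
\<close>

lemma sum_roots_of_unity:
  assumes j: "0 < j" "j < m"
  shows "(\<Sum>z | z ^ m = 1. z ^ j) = (0 :: 'k::{alg_closed_field, field_char_0})"
proof -
  let ?Z = "{z::'k. z ^ m = 1}"
  have "\<not> ?Z \<subseteq> {z. z ^ j = 1}"
  proof
    assume "?Z \<subseteq> {z. z ^ j = 1}"
    then have "card ?Z \<le> card {z::'k. z ^ j = 1}"
      by (rule card_mono[OF finite_roots_of_unity(1)[OF j(1)]])
    then show False
      using card_roots_of_unity[of m, where 'k = 'k] finite_roots_of_unity(2)[OF j(1), where 'k = 'k] j by linarith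
  qed
  then obtain w :: 'k where w: "w ^ m = 1" "w ^ j \<noteq> 1" by blast
  then have "w \<noteq> 0" using j by (auto simp: power_0_left)
  have "(\<Sum>z\<in>?Z. z ^ j) = (\<Sum>z\<in>?Z. (w * z) ^ j)"
    by (rule sum.reindex_bij_witness[of _ "\<lambda>z. w * z" "\<lambda>z. z / w"])
      (use w \<open>w \<noteq> 0\<close> in \<open>auto simp: power_mult_distrib power_divide\<close>)
  also have "\<dots> = w ^ j * (\<Sum>z\<in>?Z. z ^ j)" by (simp add: power_mult_distrib sum_distrib_left)
  finally have "(1 - w ^ j) * (\<Sum>z\<in>?Z. z ^ j) = 0" by (simp add: algebra_simps)
  then show ?thesis using w by simp
qed

section \<open>Eigenbases and the classification\<close>

text \<open>
  The component for the root \<open>z\<close> is the average of the \<open>z\<^sup>j f\<^sup>j v\<close> over \<open>j < m\<close>, an eigenvector for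
  \<open>z\<^sup>-\<^sup>1\<close>.  As it is a combination of the \<open>f\<^sup>j v\<close>, it stays in every stable subspace that contains \<open>v\<close>.
\<close>

lemma eigen_decomposition:
  fixes scale :: "'k::{alg_closed_field, field_char_0} \<Rightarrow> 'v::ab_group_add \<Rightarrow> 'v"
  assumes vs: "vector_space scale" and f: "Vector_Spaces.linear scale scale f"
    and m: "0 < m" "f ^^ m = id"
    and S: "module.subspace scale S" "f ` S \<subseteq> S" "v \<in> S"
  obtains u where "v = (\<Sum>z | z ^ m = 1. u z)"
    "\<And>z. z ^ m = 1 \<Longrightarrow> u z \<in> S \<and> f (u z) = scale (inverse z) (u z)"
proof -
  interpret V: vector_space scale by fact
  interpret f: Vector_Spaces.linear scale scale f by fact
  let ?Z = "{z::'k. z ^ m = 1}"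
  define N :: 'k where "N = of_nat (card ?Z)"
  have "N \<noteq> 0" using card_roots_of_unity[OF m(1), where 'k = 'k] m(1) by (simp add: N_def)
  define u where "u z = scale (inverse N) (\<Sum>j<m. scale (z ^ j) ((f ^^ j) v))" for z
  have fS: "(f ^^ j) v \<in> S" for j using S by (induction j) auto
  have "v = (\<Sum>z\<in>?Z. u z)"
  proof -
    have "(\<Sum>z\<in>?Z. u z) = scale (inverse N) (\<Sum>j<m. scale (\<Sum>z\<in>?Z. z ^ j) ((f ^^ j) v))"
      unfolding u_def V.scale_sum_right[symmetric] V.scale_sum_left by (subst sum.swap) (rule refl)
    also have "(\<Sum>j<m. scale (\<Sum>z\<in>?Z. z ^ j) ((f ^^ j) v)) = (\<Sum>j<m. if j = 0 then scale N v else 0)"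
    proof (rule sum.cong)
      fix j assume "j \<in> {..<m}"
      then show "scale (\<Sum>z\<in>?Z. z ^ j) ((f ^^ j) v) = (if j = 0 then scale N v else 0)"
        using sum_roots_of_unity[of j m, where 'k = 'k] by (cases "j = 0") (auto simp: N_def)
    qed simp
    also have "\<dots> = scale N v" using m(1) by simp
    finally show ?thesis using \<open>N \<noteq> 0\<close> by simp
  qed
  moreover have "u z \<in> S \<and> f (u z) = scale (inverse z) (u z)" if z: "z ^ m = 1" for z
  proof
    show "u z \<in> S" unfolding u_def
      by (intro V.subspace_scale V.subspace_sum S(1) fS)
    have "z \<noteq> 0" using z m(1) by (auto simp: power_0_left)
    have "scale z (f (\<Sum>j<m. scale (z ^ j) ((f ^^ j) v))) = (\<Sum>j<m. scale (z ^ Suc j) ((f ^^ Suc j) v))"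
      by (simp add: f.sum f.scale V.scale_sum_right)
    also have "\<dots> = (\<Sum>j<Suc m. scale (z ^ j) ((f ^^ j) v)) - v"
      unfolding sum.lessThan_Suc_shift by simp
    also have "\<dots> = (\<Sum>j<m. scale (z ^ j) ((f ^^ j) v))"
      by (simp add: z m(2))
    finally have "scale z (f (u z)) = u z"
      unfolding u_def f.scale V.scale_left_commute[of z "inverse N"] by (simp only:)
    then show "f (u z) = scale (inverse z) (u z)"
      using \<open>z \<noteq> 0\<close> by (metis V.scale_scale left_inverse V.scale_one)
  qed
  ultimately show thesis by (rule that)
qed

text \<open>
  Split \<open>v\<close> into eigenvectors of one operator; its eigenspaces are stable under the others.
\<close>

lemma joint_eigenvectors_span:
  fixes scale :: "'k::{alg_closed_field, field_char_0} \<Rightarrow> 'v::ab_group_add \<Rightarrow> 'v"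
  assumes vs: "vector_space scale" and fin: "finite \<F>"
    and lin: "\<And>f. f \<in> \<F> \<Longrightarrow> Vector_Spaces.linear scale scale f"
    and ord: "\<And>f. f \<in> \<F> \<Longrightarrow> \<exists>m>0. f ^^ m = id"
    and comm: "\<And>f h u. f \<in> \<F> \<Longrightarrow> h \<in> \<F> \<Longrightarrow> f (h u) = h (f u)"
    and S: "module.subspace scale S" "\<And>f. f \<in> \<F> \<Longrightarrow> f ` S \<subseteq> S" "v \<in> S"
  shows "v \<in> module.span scale {u \<in> S. \<forall>f\<in>\<F>. \<exists>a. f u = scale a u}"
proof -
  interpret V: vector_space scale by fact
  show ?thesis
    using fin lin ord comm S
  proof (induction \<F> arbitrary: S v)
    case empty
    then show ?case by (simp add: V.span_base)
  next
    case (insert f \<F>)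
    interpret f: Vector_Spaces.linear scale scale f using insert.prems(1) by blast
    obtain m where m: "0 < m" "f ^^ m = id" using insert.prems(2) by blast
    obtain u where u: "v = (\<Sum>z | z ^ m = 1. u z)"
      "\<And>z. z ^ m = 1 \<Longrightarrow> u z \<in> S \<and> f (u z) = scale (inverse z) (u z)"
      using eigen_decomposition[OF vs insert.prems(1)[of f] m insert.prems(4) _ insert.prems(6)] insert.prems(5)[of f]
      by blast
    let ?E = "{u \<in> S. \<forall>h\<in>insert f \<F>. \<exists>a. h u = scale a u}"
    have "u z \<in> V.span ?E" if z: "z ^ m = 1" for z
    proof -
      let ?S = "{w \<in> S. f w = scale (inverse z) w}"
      have "u z \<in> V.span {w \<in> ?S. \<forall>h\<in>\<F>. \<exists>a. h w = scale a w}"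
      proof (rule insert.IH)
        show "V.subspace ?S"
          using insert.prems(4) by (auto simp: V.subspace_def f.zero f.add f.scale V.scale_right_distrib V.scale_left_commute)
        show "h ` ?S \<subseteq> ?S" if h: "h \<in> \<F>" for h
        proof
          fix y assume "y \<in> h ` ?S"
          then obtain w where w: "w \<in> S" "f w = scale (inverse z) w" "y = h w" by blast
          interpret h: Vector_Spaces.linear scale scale h using insert.prems(1) h by blast
          have "f (h w) = h (f w)" using insert.prems(3) h by blast
          then have "f y = scale (inverse z) y" by (simp add: w h.scale)
          moreover have "y \<in> S" using insert.prems(5)[of h] h w by blast
          ultimately show "y \<in> ?S" by blast
        qed
        show "u z \<in> ?S" using u(2)[OF z] by blast
      qed (use insert.prems in blast)+
      moreover have "{w \<in> ?S. \<forall>h\<in>\<F>. \<exists>a. h w = scale a w} \<subseteq> ?E" by blast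
      ultimately show ?thesis using V.span_mono by blast
    qed
    then show ?case unfolding u(1) by (intro V.span_sum) blast
  qed
qed

lemma finite_order_in_GL:
  assumes fin: "finite (generate (GL scale) X)" and g: "g \<in> X" "bij g"
  shows "\<exists>m>0. g ^^ m = id"
proof -
  have "g ^^ k \<in> generate (GL scale) X" for k
  proof (induction k)
    case 0
    have "\<one>\<^bsub>GL scale\<^esub> = id" by (simp add: GL_def)
    then show ?case using generate.one[of "GL scale" X] by (simp only: funpow_0 funpow.simps(1))
  next
    case (Suc k)
    have "g \<otimes>\<^bsub>GL scale\<^esub> (g ^^ k) \<in> generate (GL scale) X"
      by (rule generate.eng[OF generate.incl[OF g(1)] Suc])
    moreover have "g \<otimes>\<^bsub>GL scale\<^esub> (g ^^ k) = g ^^ Suc k" by (simp add: GL_def)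
    ultimately show ?case by (simp only:)
  qed
  then have "range (\<lambda>k. g ^^ k) \<subseteq> generate (GL scale) X" by blast
  then have "\<not> inj (\<lambda>k::nat. g ^^ k)"
    using fin finite_subset finite_imageD infinite_UNIV_nat by metis
  then obtain a b :: nat where ab: "g ^^ a = g ^^ b" "a < b"
    unfolding inj_def by (metis linorder_neqE_nat)
  have inj: "inj (g ^^ a)" using bij_betw_funpow[OF g(2)] by (rule bij_is_inj)
  have "g ^^ b = g ^^ a \<circ> g ^^ (b - a)" using funpow_add[of a "b - a" g] ab(2) by simp
  then have "(g ^^ a) ((g ^^ (b - a)) u) = (g ^^ a) u" for u using ab(1) by (metis comp_apply)
  then have "(g ^^ (b - a)) u = u" for u by (rule injD[OF inj])
  then have "g ^^ (b - a) = id" by (simp add: fun_eq_iff)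
  then show ?thesis using ab(2) by (intro exI[of _ "b - a"]) simp
qed

context braided_vector_space
begin

lemma pure_pair_linear:
  "pure scale [scale a u + v, w] = tscale a (pure scale [u, w]) + pure scale [v, w]"
  "pure scale [w, scale a u + v] = tscale a (pure scale [w, u]) + pure scale [w, v]"
  using pure_linear_entry[OF vector_space_scale, of "[]" a u v "[w]"]
    pure_linear_entry[OF vector_space_scale, of "[w]" a u v "[]"] by simp_all

lemma pure_pair_0: "pure scale [0, w] = 0" "pure scale [w, 0] = 0"
proof -
  interpret V: vector_space scale by (rule vector_space_scale)
  show "pure scale [0, w] = 0"
    using pure_pair_linear(1)[of 1 0 0 w] by (simp add: tensor.scale_one)
  show "pure scale [w, 0] = 0"
    using pure_pair_linear(2)[of w 1 0 0] by (simp add: tensor.scale_one)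
qed

lemma c_pair_linear:
  "c (tscale a (pure scale [u, v]) + pure scale [u', v']) = tscale a (c (pure scale [u, v])) + c (pure scale [u', v'])"
proof -
  have p: "pure scale [u, v] \<in> T 2" for u v by (rule pure_T) simp
  show ?thesis
    unfolding linear_on_add[OF c_linear tensor.subspace_scale[OF subspace_T p] p] linear_on_scale[OF c_linear p] ..
qed

text \<open>
  This is what allows the basis of \<open>V\<close> to be changed within each homogeneous component.
\<close>

lemma subspace_braids_by: "module.subspace scale {v. braids_by \<gamma> v}"
proof -
  interpret V: vector_space scale by (rule vector_space_scale)
  have c0: "c 0 = 0" by (rule linear_on_0[OF c_linear subspace_T])
  have lin: "braids_by \<gamma> (scale a v + w)" if "braids_by \<gamma> v" "braids_by \<gamma> w" for a v w
    using that unfolding braids_by_def pure_pair_linear c_pair_linear by metis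
  have zero: "braids_by \<gamma> 0" unfolding braids_by_def pure_pair_0 c0 by blast
  have "braids_by \<gamma> (v + w)" if "braids_by \<gamma> v" "braids_by \<gamma> w" for v w
    using lin[OF that, of 1] by (simp only: V.scale_one)
  moreover have "braids_by \<gamma> (scale a v)" if "braids_by \<gamma> v" for a v
    using lin[OF that zero, of a] by (simp only: add_0_right)
  ultimately show ?thesis unfolding V.subspace_def using zero by blast
qed

lemma braids_by_on_basis:
  assumes span: "module.span scale X = UNIV" and g: "Vector_Spaces.linear scale scale h"
    and c: "\<And>u. u \<in> X \<Longrightarrow> c (pure scale [v, u]) = pure scale [h u, v]"
  shows "braids_by h v"
  unfolding braids_by_def
proof
  interpret V: vector_space scale by (rule vector_space_scale)
  have h: "module_hom scale scale h" using g by (simp add: linear_iff_module_hom)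
  have c0: "c 0 = 0" by (rule linear_on_0[OF c_linear subspace_T])
  fix u
  have "u \<in> V.span X" unfolding span by (rule UNIV_I)
  then show "c (pure scale [v, u]) = pure scale [h u, v]"
  proof (induction rule: V.span_induct_alt)
    case base
    show ?case unfolding module_hom.zero[OF h] pure_pair_0 by (rule c0)
  next
    case (step a u w)
    show ?case
      unfolding pure_pair_linear c_pair_linear module_hom.add[OF h] module_hom.scale[OF h] step.IH c[OF step(1)] ..
  qed
qed

end

lemma group_type_braiding_of_group_braiding:
  assumes "vector_space scale" "braided_pair scale c" "group_braiding scale c n x g"
  shows "group_type_braiding scale c n x g"
proof -
  interpret braided_vector_space scale c using assms(1,2) by (rule braided_vector_space.intro)
  show ?thesis
  proof (intro group_type_braiding.intro group_type_braiding_axioms.intro)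
    show "braided_vector_space scale c" by (rule braided_vector_space_axioms)
    fix i assume i: "i \<in> {1..n}"
    show "Vector_Spaces.linear scale scale (g i)" "bij (g i)"
      using assms(3) i by (auto simp: group_braiding_def GL_def)
    then show "braids_by (g i) (x i)"
      using assms(3) i by (intro braids_by_on_basis[of "x ` {1..n}"]) (auto simp: group_braiding_def basis_family_def)
  qed (use assms(3) in \<open>simp add: group_braiding_def\<close>)
qed

text \<open>
  The operators in \<open>\<F> i\<close> commute with \<open>h i\<close> and therefore preserve the component of degree \<open>h i\<close>.  That
  component is spanned by joint eigenvectors, and a basis of \<open>V\<close> can be selected from these.
\<close>

lemma eigenbasis:
  fixes scale :: "'k::{alg_closed_field, field_char_0} \<Rightarrow> 'v::ab_group_add \<Rightarrow> 'v"
  assumes gt: "group_type_braiding scale c m y h"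
    and ord: "\<And>i. i \<in> {1..m} \<Longrightarrow> \<exists>k>0. h i ^^ k = id"
    and \<F>: "\<And>i. i \<in> {1..m} \<Longrightarrow> \<F> i \<subseteq> h ` {1..m}"
    and comm: "\<And>i f f' u. i \<in> {1..m} \<Longrightarrow> f \<in> insert (h i) (\<F> i) \<Longrightarrow> f' \<in> insert (h i) (\<F> i) \<Longrightarrow> f (f' u) = f' (f u)"
  obtains n x g where "group_type_braiding scale c n x g"
    "\<And>k. k \<in> {1..n} \<Longrightarrow> \<exists>i\<in>{1..m}. g k = h i \<and> (\<forall>f\<in>\<F> i. \<exists>a. f (x k) = scale a (x k))"
proof -
  interpret A: group_type_braiding scale c m y h by fact
  define E where "E = {v. \<exists>i\<in>{1..m}. A.braids_by (h i) v \<and> (\<forall>f\<in>\<F> i. \<exists>a. f v = scale a v)}"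
  have "y i \<in> A.V.span E" if i: "i \<in> {1..m}" for i
  proof -
    let ?S = "{v. A.braids_by (h i) v}"
    have "y i \<in> A.V.span {u \<in> ?S. \<forall>f\<in>\<F> i. \<exists>a. f u = scale a u}"
    proof (rule joint_eigenvectors_span[OF A.vector_space_scale])
      show "finite (\<F> i)" using \<F>[OF i] finite_subset by blast
      show "A.V.subspace ?S" by (rule A.subspace_braids_by)
      show "y i \<in> ?S" using A.braids_x[OF i] by simp
      fix f assume f: "f \<in> \<F> i"
      then obtain j where j: "j \<in> {1..m}" "f = h j" using \<F>[OF i] by blast
      show "Vector_Spaces.linear scale scale f" unfolding j(2) by (rule A.linear_g[OF j(1)])
      show "\<exists>m>0. f ^^ m = id" unfolding j(2) by (rule ord[OF j(1)])
      show "f (f' u) = f' (f u)" if "f' \<in> \<F> i" for f' u using comm[OF i] f that by blast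
      show "f ` ?S \<subseteq> ?S"
      proof clarify
        fix v assume v: "A.braids_by (h i) v"
        obtain \<delta> where \<delta>: "A.braids_by \<delta> (f v)" "\<And>u. \<delta> (f u) = f (h i u)"
          using A.equivariant_g[OF j(1)] v unfolding A.equivariant_def j(2) by blast
        have "\<delta> w = h i w" for w
        proof -
          obtain u where "w = f u" using A.bij_g[OF j(1)] unfolding j(2) by (metis bij_is_surj surjD)
          then show ?thesis using \<delta>(2) comm[OF i, of f "h i" u] f by simp
        qed
        then have "\<delta> = h i" by blast
        then show "A.braids_by (h i) (f v)" using \<delta>(1) by simp
      qed
    qed
    moreover have "{u \<in> ?S. \<forall>f\<in>\<F> i. \<exists>a. f u = scale a u} \<subseteq> E" using i unfolding E_def by blast
    ultimately show ?thesis using A.V.span_mono by blast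
  qed
  then have "y ` {1..m} \<subseteq> A.V.span E" by blast
  then have "A.V.span (y ` {1..m}) \<subseteq> A.V.span E" by (rule A.V.span_minimal) simp
  then have span_E: "A.V.span E = UNIV" unfolding A.span_x by blast
  obtain X where X: "X \<subseteq> E" "A.V.independent X" "E \<subseteq> A.V.span X"
    by (rule A.V.maximal_independent_subset)
  have "A.V.span E \<subseteq> A.V.span X" using X(3) by (rule A.V.span_minimal) simp
  then have span_X: "A.V.span X = UNIV" unfolding span_E by blast
  have "finite X"
  proof -
    have "X \<subseteq> A.V.span (y ` {1..m})" unfolding A.span_x by (rule subset_UNIV)
    then show ?thesis using A.V.independent_span_bound[OF finite_imageI X(2)] by blast
  qed
  then obtain x where x: "bij_betw x {1..card X} X" using ex_bij_betw_nat_finite_1 by blast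
  have "\<forall>k\<in>{1..card X}. \<exists>i\<in>{1..m}. A.braids_by (h i) (x k) \<and> (\<forall>f\<in>\<F> i. \<exists>a. f (x k) = scale a (x k))"
    using x X(1) bij_betwE unfolding E_def by blast
  then obtain \<iota> where \<iota>: "\<And>k. k \<in> {1..card X} \<Longrightarrow> \<iota> k \<in> {1..m} \<and> A.braids_by (h (\<iota> k)) (x k) \<and>
      (\<forall>f\<in>\<F> (\<iota> k). \<exists>a. f (x k) = scale a (x k))"
    by metis
  have "group_type_braiding scale c (card X) x (\<lambda>k. h (\<iota> k))"
  proof (intro group_type_braiding.intro group_type_braiding_axioms.intro)
    show "braided_vector_space scale c" by (rule A.braided_vector_space_axioms)
    show "basis_family scale (card X) x"
      using x X(2) span_X unfolding basis_family_def bij_betw_def by simp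
  qed (use \<iota> A.linear_g A.bij_g in auto)
  then show thesis using that[of "card X" x "\<lambda>k. h (\<iota> k)"] \<iota> by blast
qed

text \<open>
  The eigenbasis is chosen twice.  The first choice only diagonalises each \<open>h i\<close> on its own component, which
  suffices for \<open>commuting_if_dim_cube\<close>; once the \<open>h i\<close> are known to commute, all of them can be diagonalised at
  once.
\<close>

lemma diagonal_type_of_dim_cube:
  fixes scale :: "'k::{alg_closed_field, field_char_0} \<Rightarrow> 'v::ab_group_add \<Rightarrow> 'v"
  assumes vs: "vector_space scale" and p: "prime p" and bp: "braided_pair scale c"
    and fg: "finite_group_type scale c" and rank: "nichols_rank scale c = p ^ 3"
  obtains n x g q where "diagonal_type_braiding scale c n x g q"
proof -
  obtain m y h where gb: "group_braiding scale c m y h" and fin: "finite (generate (GL scale) (h ` {1..m}))"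
    using fg unfolding finite_group_type_def by blast
  have gt: "group_type_braiding scale c m y h"
    by (rule group_type_braiding_of_group_braiding[OF vs bp gb])
  interpret A: group_type_braiding scale c m y h by fact
  have ord: "\<exists>k>0. h i ^^ k = id" if "i \<in> {1..m}" for i
    using finite_order_in_GL[OF fin _ A.bij_g[OF that]] that by blast
  have comm: "h i (h j u) = h j (h i u)" if ij: "i \<in> {1..m}" "j \<in> {1..m}" for i j u
  proof -
    obtain n x g where B: "group_type_braiding scale c n x g"
      and eig: "\<And>k. k \<in> {1..n} \<Longrightarrow> \<exists>i\<in>{1..m}. g k = h i \<and> (\<forall>f\<in>{h i}. \<exists>a. f (x k) = scale a (x k))"
      by (rule eigenbasis[OF gt ord, of "\<lambda>i. {h i}"]) auto
    interpret B: group_type_braiding scale c n x g by fact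
    have "p ^ 3 \<noteq> 0" using p by (simp add: prime_gt_0_nat)
    then interpret B: finite_rank_braiding scale c n x g by unfold_locales (simp add: rank)
    have "\<exists>k\<in>{1..n}. h i = g k" if i: "i \<in> {1..m}" for i
    proof -
      have "y i \<noteq> 0" by (rule A.x_nonzero[OF i])
      then obtain k where k: "k \<in> {1..n}" "B.\<xi> k (y i) \<noteq> 0"
        using B.vector_eqI[of "y i" 0] A.dual.linear_0[OF B.linear_\<xi>] by metis
      have "h i u = g k u" for u by (rule B.braids_by_coeff[OF A.braids_x[OF i] k])
      then show ?thesis using k(1) by blast
    qed
    then obtain k l where "k \<in> {1..n}" "h i = g k" "l \<in> {1..n}" "h j = g l" using ij by metis
    moreover have "\<exists>a. g k (x k) = scale a (x k)" if "k \<in> {1..n}" for k using eig[OF that] by auto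
    ultimately show ?thesis using B.commuting_if_dim_cube[OF p rank] by metis
  qed
  obtain n x g where B: "group_type_braiding scale c n x g"
    and eig: "\<And>k. k \<in> {1..n} \<Longrightarrow> \<exists>i\<in>{1..m}. g k = h i \<and> (\<forall>f\<in>h ` {1..m}. \<exists>a. f (x k) = scale a (x k))"
    by (rule eigenbasis[OF gt ord, of "\<lambda>i. h ` {1..m}"]) (use comm in auto)
  have "\<exists>a. g k (x l) = scale a (x l)" if "k \<in> {1..n}" "l \<in> {1..n}" for k l
    using eig[OF that(1)] eig[OF that(2)] by (metis image_eqI)
  then obtain q where "\<And>k l. k \<in> {1..n} \<Longrightarrow> l \<in> {1..n} \<Longrightarrow> g k (x l) = scale (q k l) (x l)" by metis
  then have "diagonal_type_braiding scale c n x g q"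
    using B by (simp add: diagonal_type_braiding_def diagonal_type_braiding_axioms_def)
  then show thesis by (rule that)
qed

theorem theorem6p1:
  fixes scale :: "'k::{alg_closed_field, field_char_0} \<Rightarrow> 'v::ab_group_add \<Rightarrow> 'v"
    and c :: "('k, 'v) tensor \<Rightarrow> ('k, 'v) tensor"
    and p :: nat
  assumes "vector_space scale"
    and "\<exists>B. finite B \<and> module.span scale B = UNIV"
    and "prime p"
    and "braided_pair scale c"
    and "finite_group_type scale c"
    and "nichols_rank scale c = p ^ 3"
  shows "diagonal_group_type scale c \<and>
    (\<exists>n x q. diagonal_braiding scale c n x q \<and>
      ((vector_space.dim scale (UNIV :: 'v set) = 3 \<and> quantum_linear_space n q \<and>
          root_order (q 1 1) = enat p \<and> root_order (q 2 2) = enat p \<and>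
          root_order (q 3 3) = enat p) \<or>
       (vector_space.dim scale (UNIV :: 'v set) = 2 \<and> quantum_linear_space n q \<and>
          root_order (q 1 1) = enat p \<and> root_order (q 2 2) = enat (p ^ 2)) \<or>
       (vector_space.dim scale (UNIV :: 'v set) = 2 \<and> type_A2 scale c x \<and>
          q 1 1 = q 2 2 \<and> q 2 2 = inverse (q 1 2 * q 2 1) \<and>
          root_order (q 1 1) = enat p) \<or>
       (vector_space.dim scale (UNIV :: 'v set) = 1 \<and> quantum_linear_space n q \<and>
          root_order (q 1 1) = enat (p ^ 3))))"
proof -
  obtain n x g q where D: "diagonal_type_braiding scale c n x g q"
    by (rule diagonal_type_of_dim_cube[OF assms(1,3,4,5,6)])
  interpret D: diagonal_type_braiding scale c n x g q by fact
  have "p ^ 3 \<noteq> 0" using assms(3) by (simp add: prime_gt_0_nat)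
  then interpret D: finite_rank_braiding scale c n x g by unfold_locales (simp add: assms(6))
  interpret N: diagonal_calculus D.NA n D.\<xi> D.R D.G q
    by unfold_locales (use D.G_diagonal D.q_nonzero in auto)
  have dim: "vector_space.dim scale (UNIV :: 'v set) = n"
  proof -
    have "D.V.dim (D.V.span (x ` {1..n})) = card (x ` {1..n})"
      by (rule D.V.dim_span_eq_card_independent[OF D.indep])
    then show ?thesis unfolding D.span_x using card_image[OF D.inj_x] by simp
  qed
  have diag: "diagonal_braiding scale c n x q" by (rule D.diagonal_braiding_q)
  have d: "tensor.dim D.NA = p ^ 3" using assms(6) by (simp add: nichols_rank_def)
  have type: "diagonal_group_type scale c" using diag unfolding diagonal_group_type_def by blast
  show ?thesis
  proof (rule N.classification_dim_cube[OF assms(3) d])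
    assume "n = 3" "quantum_linear_space n q" "\<And>i. i \<in> {1..3} \<Longrightarrow> q_order (q i i) p"
    then show ?thesis using diag dim
      by (intro conjI[OF type] exI[of _ n] exI[of _ x] exI[of _ q]) (simp add: q_order_imp_root_order)
  next
    fix i j
    assume ij: "n = 2" "{i, j} = {1, 2}" and qls: "quantum_linear_space n q"
      and ord: "q_order (q i i) p" "q_order (q j j) (p ^ 2)"
    \<comment> \<open>renumber the basis such that the generator of order \<open>p\<close> comes first\<close>
    define \<pi> where "\<pi> k = (if k = 1 then i else j)" for k :: nat
    have \<pi>: "bij_betw \<pi> {1..n} {1..n}"
    proof -
      have "{1..n} = {1, 2}" using ij(1) by auto
      moreover have "\<pi> ` {1, 2} = {1, 2}" using ij(2) by (auto simp: \<pi>_def)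
      moreover have "inj_on \<pi> {1, 2}" using ij(2) by (auto simp: \<pi>_def inj_on_def doubleton_eq_iff)
      ultimately show ?thesis by (simp add: bij_betw_def)
    qed
    have \<pi>_mem: "\<pi> k \<in> {1..n}" if "k \<in> {1..n}" for k using \<pi> that bij_betwE by blast
    have "diagonal_braiding scale c n (\<lambda>k. x (\<pi> k)) (\<lambda>k l. q (\<pi> k) (\<pi> l))"
    proof -
      have im: "(\<lambda>k. x (\<pi> k)) ` {1..n} = x ` {1..n}"
        using \<pi> by (metis bij_betw_imp_surj_on image_image)
      have "inj_on (\<lambda>k. x (\<pi> k)) {1..n}"
        using comp_inj_on[of \<pi> "{1..n}" x] \<pi> D.inj_x by (simp add: bij_betw_def o_def)
      then show ?thesis
        using diag \<pi>_mem unfolding diagonal_braiding_def basis_family_def im by blast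
    qed
    moreover have "quantum_linear_space n (\<lambda>k l. q (\<pi> k) (\<pi> l))"
      using qls \<pi>_mem \<pi> unfolding quantum_linear_space_def bij_betw_def inj_on_def by blast
    moreover have "q (\<pi> 1) (\<pi> 1) = q i i" "q (\<pi> 2) (\<pi> 2) = q j j" by (simp_all add: \<pi>_def)
    ultimately show ?thesis using ord dim ij(1)
      by (intro conjI[OF type] exI[of _ n] exI[of _ "\<lambda>k. x (\<pi> k)"] exI[of _ "\<lambda>k l. q (\<pi> k) (\<pi> l)"])
        (simp add: q_order_imp_root_order)
  next
    assume A: "n = 2" "q 1 2 * q 2 1 \<noteq> 1" "q 1 1 * (q 1 2 * q 2 1) = 1" "q 2 2 = q 1 1" "q_order (q 1 1) p"
    have ix: "1 \<in> {1..n}" "2 \<in> {1..n}" "{1..n} = {1, 2}" "{1..n} = {2, 1}" using A(1) by auto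
    have "has_nilpotency_order (nichols_Ad scale c (x 1)) (pure scale [x 2]) 2"
      by (rule D.type_A2_vanishing[OF ix(1,2) _ A(2,3) ix(3)]) simp
    moreover have "has_nilpotency_order (nichols_Ad scale c (x 2)) (pure scale [x 1]) 2"
    proof (rule D.type_A2_vanishing[OF ix(2,1) _ _ _ ix(4)])
      have s: "q 2 1 * q 1 2 = q 1 2 * q 2 1" by (rule mult.commute)
      show "q 2 1 * q 1 2 \<noteq> 1" unfolding s by (rule A(2))
      show "q 2 2 * (q 2 1 * q 1 2) = 1" unfolding s A(4) by (rule A(3))
    qed simp
    ultimately have "type_A2 scale c x" by (simp add: type_A2_def)
    moreover have "q 2 2 = inverse (q 1 2 * q 2 1)"
    proof -
      have "q 1 2 * q 2 1 * q 1 1 = 1" by (subst mult.commute) (rule A(3))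
      then have "inverse (q 1 2 * q 2 1) = q 1 1" by (rule inverse_unique)
      then show ?thesis unfolding A(4) by (rule sym)
    qed
    ultimately show ?thesis using diag dim A
      by (intro conjI[OF type] exI[of _ n] exI[of _ x] exI[of _ q]) (simp add: q_order_imp_root_order)
  next
    assume A: "n = 1" "q_order (q 1 1) (p ^ 3)"
    have "quantum_linear_space n q" using A(1) by (auto simp: quantum_linear_space_def)
    then show ?thesis using diag dim A
      by (intro conjI[OF type] exI[of _ n] exI[of _ x] exI[of _ q]) (simp add: q_order_imp_root_order)
  qed
qed

end
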